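(* Let $f:\mathbb T^n\to\mathbb T^n$ be a hyperbolic toral automorphism and let $\epsilon>0$. For a $C^2$ unit vector field $V$ on $\mathbb T^n$ let $\mathcal F_V$ be the rank 1 random perturbation of $f$ along $V$ of size $\epsilon$. Then there is a residual subset $\mathcal V$ of the space of $C^2$ unit vector fields on $\mathbb T^n$ (with the $C^2$ topology) such that for every $V\in\mathcal V$ all the invariant measures of $\mathcal F_V$ are absolutely continuous with respect to the Riemannian measure $m$ on $\mathbb T^n$.
   Context: $\mathbb T^n=\mathbb R^n/\mathbb Z^n$ with its standard flat metric. For $x\in \mathbb T^n$, $I_\epsilon(x)$ is the arc through $x$ of the integral curve of $V$, namely the maximal connected piece containing $x$ all of whose points are at Riemannian distance $\le\epsilon$ from $x$. $Q_x$ is the uniform distribution (normalized one-dimensional Riemannian measure) on $I_\epsilon(x)$. The rank 1 random perturbation $\mathcal F_V$ of $f$ is the Markov chain with transition probabilities $P(\cdot|x)=Q_{f(x)}$. An invariant measure of $\mathcal F_V$ is a Borel probability measure $\mu$ with $\int P(A|x)\,d\mu(x)=\mu(A)$ for all Borel $A$. A residual set is one containing a countable intersection of open dense sets. *)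

theory Defs
  imports "HOL-Analysis.Analysis" "HOL-Probability.Probability"
begin

section \<open>The flat torus\<close>

definition lattice_rel :: "real ^ 'n \<Rightarrow> real ^ 'n \<Rightarrow> bool" where
  "lattice_rel x y \<longleftrightarrow> (\<forall>i. x $ i - y $ i \<in> \<int>)"

lemma lattice_rel_refl: "lattice_rel x x"
  by (simp add: lattice_rel_def)

lemma lattice_rel_sym: "lattice_rel x y \<Longrightarrow> lattice_rel y x"
  by (auto simp: lattice_rel_def) (metis Ints_minus minus_diff_eq)

lemma lattice_rel_trans: "lattice_rel x y \<Longrightarrow> lattice_rel y z \<Longrightarrow> lattice_rel x z"
  unfolding lattice_rel_def by (metis Ints_add add_diff_eq diff_add_cancel)

quotient_type 'n torus = "real ^ 'n::finite" / lattice_rel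
  by (intro equivpI reflpI sympI transpI)
    (auto intro: lattice_rel_refl lattice_rel_sym lattice_rel_trans)

lemma abs_torus_eq_iff: "abs_torus x = abs_torus y \<longleftrightarrow> lattice_rel x y"
  by (rule torus.abs_eq_iff)

lemma abs_rep_torus [simp]: "abs_torus (rep_torus p) = p"
  by (rule Quotient3_abs_rep[OF Quotient3_torus])

lemma torus_cases [case_names abs]: obtains x where "p = abs_torus x"
  by (metis abs_rep_torus)

lemma abs_torus_translate:
  assumes "lattice_rel x y"
  shows "abs_torus (z + (x - y)) = abs_torus z"
  using assms by (auto simp: abs_torus_eq_iff lattice_rel_def)

instantiation torus :: (finite) metric_space
begin

text \<open>
  The projection from Euclidean space is a local isometry, so the Riemannian distance of the
  flat torus is the distance of the two fibres.
\<close>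

definition dist_torus :: "'a torus \<Rightarrow> 'a torus \<Rightarrow> real" where
  "dist_torus p q = (INF (x, y) \<in> {(x, y). abs_torus x = p \<and> abs_torus y = q}. dist x y)"

definition uniformity_torus :: "('a torus \<times> 'a torus) filter" where
  "uniformity_torus = (INF e\<in>{0 <..}. principal {(x, y). dist x y < e})"

definition open_torus :: "'a torus set \<Rightarrow> bool" where
  "open_torus U \<longleftrightarrow> (\<forall>x\<in>U. \<forall>\<^sub>F (x', y) in uniformity. x' = x \<longrightarrow> y \<in> U)"

lemma dist_torus_le: "dist (abs_torus x) (abs_torus y) \<le> dist x y"
proof -
  have "bdd_below ((\<lambda>(x, y). dist x y) ` {(x', y'). abs_torus x' = abs_torus x \<and> abs_torus y' = abs_torus y})"
    by (rule bdd_belowI[of _ 0]) auto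
  then show ?thesis
    unfolding dist_torus_def by (rule cINF_lower2[of _ _ "(x, y)"]) auto
qed

lemma dist_torus_less:
  assumes "dist (abs_torus x) q < r"
  obtains y where "q = abs_torus y" "dist x y < r"
proof -
  let ?S = "{(x', y'). abs_torus x' = abs_torus x \<and> abs_torus y' = q}"
  have "(x, rep_torus q) \<in> ?S" by simp
  then have "(\<lambda>(x, y). dist x y) ` ?S \<noteq> {}" by blast
  from cInf_lessD[OF this, of r] assms obtain x' y'
    where *: "abs_torus x' = abs_torus x" "abs_torus y' = q" "dist x' y' < r"
    unfolding dist_torus_def by auto
  have "lattice_rel x x'" using *(1) by (simp add: abs_torus_eq_iff lattice_rel_sym)
  then have "q = abs_torus (y' + (x - x'))" using *(2) abs_torus_translate by metis
  moreover have "dist x (y' + (x - x')) = dist x' y'"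
    by (simp add: dist_norm norm_minus_commute algebra_simps)
  ultimately show ?thesis using that *(3) by simp
qed

instance
proof
  fix p q s :: "'a torus"
  show "uniformity = (INF e\<in>{0 <..}. principal {(x, y::'a torus). dist x y < e})"
    by (rule uniformity_torus_def)
  show "open U \<longleftrightarrow> (\<forall>x\<in>U. \<forall>\<^sub>F (x', y) in uniformity. x' = x \<longrightarrow> y \<in> U)" for U :: "'a torus set"
    by (rule open_torus_def)
  have nonneg: "0 \<le> dist a b" for a b :: "'a torus"
    unfolding dist_torus_def
    by (rule cINF_greatest) (auto intro: exI[of _ "rep_torus a"] exI[of _ "rep_torus b"])
  show "dist p q = 0 \<longleftrightarrow> p = q"
  proof
    assume "p = q"
    obtain x where "p = abs_torus x" by (rule torus_cases)
    then show "dist p q = 0" using dist_torus_le[of x x] nonneg[of p q] \<open>p = q\<close> by simp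
  next
    assume d0: "dist p q = 0"
    obtain x where x: "p = abs_torus x" by (rule torus_cases)
    obtain y where y: "q = abs_torus y" by (rule torus_cases)
    have "x $ i - y $ i \<in> \<int>" for i
    proof -
      have "x $ i - y $ i \<in> closure \<int>"
        unfolding closure_approachable
      proof (intro allI impI)
        fix e :: real assume "0 < e"
        then obtain y' where y': "q = abs_torus y'" "dist x y' < e"
          using dist_torus_less[of x q e] d0 x by auto
        have "\<bar>x $ i - y' $ i\<bar> < e"
          using y'(2) component_le_norm_cart[of "x - y'" i] by (simp add: dist_norm)
        moreover have "y' $ i - y $ i \<in> \<int>"
          using y y'(1) by (simp add: abs_torus_eq_iff lattice_rel_def)
        ultimately show "\<exists>k\<in>\<int>. dist k (x $ i - y $ i) < e"
          by (intro bexI[of _ "y' $ i - y $ i"]) (auto simp: dist_real_def)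
      qed
      then show ?thesis using closed_Ints closure_closed by blast
    qed
    then show "p = q" using x y by (simp add: abs_torus_eq_iff lattice_rel_def)
  qed
  show "dist p q \<le> dist p s + dist q s"
  proof (rule field_le_epsilon)
    fix e :: real assume e: "0 < e"
    obtain z where z: "s = abs_torus z" by (rule torus_cases)
    have sym: "dist a b = dist b a" for a b :: "'a torus"
    proof -
      have *: "(\<lambda>(x, y). dist x y) ` {(x, y). abs_torus x = a \<and> abs_torus y = b}
            = (\<lambda>(x, y). dist x y) ` {(x, y). abs_torus x = b \<and> abs_torus y = a}"
        by (auto simp: image_iff) (metis dist_commute)+
      show ?thesis unfolding dist_torus_def * ..
    qed
    obtain x where x: "p = abs_torus x" "dist z x < dist p s + e / 2"
      using dist_torus_less[of z p "dist p s + e / 2"] e z sym[of s p] by auto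
    obtain y where y: "q = abs_torus y" "dist z y < dist q s + e / 2"
      using dist_torus_less[of z q "dist q s + e / 2"] e z sym[of s q] by auto
    have "dist p q \<le> dist x y" using dist_torus_le x(1) y(1) by simp
    also have "\<dots> \<le> dist z x + dist z y" by (rule dist_triangle3)
    finally show "dist p q \<le> dist p s + dist q s + e" using x(2) y(2) by simp
  qed
qed

end

lemma continuous_on_abs_torus: "continuous_on A abs_torus"
  unfolding continuous_on_iff by (metis dist_torus_le order_le_less_trans)

lemma abs_torus_unit_cube: "\<exists>x \<in> cbox 0 (\<chi> i. 1). abs_torus x = p"
proof -
  obtain y where y: "p = abs_torus y" by (rule torus_cases)
  let ?x = "\<chi> i. frac (y $ i)"
  have "?x \<in> cbox 0 (\<chi> i. 1)"
    by (auto simp: mem_box_cart frac_ge_0 less_imp_le[OF frac_lt_1])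
  moreover have "abs_torus ?x = p"
    unfolding y abs_torus_eq_iff lattice_rel_def by (auto simp: frac_def)
  ultimately show ?thesis by blast
qed

lemma bounded_range_torus:
  fixes g :: "'n::finite torus \<Rightarrow> 'b::metric_space"
  assumes "continuous_on UNIV (\<lambda>x. g (abs_torus x))"
  shows "bounded (range g)"
proof -
  have "range g = (\<lambda>x. g (abs_torus x)) ` cbox 0 (\<chi> i. 1)"
  proof (intro equalityI subsetI)
    fix v assume "v \<in> range g"
    then obtain p where "v = g p" by blast
    with abs_torus_unit_cube[of p] show "v \<in> (\<lambda>x. g (abs_torus x)) ` cbox 0 (\<chi> i. 1)" by blast
  qed blast
  moreover have "compact ((\<lambda>x. g (abs_torus x)) ` cbox 0 (\<chi> i. 1))"
    using assms by (intro compact_continuous_image compact_cbox) (auto intro: continuous_on_subset)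
  ultimately show ?thesis by (simp add: compact_imp_bounded)
qed

definition torus_measure :: "'n::finite torus measure" where
  "torus_measure =
     distr (restrict_space lborel {x :: real ^ 'n. \<forall>i. 0 \<le> x $ i \<and> x $ i < 1}) borel abs_torus"

definition hyperbolic_toral_automorphism :: "('n::finite torus \<Rightarrow> 'n torus) \<Rightarrow> bool" where
  "hyperbolic_toral_automorphism f \<longleftrightarrow>
     (\<exists>A :: int ^ 'n ^ 'n.
        (det A = 1 \<or> det A = - 1) \<and>
        (\<forall>x. f (abs_torus x) = abs_torus (map_matrix of_int A *v x)) \<and>
        (\<forall>z :: complex. (\<exists>v. v \<noteq> 0 \<and> map_matrix of_int A *v v = z *s v) \<longrightarrow> cmod z \<noteq> 1))"

section \<open>Unit vector fields of class C2\<close>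

text \<open>
  The tangent bundle of the flat torus is trivialised by the projection, so a vector field is a
  map from the torus to Euclidean space. Functions on the torus are differentiated through
  their periodic lifts; by periodicity the chosen representative does not matter.
\<close>

definition torus_differentiable :: "('n::finite torus \<Rightarrow> 'b::real_normed_vector) \<Rightarrow> bool" where
  "torus_differentiable g \<longleftrightarrow> (\<forall>x. (\<lambda>y. g (abs_torus y)) differentiable (at x))"

definition torus_deriv ::
    "('n::finite torus \<Rightarrow> 'b::real_normed_vector) \<Rightarrow> 'n torus \<Rightarrow> (real ^ 'n) \<Rightarrow>\<^sub>L 'b" where
  "torus_deriv g p = Blinfun (frechet_derivative (\<lambda>y. g (abs_torus y)) (at (rep_torus p)))"

lemma torus_deriv_has_derivative:
  fixes g :: "'n::finite torus \<Rightarrow> 'b::real_normed_vector"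
  assumes "torus_differentiable g"
  shows "((\<lambda>y. g (abs_torus y)) has_derivative torus_deriv g (abs_torus x)) (at x)"
proof -
  let ?G = "\<lambda>y. g (abs_torus y)"
  define r where "r = rep_torus (abs_torus x)"
  have D: "(?G has_derivative frechet_derivative ?G (at r)) (at r)"
    using assms by (simp add: torus_differentiable_def frechet_derivative_works)
  then have "bounded_linear (frechet_derivative ?G (at r))"
    by (rule has_derivative_bounded_linear)
  then have F: "blinfun_apply (torus_deriv g (abs_torus x)) = frechet_derivative ?G (at r)"
    by (simp add: torus_deriv_def r_def bounded_linear_Blinfun_apply)
  have per: "abs_torus (y + (r - x)) = abs_torus y" for y
    by (rule abs_torus_translate) (simp add: r_def flip: abs_torus_eq_iff)
  have "((\<lambda>y. y + (r - x)) has_derivative (\<lambda>h. h)) (at x)"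
    by (auto intro!: derivative_eq_intros)
  from has_derivative_compose[OF this, of ?G] D
  have "((\<lambda>y. ?G (y + (r - x))) has_derivative frechet_derivative ?G (at r)) (at x)"
    by simp
  then show ?thesis by (simp add: per F)
qed

definition C2_torus :: "('n::finite torus \<Rightarrow> 'b::real_normed_vector) \<Rightarrow> bool" where
  "C2_torus g \<longleftrightarrow> torus_differentiable g \<and> torus_differentiable (torus_deriv g) \<and>
     continuous_on UNIV (torus_deriv (torus_deriv g))"

definition C2_unit_fields :: "('n::finite torus \<Rightarrow> real ^ 'n) set" where
  "C2_unit_fields = {V. C2_torus V \<and> (\<forall>p. norm (V p) = 1)}"

text \<open>The value 0 outside the set of fields only makes this a metric in the library's sense.\<close>

definition C2_dist :: "('n::finite torus \<Rightarrow> real ^ 'n) \<Rightarrow> ('n torus \<Rightarrow> real ^ 'n) \<Rightarrow> real" where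
  "C2_dist V W =
     (if V \<in> C2_unit_fields \<and> W \<in> C2_unit_fields
      then (SUP p. norm (V p - W p))
         + (SUP p. norm (torus_deriv V p - torus_deriv W p))
         + (SUP p. norm (torus_deriv (torus_deriv V) p - torus_deriv (torus_deriv W) p))
      else 0)"

lemma torus_differentiable_bounded:
  assumes "torus_differentiable g"
  shows "bounded (range g)"
  using assms unfolding torus_differentiable_def
  by (intro bounded_range_torus continuous_at_imp_continuous_on ballI
        differentiable_imp_continuous_within) auto

lemma C2_unit_fields_bounded:
  assumes "V \<in> C2_unit_fields"
  shows "bounded (range V)" "bounded (range (torus_deriv V))"
    "bounded (range (torus_deriv (torus_deriv V)))"
proof -
  have "C2_torus V" using assms by (simp add: C2_unit_fields_def)
  then show "bounded (range V)" "bounded (range (torus_deriv V))"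
    by (auto simp: C2_torus_def torus_differentiable_bounded)
  have "continuous_on UNIV (torus_deriv (torus_deriv V))"
    using \<open>C2_torus V\<close> by (simp add: C2_torus_def)
  then show "bounded (range (torus_deriv (torus_deriv V)))"
    by (intro bounded_range_torus continuous_on_compose2[OF _ continuous_on_abs_torus]) auto
qed

lemma bdd_above_norm_diff:
  fixes g h :: "'a \<Rightarrow> 'b::real_normed_vector"
  assumes "bounded (range g)" "bounded (range h)"
  shows "bdd_above (range (\<lambda>p. norm (g p - h p)))"
proof -
  obtain a b where "\<And>p. norm (g p) \<le> a" "\<And>p. norm (h p) \<le> b"
    using assms by (auto simp: bounded_iff)
  then show ?thesis
    by (intro bdd_aboveI[of _ "a + b"]) (auto intro: order_trans[OF norm_triangle_ineq4] add_mono)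
qed

lemma SUP_norm_diff_triangle:
  fixes f g h :: "'a \<Rightarrow> 'b::real_normed_vector"
  assumes "bounded (range f)" "bounded (range g)" "bounded (range h)"
  shows "(SUP p. norm (f p - h p)) \<le> (SUP p. norm (f p - g p)) + (SUP p. norm (g p - h p))"
proof (rule cSUP_least)
  fix p
  have "norm (f p - h p) \<le> norm (f p - g p) + norm (g p - h p)"
    by (rule norm_diff_triangle_le[OF order_refl order_refl])
  also have "\<dots> \<le> (SUP p. norm (f p - g p)) + (SUP p. norm (g p - h p))"
    using assms by (intro add_mono cSUP_upper bdd_above_norm_diff) auto
  finally show "norm (f p - h p) \<le> \<dots>" .
qed simp

lemma SUP_norm_diff_nonneg:
  fixes f g :: "'a \<Rightarrow> 'b::real_normed_vector"
  assumes "bounded (range f)" "bounded (range g)"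
  shows "0 \<le> (SUP p. norm (f p - g p))"
  using assms by (intro cSUP_upper2[where x = undefined] bdd_above_norm_diff) auto

interpretation C2_metric: Metric_space C2_unit_fields C2_dist
proof
  fix U V W :: "'n torus \<Rightarrow> real ^ 'n"
  note b = C2_unit_fields_bounded
  show nonneg: "0 \<le> C2_dist V W"
    by (auto simp: C2_dist_def intro!: add_nonneg_nonneg SUP_norm_diff_nonneg b)
  show "C2_dist V W = C2_dist W V"
    by (auto simp: C2_dist_def norm_minus_commute)
  assume V: "V \<in> C2_unit_fields" and W: "W \<in> C2_unit_fields"
  show "C2_dist V W = 0 \<longleftrightarrow> V = W"
  proof
    assume "C2_dist V W = 0"
    moreover have "0 \<le> (SUP p. norm (torus_deriv V p - torus_deriv W p))"
      "0 \<le> (SUP p. norm (torus_deriv (torus_deriv V) p - torus_deriv (torus_deriv W) p))"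
      using V W by (auto intro!: SUP_norm_diff_nonneg b)
    ultimately have *: "(SUP p. norm (V p - W p)) \<le> 0"
      using V W by (simp add: C2_dist_def)
    have "norm (V p - W p) \<le> 0" for p
    proof -
      have "norm (V p - W p) \<le> (SUP p. norm (V p - W p))"
        using V W by (intro cSUP_upper bdd_above_norm_diff b) auto
      with * show ?thesis by (rule order_trans[rotated])
    qed
    then show "V = W" by (auto simp: fun_eq_iff)
  qed (simp add: C2_dist_def)
  assume U: "U \<in> C2_unit_fields"
  show "C2_dist V U \<le> C2_dist V W + C2_dist W U"
    using SUP_norm_diff_triangle[OF b(1)[OF V] b(1)[OF W] b(1)[OF U]]
      SUP_norm_diff_triangle[OF b(2)[OF V] b(2)[OF W] b(2)[OF U]]
      SUP_norm_diff_triangle[OF b(3)[OF V] b(3)[OF W] b(3)[OF U]]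
    using U V W by (simp add: C2_dist_def)
qed

definition C2_unit_fields_topology :: "('n::finite torus \<Rightarrow> real ^ 'n) topology" where
  "C2_unit_fields_topology = Metric_space.mtopology C2_unit_fields C2_dist"

definition residual_in :: "'a topology \<Rightarrow> 'a set \<Rightarrow> bool" where
  "residual_in X S \<longleftrightarrow> S \<subseteq> topspace X \<and>
     (\<exists>\<G>. countable \<G> \<and> (\<forall>G\<in>\<G>. openin X G \<and> X closure_of G = topspace X) \<and>
          topspace X \<inter> \<Inter>\<G> \<subseteq> S)"

section \<open>Rank 1 random perturbations\<close>

definition is_integral_curve ::
    "('n::finite torus \<Rightarrow> real ^ 'n) \<Rightarrow> 'n torus \<Rightarrow> (real \<Rightarrow> 'n torus) \<Rightarrow> bool" where
  "is_integral_curve V x \<gamma> \<longleftrightarrow> \<gamma> 0 = x \<and>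
     (\<exists>c. \<forall>t. \<gamma> t = abs_torus (c t) \<and> (c has_vector_derivative V (\<gamma> t)) (at t))"

text \<open>The integral curve through a point exists on the whole line and is unique for a C2 field.\<close>

definition integral_curve ::
    "('n::finite torus \<Rightarrow> real ^ 'n) \<Rightarrow> 'n torus \<Rightarrow> real \<Rightarrow> 'n torus" where
  "integral_curve V x = (THE \<gamma>. is_integral_curve V x \<gamma>)"

text \<open>
  Connectedness is that of the integral curve and not of its image in the torus, where a
  nonclosed orbit may accumulate on itself; so the component is taken in the time parameter.
\<close>

definition arc :: "('n::finite torus \<Rightarrow> real ^ 'n) \<Rightarrow> real \<Rightarrow> 'n torus \<Rightarrow> 'n torus set" where
  "arc V \<epsilon> x = integral_curve V x `
     connected_component_set {t. dist (integral_curve V x t) x \<le> \<epsilon>} 0"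

text \<open>
  Integral curves of a unit field are parametrised by arc length, so length on an orbit is
  Lebesgue measure in time. On a closed orbit only one period is used, on which the curve is
  injective.
\<close>

definition orbit_times :: "('n::finite torus \<Rightarrow> real ^ 'n) \<Rightarrow> 'n torus \<Rightarrow> real set" where
  "orbit_times V x =
     (if \<exists>T>0. integral_curve V x T = x
      then {0 ..< Inf {T. 0 < T \<and> integral_curve V x T = x}}
      else UNIV)"

definition orbit_length :: "('n::finite torus \<Rightarrow> real ^ 'n) \<Rightarrow> 'n torus \<Rightarrow> 'n torus measure" where
  "orbit_length V x = distr (restrict_space lborel (orbit_times V x)) borel (integral_curve V x)"

text \<open>
  An arc of infinite length (a nonclosed half-orbit staying within the given distance) carries no
  uniform distribution; \<^const>\<open>uniform_measure\<close> is then the zero measure. An invariant probability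
  measure gives no mass to the points whose transition measure is of this kind.
\<close>

definition uniform_on_arc :: "('n::finite torus \<Rightarrow> real ^ 'n) \<Rightarrow> real \<Rightarrow> 'n torus \<Rightarrow> 'n torus measure" where
  "uniform_on_arc V \<epsilon> x = uniform_measure (orbit_length V x) (arc V \<epsilon> x)"

definition rank1_perturbation ::
    "('n::finite torus \<Rightarrow> 'n torus) \<Rightarrow> ('n torus \<Rightarrow> real ^ 'n) \<Rightarrow> real \<Rightarrow> 'n torus \<Rightarrow> 'n torus measure" where
  "rank1_perturbation f V \<epsilon> = (\<lambda>x. uniform_on_arc V \<epsilon> (f x))"

definition invariant_measure ::
    "('a::topological_space \<Rightarrow> 'a measure) \<Rightarrow> 'a measure \<Rightarrow> bool" where
  "invariant_measure P \<mu> \<longleftrightarrow> prob_space \<mu> \<and> sets \<mu> = sets borel \<and>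
     (\<forall>A\<in>sets borel. (\<integral>\<^sup>+x. emeasure (P x) A \<partial>\<mu>) = emeasure \<mu> A)"

end

theory Submission
  imports Defs
begin

text \<open>
  Suppose that an invariant measure has a singular part. A Lebesgue-null set of maximal mass can
  then be shrunk to a null set \<open>S\<close> which the chain never leaves: from \<open>x \<in> S\<close> the next point
  lies in \<open>S\<close> for almost every time \<open>t\<close> near 0 of the flow started at \<open>f x\<close>. Hence the map sending
  \<open>(t\<^sub>1, \<dots>, t\<^sub>k)\<close> to the position after \<open>k\<close> steps takes almost every small parameter into
  \<open>S\<close>. At 0 its derivative is spanned by the vectors \<open>A ^ (k - j) V (f ^ j x)\<close>; if these span the
  whole space then preimages of null sets are null near 0, a contradiction.

  For a generic field they span at every \<open>x\<close> outside a countable set, which is not charged because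
  transition measures have no atoms. If the points \<open>f ^ j x\<close>, \<open>1 \<le> j \<le> k\<close>, are distinct, the values
  of \<open>V\<close> there can be perturbed independently, and for large \<open>k\<close> the failure to span has
  codimension greater than \<open>n\<close>. By hyperbolicity the remaining points are countable.
\<close>

section \<open>Flows of Lipschitz vector fields\<close>

text \<open>If the vectors fail to span at \<open>y\<close>, a nonzero \<open>\<xi>\<close>
  annihilates them all. Once a coordinate of \<open>\<xi>\<close> is scaled to 1, the pair
  \<open>(y, \<xi>)\<close> is given by at most 2n real variables, and each step imposes one scalar
  equation on it, which determines one perturbation parameter. With 2n + 1 steps per coordinate, the
  bad parameters form a differentiable image of a space of lower dimension, hence a null set.

  Two iterates of a point agree on the torus when \<open>(T ^^ i) x - (T ^^ j) x\<close> is an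
  integer vector, \<open>T\<close> being the lift of \<open>f\<close>. A nonzero kernel vector of
  this linear map would produce a periodic vector of \<open>T\<close> and hence an eigenvalue of
  modulus 1. So the map is injective, and only countably many points reach the lattice.

  Baire's setting asks for countably many open dense conditions, while \<open>y\<close> and
  \<open>\<xi>\<close> range over noncompact sets. Hence the closed balls selected by Lindelof's
  theorem and the integer bounds on \<open>\<xi>\<close>.

  The derivative of the k-step map at 0 alone must control preimages on a whole neighbourhood; this
  is why differentiability is strict throughout.\<close>

lemma exists_primitive:
  fixes g :: "real \<Rightarrow> 'a::euclidean_space"
  assumes "continuous_on UNIV g"
  obtains G where "G 0 = 0" "\<And>t. (G has_vector_derivative g t) (at t)"
proof -
  obtain F where F: "\<And>t. (F has_vector_derivative g t) (at t)"
    using einterval_antiderivative[of "-\<infinity>" \<infinity> g] assms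
    by (auto simp: continuous_on_eq_continuous_at)
  show ?thesis
    by (rule that[of "\<lambda>t. F t - F 0"]) (auto intro!: derivative_eq_intros F)
qed

text \<open>Integrating the weight \<open>exp (K * \<bar>s\<bar>)\<close> returns it divided by
  \<open>K\<close>. Measured against this weight, Picard's operator of an \<open>L\<close>-Lipschitz
  field contracts by \<open>L / K\<close>.\<close>

lemma norm_growth_le_exp:
  fixes G :: "real \<Rightarrow> 'a::real_normed_vector"
  assumes G: "\<And>s. (G has_vector_derivative g s) (at s)"
    and g: "\<And>s. norm (g s) \<le> M * exp (K * \<bar>s\<bar>)" and "0 < K"
  shows "norm (G t - G 0) \<le> M / K * (exp (K * \<bar>t\<bar>) - 1)"
proof -
  have forward: "norm (H t - H 0) \<le> M / K * (exp (K * t) - 1)"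
    if H: "\<And>s. (H has_vector_derivative h s) (at s)"
      and h: "\<And>s. norm (h s) \<le> M * exp (K * \<bar>s\<bar>)" and "0 < t"
    for H :: "real \<Rightarrow> 'a" and h t
  proof -
    have "norm (H t - H 0) \<le> M / K * exp (K * t) - M / K * exp (K * 0)"
    proof (rule differentiable_bound_general[OF \<open>0 < t\<close>])
      show "continuous_on {0..t} H"
        using H by (intro continuous_at_imp_continuous_on)
          (auto intro: has_vector_derivative_continuous)
      show "continuous_on {0..t} (\<lambda>t. M / K * exp (K * t))"
        by (intro continuous_intros)
      show "((\<lambda>t. M / K * exp (K * t)) has_vector_derivative M * exp (K * s)) (at s)" for s
        unfolding has_real_derivative_iff_has_vector_derivative[symmetric]
        using \<open>0 < K\<close> by (auto intro!: derivative_eq_intros)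
      show "norm (h s) \<le> M * exp (K * s)" if "0 < s" for s
        using h[of s] that by simp
    qed (rule H)
    then show ?thesis by (simp add: algebra_simps)
  qed
  consider "t = 0" | "0 < t" | "t < 0" by linarith
  then show ?thesis
  proof cases
    case 2
    then show ?thesis using forward[OF G g] by simp
  next
    case 3
    have "((\<lambda>s. G (- s)) has_vector_derivative - g (- s)) (at s)" for s
    proof -
      have "(G \<circ> uminus has_vector_derivative (- 1) *\<^sub>R g (- s)) (at s)"
        by (rule vector_diff_chain_at) (auto intro!: derivative_eq_intros G)
      then show ?thesis by (simp add: o_def)
    qed
    from forward[OF this, of "- t"] g 3 show ?thesis
      by (metis abs_minus_cancel abs_of_neg minus_minus neg_0_less_iff_less norm_minus_cancel minus_zero)
  qed simp
qed

lemma vector_differentiable_bound_segment: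
  fixes G :: "real \<Rightarrow> 'a::real_normed_vector"
  assumes "\<And>s. (G has_vector_derivative g s) (at s)"
    and "\<And>s. s \<in> closed_segment a b \<Longrightarrow> norm (g s) \<le> M"
  shows "norm (G b - G a) \<le> M * \<bar>b - a\<bar>"
proof -
  have "norm (G b - G a) \<le> M * norm (b - a)"
  proof (rule differentiable_bound[where S = "closed_segment a b"
        and f' = "\<lambda>s h. h *\<^sub>R g s"])
    show "(G has_derivative (\<lambda>h. h *\<^sub>R g s)) (at s within closed_segment a b)" for s
      using assms(1)[of s] by (simp add: has_vector_derivative_def has_derivative_at_withinI)
    show "onorm (\<lambda>h. h *\<^sub>R g s) \<le> M" if "s \<in> closed_segment a b" for s
      using assms(2)[OF that]
      by (intro onorm_le) (auto simp: mult.commute[of M] intro!: mult_left_mono)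
  qed auto
  then show ?thesis by simp
qed

text \<open>The intended instance is the periodic lift of a unit field. The assumptions are
  invariant under replacing \<open>v\<close> by its negative, which reduces negative times to
  positive ones.\<close>

locale lipschitz_field =
  fixes v :: "'a::euclidean_space \<Rightarrow> 'a" and L :: real
  assumes lip: "norm (v x - v y) \<le> L * norm (x - y)"
    and norm_v_le: "norm (v x) \<le> 1"
    and L_pos: "0 < L"
begin

definition solution :: "(real \<Rightarrow> 'a) \<Rightarrow> bool" where
  "solution c \<longleftrightarrow> (\<forall>t. (c has_vector_derivative v (c t)) (at t))"

lemma continuous_field: "continuous_on S v"
proof (rule continuous_on_subset[of UNIV])
  have "L-lipschitz_on UNIV v"
    using lip L_pos by (auto simp: lipschitz_on_def dist_norm)
  then show "continuous_on UNIV v" by (rule lipschitz_on_continuous_on)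
qed simp

text \<open>
  Picard's operator acts on the rescaled difference \<open>b(t) = exp(-2L|t|) (c(t) - x)\<close>; in this
  weighted norm it contracts on the whole line at once, so no continuation argument is needed.
\<close>

lemma solution_exists: "\<exists>c. c 0 = x \<and> solution c"
proof -
  \<comment> \<open>Gives the contraction ratio \<open>L / K = 1 / 2\<close>.\<close>
  define K where "K = 2 * L"
  have K: "0 < K" using L_pos by (simp add: K_def)
  define curve where "curve b t = x + exp (K * \<bar>t\<bar>) *\<^sub>R apply_bcontfun b t"
    for b :: "real \<Rightarrow>\<^sub>C 'a" and t
  have cont: "continuous_on UNIV (\<lambda>t. v (curve b t))" for b
    unfolding curve_def
    by (intro continuous_on_compose2[OF continuous_field[of UNIV]] continuous_intros) auto
  have "\<exists>G. G 0 = 0 \<and> (\<forall>t. (G has_vector_derivative v (curve b t)) (at t))" for b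
    using exists_primitive[OF cont[of b]] by metis
  then obtain G where G0: "\<And>b. G b 0 = 0"
    and G: "\<And>b t. (G b has_vector_derivative v (curve b t)) (at t)"
    by metis
  define T where "T b = Bcontfun (\<lambda>t. exp (- K * \<bar>t\<bar>) *\<^sub>R G b t)" for b
  have cancel: "exp (- K * \<bar>t\<bar>) * exp (K * \<bar>t\<bar>) = 1" for t
    by (simp flip: exp_add)
  have weighted: "norm (exp (- K * \<bar>t\<bar>) *\<^sub>R y) \<le> M" if "norm y \<le> M * (exp (K * \<bar>t\<bar>) - 1)" "0 \<le> M"
    for M t and y :: 'a
  proof -
    have "norm (exp (- K * \<bar>t\<bar>) *\<^sub>R y) \<le> exp (- K * \<bar>t\<bar>) * (M * (exp (K * \<bar>t\<bar>) - 1))"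
      using that by (simp add: mult_left_mono)
    also have "\<dots> = M * (1 - exp (- K * \<bar>t\<bar>))"
      using cancel[of t] by (simp add: algebra_simps)
    also have "\<dots> \<le> M" using that(2) by (intro mult_left_le) auto
    finally show ?thesis .
  qed
  have T: "apply_bcontfun (T b) t = exp (- K * \<bar>t\<bar>) *\<^sub>R G b t" for b t
  proof -
    have "(\<lambda>t. exp (- K * \<bar>t\<bar>) *\<^sub>R G b t) \<in> bcontfun"
    proof (rule bcontfun_normI)
      have "continuous_on UNIV (G b)"
        using G by (intro continuous_at_imp_continuous_on)
          (auto intro: has_vector_derivative_continuous)
      then show "continuous_on UNIV (\<lambda>t. exp (- K * \<bar>t\<bar>) *\<^sub>R G b t)"
        by (intro continuous_intros)
      show "norm (exp (- K * \<bar>t\<bar>) *\<^sub>R G b t) \<le> 1 / K" for t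
      proof (rule weighted)
        have "norm (v (curve b s)) \<le> 1 * exp (K * \<bar>s\<bar>)" for s
          using order_trans[OF norm_v_le[of "curve b s"], of "exp (K * \<bar>s\<bar>)"] K by simp
        from norm_growth_le_exp[OF G this K]
        show "norm (G b t) \<le> 1 / K * (exp (K * \<bar>t\<bar>) - 1)" by (simp add: G0)
      qed (use K in simp)
    qed
    then show ?thesis by (simp add: T_def Bcontfun_inverse)
  qed
  have "dist (T b) (T b') \<le> 1 / 2 * dist b b'" for b b'
  proof (rule dist_bound)
    fix t
    have "norm (v (curve b s) - v (curve b' s)) \<le> (L * dist b b') * exp (K * \<bar>s\<bar>)" for s
    proof -
      have "norm (v (curve b s) - v (curve b' s)) \<le> L * norm (curve b s - curve b' s)" by (rule lip)
      also have "curve b s - curve b' s = exp (K * \<bar>s\<bar>) *\<^sub>R (apply_bcontfun b s - apply_bcontfun b' s)"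
        by (simp add: curve_def algebra_simps)
      also have "L * norm \<dots> \<le> L * (exp (K * \<bar>s\<bar>) * dist b b')"
        using dist_bounded[of b s b'] L_pos by (simp add: dist_norm)
      finally show ?thesis by (simp add: ac_simps)
    qed
    from norm_growth_le_exp[OF has_vector_derivative_diff[OF G G] this K, of t]
    have "norm (G b t - G b' t) \<le> L * dist b b' / K * (exp (K * \<bar>t\<bar>) - 1)" by (simp add: G0)
    then have "norm (exp (- K * \<bar>t\<bar>) *\<^sub>R (G b t - G b' t)) \<le> L * dist b b' / K"
      by (rule weighted) (use L_pos K in simp)
    then show "dist (apply_bcontfun (T b) t) (apply_bcontfun (T b') t) \<le> 1 / 2 * dist b b'"
      using L_pos by (simp add: T dist_norm K_def scaleR_diff_right)
  qed
  then obtain b where b: "T b = b"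
    using banach_fix_type[of "1 / 2" T] by auto
  have "curve b = (\<lambda>t. x + G b t)"
  proof
    fix t
    have "exp (K * \<bar>t\<bar>) *\<^sub>R apply_bcontfun (T b) t = G b t"
      using cancel[of t] by (simp add: T mult.commute)
    then show "curve b t = x + G b t" by (simp add: b curve_def)
  qed
  with G[of b] G0[of b] show ?thesis
    by (intro exI[of _ "\<lambda>t. x + G b t"]) (auto simp: solution_def intro!: derivative_eq_intros)
qed

lemma solution_reverse:
  assumes "solution c"
  shows "lipschitz_field.solution (\<lambda>x. - v x) (\<lambda>t. c (- t))"
proof -
  interpret r: lipschitz_field "\<lambda>x. - v x" L
    using lip norm_v_le L_pos by unfold_locales (auto simp: norm_minus_commute)
  have "(c \<circ> uminus has_vector_derivative (- 1) *\<^sub>R v (c (- t))) (at t)" for t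
    using assms unfolding solution_def
    by (intro vector_diff_chain_at) (auto intro!: derivative_eq_intros)
  then show ?thesis by (simp add: r.solution_def o_def)
qed

text \<open>The squared distance is differentiable even where the norm is not. Its derivative is at
  most \<open>2 * L\<close> times itself, so the exponential factor in \<open>q\<close> makes it
  nonincreasing.\<close>

lemma gronwall_forward:
  assumes "solution c" "solution d" "0 \<le> t"
  shows "norm (c t - d t) \<le> exp (L * t) * norm (c 0 - d 0)"
proof -
  define q where "q t = exp (- (2 * L) * t) * ((c t - d t) \<bullet> (c t - d t))" for t
  have "q t \<le> q 0"
  proof (rule DERIV_nonpos_imp_nonincreasing[OF \<open>0 \<le> t\<close>])
    fix s
    let ?z = "c s - d s" and ?w = "v (c s) - v (d s)"
    have "(c has_derivative (\<lambda>h. h *\<^sub>R v (c s))) (at s)" "(d has_derivative (\<lambda>h. h *\<^sub>R v (d s))) (at s)"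
      using assms by (auto simp: solution_def has_vector_derivative_def)
    then have "(q has_field_derivative exp (- (2 * L) * s) * (2 * (?z \<bullet> ?w) - 2 * L * (?z \<bullet> ?z))) (at s)"
      unfolding q_def has_field_derivative_def
      by (auto intro!: derivative_eq_intros ext simp: algebra_simps inner_commute)
    moreover have "?z \<bullet> ?w \<le> L * (?z \<bullet> ?z)"
    proof -
      have "?z \<bullet> ?w \<le> norm ?z * norm ?w" by (rule norm_cauchy_schwarz)
      also have "\<dots> \<le> norm ?z * (L * norm ?z)" by (intro mult_left_mono lip) auto
      finally show ?thesis by (simp add: power2_norm_eq_inner[symmetric] power2_eq_square ac_simps)
    qed
    ultimately show "\<exists>y. (q has_real_derivative y) (at s) \<and> y \<le> 0"
      by (intro exI conjI) (auto intro!: mult_nonneg_nonpos)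
  qed
  then have "exp (- (2 * L) * t) * (norm (c t - d t))\<^sup>2 \<le> (norm (c 0 - d 0))\<^sup>2"
    by (simp add: q_def power2_norm_eq_inner)
  then have "exp (2 * L * t) * (exp (- (2 * L) * t) * (norm (c t - d t))\<^sup>2)
      \<le> exp (2 * L * t) * (norm (c 0 - d 0))\<^sup>2"
    by (rule mult_left_mono) simp
  then have "(norm (c t - d t))\<^sup>2 \<le> exp (2 * L * t) * (norm (c 0 - d 0))\<^sup>2"
    by (simp add: mult.assoc[symmetric] flip: exp_add)
  also have "\<dots> = (exp (L * t) * norm (c 0 - d 0))\<^sup>2"
    by (simp add: power_mult_distrib exp_double[symmetric] ac_simps)
  finally show ?thesis by (rule power2_le_imp_le) simp
qed

lemma gronwall:
  assumes "solution c" "solution d"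
  shows "norm (c t - d t) \<le> exp (L * \<bar>t\<bar>) * norm (c 0 - d 0)"
proof (cases "0 \<le> t")
  case True
  then show ?thesis using gronwall_forward[OF assms] by simp
next
  case False
  interpret r: lipschitz_field "\<lambda>x. - v x" L
    using lip norm_v_le L_pos by unfold_locales (auto simp: norm_minus_commute)
  show ?thesis
    using r.gronwall_forward[OF solution_reverse[OF assms(1)] solution_reverse[OF assms(2)], of "- t"] False
    by simp
qed

lemma solution_unique: "solution c \<Longrightarrow> solution d \<Longrightarrow> c 0 = d 0 \<Longrightarrow> c = d"
  using gronwall[of c d] by (auto simp: fun_eq_iff)

section \<open>The flow and its regularity in time and initial point\<close>

definition flow :: "real \<Rightarrow> 'a \<Rightarrow> 'a" where
  "flow t x = (SOME c. c 0 = x \<and> solution c) t"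

lemma flow_solution: "flow 0 x = x" "solution (\<lambda>t. flow t x)"
  using someI_ex[OF solution_exists[of x]] by (auto simp: flow_def)

lemma flow_deriv: "((\<lambda>t. flow t x) has_vector_derivative v (flow t x)) (at t)"
  using flow_solution(2)[of x] by (simp add: solution_def)

lemma flow_eqI: "solution c \<Longrightarrow> c t = flow t (c 0)"
  using solution_unique[OF _ flow_solution(2)[of "c 0"], of c] by (simp add: flow_solution(1)) (metis)

lemma solution_shift:
  assumes "solution c"
  shows "solution (\<lambda>t. c (t + s))"
  unfolding solution_def
proof
  fix t
  have "(c \<circ> (\<lambda>t. t + s) has_vector_derivative 1 *\<^sub>R v (c (t + s))) (at t)"
    using assms unfolding solution_def
    by (intro vector_diff_chain_at) (auto intro!: derivative_eq_intros)
  then show "((\<lambda>t. c (t + s)) has_vector_derivative v (c (t + s))) (at t)" by (simp add: o_def)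
qed

lemma flow_add: "flow (t + s) x = flow t (flow s x)"
  using flow_eqI[OF solution_shift[OF flow_solution(2)[of x], of s], of t] by simp

lemma flow_minus [simp]: "flow (- t) (flow t x) = x" "flow t (flow (- t) x) = x"
  by (simp_all add: flow_solution flip: flow_add)

lemma flow_lipschitz_initial: "norm (flow t x - flow t y) \<le> exp (L * \<bar>t\<bar>) * norm (x - y)"
  using gronwall[OF flow_solution(2)[of x] flow_solution(2)[of y], of t] by (simp add: flow_solution)

lemma flow_lipschitz_time: "norm (flow t x - flow s x) \<le> \<bar>t - s\<bar>"
  using vector_differentiable_bound_segment[OF flow_deriv[of x], of s t 1] norm_v_le by simp

lemma continuous_on_flow: "continuous_on S (\<lambda>(t, x). flow t x)"
proof (rule continuous_on_subset[of UNIV])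
  have "isCont (\<lambda>p. flow (fst p) (snd p)) q" for q :: "real \<times> 'a"
  proof -
    let ?m = "\<lambda>p. exp (L * \<bar>fst p\<bar>) * norm (snd p - snd q) + \<bar>fst p - fst q\<bar>"
    have "isCont ?m q" by (intro continuous_intros)
    then have "(?m \<longlongrightarrow> ?m q) (at q)" by (simp only: isCont_def)
    then have lim: "(?m \<longlongrightarrow> 0) (at q)" by simp
    have "norm (flow (fst p) (snd p) - flow (fst q) (snd q)) \<le> ?m p" for p
      using norm_triangle_mono[OF flow_lipschitz_initial[of "fst p" "snd p" "snd q"]
          flow_lipschitz_time[of "fst p" "snd q" "fst q"]] by simp
    then have "((\<lambda>p. flow (fst p) (snd p) - flow (fst q) (snd q)) \<longlongrightarrow> 0) (at q)"
      by (intro Lim_null_comparison[OF _ lim] always_eventually) simp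
    then show ?thesis by (simp add: isCont_def LIM_zero_iff)
  qed
  then show "continuous_on UNIV (\<lambda>(t, x). flow t x)"
    by (simp add: case_prod_beta' continuous_on_eq_continuous_at)
qed simp

text \<open>
  A Lipschitz field is enough for strict differentiability of the flow at time 0; this replaces
  the differentiable dependence on initial conditions.
\<close>

lemma flow_strict:
  assumes "0 < \<eta>"
  obtains \<delta> where "0 < \<delta>"
    "\<And>t s x y. \<bar>t\<bar> \<le> \<delta> \<Longrightarrow> \<bar>s\<bar> \<le> \<delta> \<Longrightarrow> norm (y - x0) \<le> \<delta> \<Longrightarrow>
      norm (flow t x - flow s y - ((x - y) + (t - s) *\<^sub>R v x0)) \<le> \<eta> * (norm (x - y) + \<bar>t - s\<bar>)"
proof -
  \<comment> \<open>The bound 1 keeps the growth factor of the flow below \<open>exp L\<close>; the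
    second bound controls the change of initial point, and the third the change of the field within
    distance \<open>2 * \<delta>\<close> of \<open>x0\<close>.\<close>
  define \<delta> where "\<delta> = min (min 1 (\<eta> / (L * exp L))) (\<eta> / (2 * L))"
  have "\<delta> \<le> \<eta> / (L * exp L)" "\<delta> \<le> \<eta> / (2 * L)" "0 < L * exp L" "0 < 2 * L"
    using L_pos by (auto simp: \<delta>_def)
  then have "\<delta> * (L * exp L) \<le> \<eta>" "\<delta> * (2 * L) \<le> \<eta>"
    by (simp_all only: pos_le_divide_eq)
  moreover have "0 < \<delta>" "\<delta> \<le> 1"
    using assms L_pos by (auto simp: \<delta>_def)
  ultimately have \<delta>: "0 < \<delta>" "\<delta> \<le> 1" "\<delta> * (L * exp L) \<le> \<eta>" "L * (2 * \<delta>) \<le> \<eta>"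
    by (simp_all add: ac_simps)
  show ?thesis
  proof (rule that[OF \<delta>(1)])
    fix t s x y
    assume t: "\<bar>t\<bar> \<le> \<delta>" and s: "\<bar>s\<bar> \<le> \<delta>" and y: "norm (y - x0) \<le> \<delta>"
    \<comment> \<open>The increment is split at \<open>flow t y\<close>: here the initial point
      moves at fixed time, and below the time moves at fixed initial point.\<close>
    have "norm ((flow t x - flow t y) - (flow 0 x - flow 0 y)) \<le> (L * (exp L * norm (x - y))) * \<bar>t - 0\<bar>"
    proof (rule vector_differentiable_bound_segment[OF has_vector_derivative_diff[OF flow_deriv flow_deriv]])
      fix u assume "u \<in> closed_segment 0 t"
      then have u: "\<bar>u\<bar> \<le> 1" using t \<delta>(2) by (auto simp: closed_segment_eq_real_ivl split: if_splits)
      have "norm (v (flow u x) - v (flow u y)) \<le> L * norm (flow u x - flow u y)" by (rule lip)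
      also have "norm (flow u x - flow u y) \<le> exp (L * \<bar>u\<bar>) * norm (x - y)" by (rule flow_lipschitz_initial)
      also have "exp (L * \<bar>u\<bar>) \<le> exp L" using u L_pos by (simp add: mult_le_cancel_left1)
      finally show "norm (v (flow u x) - v (flow u y)) \<le> L * (exp L * norm (x - y))"
        using L_pos by (simp add: mult_left_mono mult_right_mono)
    qed
    also have "\<dots> = \<bar>t\<bar> * (L * exp L) * norm (x - y)" by simp
    also have "\<dots> \<le> \<eta> * norm (x - y)"
    proof (rule mult_right_mono)
      have "\<bar>t\<bar> * (L * exp L) \<le> \<delta> * (L * exp L)" using t L_pos by (intro mult_right_mono) auto
      then show "\<bar>t\<bar> * (L * exp L) \<le> \<eta>" using \<delta>(3) by linarith
    qed simp
    finally have 1: "norm ((flow t x - flow t y) - (x - y)) \<le> \<eta> * norm (x - y)"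
      by (simp add: flow_solution)
    have "norm ((flow t y - t *\<^sub>R v x0) - (flow s y - s *\<^sub>R v x0)) \<le> \<eta> * \<bar>t - s\<bar>"
    proof (rule vector_differentiable_bound_segment)
      show "((\<lambda>u. flow u y - u *\<^sub>R v x0) has_vector_derivative v (flow u y) - v x0) (at u)" for u
        by (auto intro!: derivative_eq_intros flow_deriv)
      fix u assume "u \<in> closed_segment s t"
      then have u: "\<bar>u\<bar> \<le> \<delta>" using t s by (auto simp: closed_segment_eq_real_ivl split: if_splits)
      have "norm (v (flow u y) - v x0) \<le> L * norm (flow u y - x0)" by (rule lip)
      also have "norm (flow u y - x0) \<le> norm (flow u y - y) + norm (y - x0)"
        by (metis norm_triangle_ineq diff_add_cancel add_diff_eq)
      also have "\<dots> \<le> 2 * \<delta>" using flow_lipschitz_time[of u y 0] u y by (simp add: flow_solution)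
      finally show "norm (v (flow u y) - v x0) \<le> \<eta>" using \<delta>(4) L_pos by (simp add: mult_left_mono)
    qed
    from norm_triangle_mono[OF 1 this]
    show "norm (flow t x - flow s y - ((x - y) + (t - s) *\<^sub>R v x0)) \<le> \<eta> * (norm (x - y) + \<bar>t - s\<bar>)"
      by (simp add: algebra_simps)
  qed
qed

end

section \<open>Strict differentiability\<close>

text \<open>Both points of the increment vary. One base point thus yields Lipschitz bounds on a
  whole neighbourhood, and expansion along the directions in which \<open>D\<close> is bounded
  below, without any derivative at neighbouring points.\<close>

definition has_strict_derivative ::
    "('a::real_normed_vector \<Rightarrow> 'b::real_normed_vector) \<Rightarrow> ('a \<Rightarrow> 'b) \<Rightarrow> 'a \<Rightarrow> bool" where
  "has_strict_derivative g D a \<longleftrightarrow> bounded_linear D \<and>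
     (\<forall>\<eta>>0. \<exists>\<delta>>0. \<forall>x\<in>cball a \<delta>. \<forall>y\<in>cball a \<delta>. norm (g x - g y - D (x - y)) \<le> \<eta> * norm (x - y))"

lemma has_strict_derivativeD:
  assumes "has_strict_derivative g D a" "0 < \<eta>"
  obtains \<delta> where "0 < \<delta>"
    "\<And>x y. x \<in> cball a \<delta> \<Longrightarrow> y \<in> cball a \<delta> \<Longrightarrow> norm (g x - g y - D (x - y)) \<le> \<eta> * norm (x - y)"
  using assms unfolding has_strict_derivative_def by blast

lemma has_strict_derivative_linear: "bounded_linear D \<Longrightarrow> has_strict_derivative D D a"
  by (auto simp: has_strict_derivative_def bounded_linear.linear linear_diff intro: exI[of _ 1])

lemma has_strict_derivative_const: "has_strict_derivative (\<lambda>x. c) (\<lambda>x. 0) a"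
  by (auto simp: has_strict_derivative_def intro: exI[of _ 1])

lemma has_strict_derivative_lipschitz:
  assumes "has_strict_derivative g D a"
  obtains \<delta> B where "0 < \<delta>" "0 < B"
    "\<And>x y. x \<in> cball a \<delta> \<Longrightarrow> y \<in> cball a \<delta> \<Longrightarrow> norm (g x - g y) \<le> B * norm (x - y)"
proof -
  obtain \<delta> where \<delta>: "0 < \<delta>"
    "\<And>x y. x \<in> cball a \<delta> \<Longrightarrow> y \<in> cball a \<delta> \<Longrightarrow> norm (g x - g y - D (x - y)) \<le> 1 * norm (x - y)"
    using has_strict_derivativeD[OF assms, of 1] by auto
  obtain K where K: "0 < K" "\<And>h. norm (D h) \<le> norm h * K"
    using assms bounded_linear.pos_bounded unfolding has_strict_derivative_def by blast
  show ?thesis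
  proof (rule that[of \<delta> "1 + K"])
    fix x y assume "x \<in> cball a \<delta>" "y \<in> cball a \<delta>"
    from norm_triangle_mono[OF \<delta>(2)[OF this] K(2)[of "x - y"]]
    show "norm (g x - g y) \<le> (1 + K) * norm (x - y)" by (simp add: algebra_simps)
  qed (use \<delta> K in auto)
qed

lemma has_strict_derivative_compose:
  assumes f: "has_strict_derivative f D a" and g: "has_strict_derivative g E (f a)"
  shows "has_strict_derivative (\<lambda>x. g (f x)) (\<lambda>h. E (D h)) a"
  unfolding has_strict_derivative_def
proof (intro conjI allI impI)
  have D: "bounded_linear D" and E: "bounded_linear E"
    using f g by (auto simp: has_strict_derivative_def)
  then show "bounded_linear (\<lambda>h. E (D h))" by (metis bounded_linear_compose)
  fix \<eta> :: real assume \<eta>: "0 < \<eta>"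
  obtain \<delta>1 B where B: "0 < \<delta>1" "0 < B"
    "\<And>x y. x \<in> cball a \<delta>1 \<Longrightarrow> y \<in> cball a \<delta>1 \<Longrightarrow> norm (f x - f y) \<le> B * norm (x - y)"
    using has_strict_derivative_lipschitz[OF f] by metis
  obtain K where K: "0 < K" "\<And>h. norm (E h) \<le> norm h * K"
    using bounded_linear.pos_bounded[OF E] by blast
  have "0 < \<eta> / (2 * K)" "0 < \<eta> / (2 * B)" using \<eta> K B by auto
  then obtain \<delta>2 \<delta>3 where \<delta>2: "0 < \<delta>2"
    "\<And>x y. x \<in> cball a \<delta>2 \<Longrightarrow> y \<in> cball a \<delta>2 \<Longrightarrow> norm (f x - f y - D (x - y)) \<le> \<eta> / (2 * K) * norm (x - y)"
    and \<delta>3: "0 < \<delta>3"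
    "\<And>x y. x \<in> cball (f a) \<delta>3 \<Longrightarrow> y \<in> cball (f a) \<delta>3 \<Longrightarrow> norm (g x - g y - E (x - y)) \<le> \<eta> / (2 * B) * norm (x - y)"
    using has_strict_derivativeD[OF f] has_strict_derivativeD[OF g] by metis
  define \<delta> where "\<delta> = min (min \<delta>1 \<delta>2) (\<delta>3 / B)"
  have \<delta>: "0 < \<delta>" "\<delta> \<le> \<delta>1" "\<delta> \<le> \<delta>2" "\<delta> \<le> \<delta>3 / B" using B \<delta>2 \<delta>3 by (auto simp: \<delta>_def)
  then have B\<delta>: "B * \<delta> \<le> \<delta>3" using B by (simp add: field_simps)
  have near: "f x \<in> cball (f a) \<delta>3" if "x \<in> cball a \<delta>" for x
  proof -
    have "norm (f x - f a) \<le> B * norm (x - a)" using that \<delta> by (intro B(3)) auto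
    also have "\<dots> \<le> B * \<delta>" using that B by (intro mult_left_mono) (auto simp: dist_norm norm_minus_commute)
    finally show ?thesis using B\<delta> by (simp add: dist_norm norm_minus_commute)
  qed
  have "norm (g (f x) - g (f y) - E (D (x - y))) \<le> \<eta> * norm (x - y)"
    if x: "x \<in> cball a \<delta>" and y: "y \<in> cball a \<delta>" for x y
  proof -
    have "norm (g (f x) - g (f y) - E (f x - f y)) \<le> \<eta> / (2 * B) * norm (f x - f y)"
      by (rule \<delta>3(2)[OF near[OF x] near[OF y]])
    also have "\<dots> \<le> \<eta> / (2 * B) * (B * norm (x - y))"
      using x y \<delta> \<eta> B by (intro mult_left_mono B(3)) auto
    finally have 1: "norm (g (f x) - g (f y) - E (f x - f y)) \<le> \<eta> / 2 * norm (x - y)"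
      using B by simp
    have "norm (E (f x - f y - D (x - y))) \<le> norm (f x - f y - D (x - y)) * K" by (rule K)
    also have "\<dots> \<le> \<eta> / (2 * K) * norm (x - y) * K"
      using x y \<delta> K by (intro mult_right_mono \<delta>2) auto
    finally have 2: "norm (E (f x - f y) - E (D (x - y))) \<le> \<eta> / 2 * norm (x - y)"
      using K linear_diff[OF bounded_linear.linear[OF E], of "f x - f y" "D (x - y)"] by simp
    from norm_triangle_mono[OF 1 2] show ?thesis by simp
  qed
  with \<delta>(1) show "\<exists>\<delta>>0. \<forall>x\<in>cball a \<delta>. \<forall>y\<in>cball a \<delta>.
      norm (g (f x) - g (f y) - E (D (x - y))) \<le> \<eta> * norm (x - y)" by blast
qed

lemma has_strict_derivative_Pair:
  assumes f: "has_strict_derivative f D a" and g: "has_strict_derivative g E a"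
  shows "has_strict_derivative (\<lambda>x. (f x, g x)) (\<lambda>h. (D h, E h)) a"
  unfolding has_strict_derivative_def
proof (intro conjI allI impI)
  show "bounded_linear (\<lambda>h. (D h, E h))"
    using f g by (auto simp: has_strict_derivative_def intro: bounded_linear_Pair)
  fix \<eta> :: real assume "0 < \<eta>"
  then have "0 < \<eta> / 2" by simp
  obtain \<delta>1 where \<delta>1: "0 < \<delta>1"
    "\<And>x y. x \<in> cball a \<delta>1 \<Longrightarrow> y \<in> cball a \<delta>1 \<Longrightarrow> norm (f x - f y - D (x - y)) \<le> \<eta> / 2 * norm (x - y)"
    using has_strict_derivativeD[OF f \<open>0 < \<eta> / 2\<close>] by metis
  obtain \<delta>2 where \<delta>2: "0 < \<delta>2"
    "\<And>x y. x \<in> cball a \<delta>2 \<Longrightarrow> y \<in> cball a \<delta>2 \<Longrightarrow> norm (g x - g y - E (x - y)) \<le> \<eta> / 2 * norm (x - y)"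
    using has_strict_derivativeD[OF g \<open>0 < \<eta> / 2\<close>] by metis
  have "norm ((f x, g x) - (f y, g y) - (D (x - y), E (x - y))) \<le> \<eta> * norm (x - y)"
    if "x \<in> cball a (min \<delta>1 \<delta>2)" "y \<in> cball a (min \<delta>1 \<delta>2)" for x y
    using \<delta>1(2)[of x y] \<delta>2(2)[of x y] that
      norm_Pair_le[of "f x - f y - D (x - y)" "g x - g y - E (x - y)"]
    by simp
  then show "\<exists>\<delta>>0. \<forall>x\<in>cball a \<delta>. \<forall>y\<in>cball a \<delta>.
      norm ((f x, g x) - (f y, g y) - (D (x - y), E (x - y))) \<le> \<eta> * norm (x - y)"
    using \<delta>1(1) \<delta>2(1) by (intro exI[of _ "min \<delta>1 \<delta>2"]) auto
qed

lemma (in lipschitz_field) flow_has_strict_derivative: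
  "has_strict_derivative (\<lambda>(t, x). flow t x) (\<lambda>(\<tau>, h). h + \<tau> *\<^sub>R v x0) (0, x0)"
  unfolding has_strict_derivative_def
proof (intro conjI allI impI)
  show "bounded_linear (\<lambda>(\<tau>, h). h + \<tau> *\<^sub>R v x0)"
    unfolding case_prod_beta'
    by (intro bounded_linear_add bounded_linear_snd bounded_linear_scaleR_left[THEN bounded_linear_compose] bounded_linear_fst)
  fix \<eta> :: real assume "0 < \<eta>"
  \<comment> \<open>Half of \<open>\<eta>\<close>, since the sum of the two norms is at most twice
    the norm of the pair.\<close>
  then obtain \<delta> where \<delta>: "0 < \<delta>"
    "\<And>t s x y. \<bar>t\<bar> \<le> \<delta> \<Longrightarrow> \<bar>s\<bar> \<le> \<delta> \<Longrightarrow> norm (y - x0) \<le> \<delta> \<Longrightarrow>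
      norm (flow t x - flow s y - ((x - y) + (t - s) *\<^sub>R v x0)) \<le> \<eta> / 2 * (norm (x - y) + \<bar>t - s\<bar>)"
    using flow_strict[of "\<eta> / 2" x0] by auto
  have "norm (flow t x - flow s y - ((x - y) + (t - s) *\<^sub>R v x0)) \<le> \<eta> * norm ((t, x) - (s, y))"
    if "(t, x) \<in> cball (0, x0) \<delta>" "(s, y) \<in> cball (0, x0) \<delta>" for t x s y
  proof -
    have "\<bar>t\<bar> \<le> \<delta>" "\<bar>s\<bar> \<le> \<delta>" "norm (y - x0) \<le> \<delta>"
      using that dist_fst_le[of "(0, x0)" "(t, x)"] dist_fst_le[of "(0, x0)" "(s, y)"]
        dist_snd_le[of "(0, x0)" "(s, y)"]
      by (auto simp: dist_norm norm_minus_commute)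
    from \<delta>(2)[OF this, of x] 
    have "norm (flow t x - flow s y - ((x - y) + (t - s) *\<^sub>R v x0)) \<le> \<eta> / 2 * (norm (x - y) + \<bar>t - s\<bar>)" .
    also have "\<dots> \<le> \<eta> / 2 * (2 * norm ((t, x) - (s, y)))"
      using \<open>0 < \<eta>\<close> norm_fst_le[of "t - s" "x - y"] norm_snd_le[of "x - y" "t - s"]
      by (intro mult_left_mono) (auto simp: real_norm_def)
    finally show ?thesis by simp
  qed
  with \<delta>(1) show "\<exists>\<delta>>0. \<forall>p\<in>cball (0, x0) \<delta>. \<forall>q\<in>cball (0, x0) \<delta>.
      norm ((case p of (t, x) \<Rightarrow> flow t x) - (case q of (t, x) \<Rightarrow> flow t x) -
        (case p - q of (\<tau>, h) \<Rightarrow> h + \<tau> *\<^sub>R v x0)) \<le> \<eta> * norm (p - q)"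
    by (intro exI[of _ \<delta>]) auto
qed

section \<open>Null sets along a submersion\<close>

text \<open>Fubini and translation invariance.\<close>

lemma null_if_slices_null:
  fixes B :: "'a::euclidean_space set" and R :: "'b::euclidean_space \<Rightarrow> 'a"
  assumes B: "B \<in> sets borel" and R: "R \<in> borel_measurable borel"
    and U: "U \<in> sets borel" "emeasure lborel U \<noteq> 0"
    and slices: "AE t in lborel. AE h in lborel. h \<in> U \<longrightarrow> t + R h \<notin> B"
  shows "B \<in> null_sets lborel"
proof -
  let ?g = "\<lambda>t h. indicator U h * indicator B (t + R h) :: ennreal"
  have R' [measurable]: "R \<in> borel_measurable lborel" using R by simp
  have [measurable]: "B \<in> sets borel" "U \<in> sets borel" by fact+
  have meas: "(\<lambda>(t, h). ?g t h) \<in> borel_measurable (lborel \<Otimes>\<^sub>M lborel)"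
    by measurable
  have "(\<integral>\<^sup>+t. \<integral>\<^sup>+h. ?g t h \<partial>lborel \<partial>lborel) = (\<integral>\<^sup>+t. 0 \<partial>(lborel :: 'a measure))"
  proof (rule nn_integral_cong_AE)
    show "AE t in lborel. (\<integral>\<^sup>+h. ?g t h \<partial>lborel) = 0"
      using slices
    proof eventually_elim
      case (elim t)
      then have "AE h in lborel. ?g t h = 0" by eventually_elim (auto simp: indicator_def)
      then show ?case by (subst nn_integral_cong_AE[where v = "\<lambda>_. 0"]) auto
    qed
  qed
  moreover have "(\<integral>\<^sup>+t. \<integral>\<^sup>+h. ?g t h \<partial>lborel \<partial>lborel) = (\<integral>\<^sup>+h. \<integral>\<^sup>+t. ?g t h \<partial>lborel \<partial>lborel)"
    by (rule lborel_pair.Fubini'[OF meas, symmetric])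
  moreover have "(\<integral>\<^sup>+t. ?g t h \<partial>lborel) = indicator U h * emeasure lborel B" for h
  proof -
    have "(\<integral>\<^sup>+t. ?g t h \<partial>lborel) = indicator U h * (\<integral>\<^sup>+t. indicator B (R h + t) \<partial>lborel)"
      by (simp add: nn_integral_cmult add.commute)
    also have "(\<integral>\<^sup>+t. indicator B (R h + t) \<partial>lborel) = (\<integral>\<^sup>+t. indicator B t \<partial>distr lborel borel ((+) (R h)))"
      by (subst nn_integral_distr) auto
    also have "\<dots> = emeasure lborel B" by (simp add: lborel_distr_plus)
    finally show ?thesis .
  qed
  ultimately have "emeasure lborel U * emeasure lborel B = 0"
    by (simp add: nn_integral_multc)
  then show ?thesis using U B by (auto simp: null_sets_def)
qed

text \<open>For a right inverse \<open>R\<close> of \<open>D\<close>, the slices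
  \<open>t + R h\<close> have the dimension of the target, and on each of them \<open>g\<close>
  shrinks distances at most by a factor 2. The inverse on the slice is therefore Lipschitz and takes
  the part of \<open>M\<close> in its domain to a null set; Fubini assembles the slices.\<close>

lemma null_preimage_strict_submersion:
  fixes g :: "'a::euclidean_space \<Rightarrow> 'b::euclidean_space"
  assumes D: "has_strict_derivative g D a" and "surj D"
    and M: "M \<in> null_sets lborel" and g: "g \<in> borel_measurable borel"
  obtains \<delta> where "0 < \<delta>" "{x \<in> cball a \<delta>. g x \<in> M} \<in> null_sets lborel"
proof -
  have linD: "linear D" and blD: "bounded_linear D"
    using D by (auto simp: has_strict_derivative_def bounded_linear.linear)
  obtain R where linR: "linear R" and DR: "D \<circ> R = id"
    using linear_surjective_right_inverse[OF linD \<open>surj D\<close>] by blast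
  have blR: "bounded_linear R" using linR linear_linear by blast
  obtain K where K: "0 < K" "\<And>h. norm (R h) \<le> norm h * K"
    using bounded_linear.pos_bounded[OF blR] by blast
  \<comment> \<open>As \<open>R\<close> enlarges norms by at most \<open>K\<close>, this tolerance
    keeps the error on a slice below half of \<open>norm (h - k)\<close>.\<close>
  have "0 < 1 / (2 * K)" using K by simp
  then obtain \<delta>0 where \<delta>0: "0 < \<delta>0"
    "\<And>x y. x \<in> cball a \<delta>0 \<Longrightarrow> y \<in> cball a \<delta>0 \<Longrightarrow> norm (g x - g y - D (x - y)) \<le> 1 / (2 * K) * norm (x - y)"
    using has_strict_derivativeD[OF D] by metis
  define B where "B = {x \<in> cball a \<delta>0. g x \<in> M}"
  have [measurable]: "M \<in> sets borel" "g \<in> borel_measurable borel" "R \<in> borel_measurable borel"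
    using M g linear_continuous_on[OF blR, of UNIV] 
    by (auto simp: null_sets_def intro: borel_measurable_continuous_onI)
  have "B \<in> sets borel"
  proof -
    have "B = cball a \<delta>0 \<inter> (g -` M \<inter> space borel)" by (auto simp: B_def)
    also have "\<dots> \<in> sets borel" by (intro sets.Int measurable_sets[of g borel borel]) auto
    finally show ?thesis .
  qed
  moreover have "AE h in lborel. h \<in> UNIV \<longrightarrow> t + R h \<notin> B" for t
  proof -
    define S where "S = {h. t + R h \<in> B}"
    have expand: "norm (h - k) \<le> 2 * norm (g (t + R h) - g (t + R k))" if "h \<in> S" "k \<in> S" for h k
    proof -
      have "norm (g (t + R h) - g (t + R k) - D (R (h - k))) \<le> 1 / (2 * K) * norm (R (h - k))"
        using \<delta>0(2)[of "t + R h" "t + R k"] that linear_diff[OF linR] by (simp add: S_def B_def)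
      also have "\<dots> \<le> 1 / (2 * K) * (norm (h - k) * K)"
        using K by (intro mult_left_mono) auto
      also have "\<dots> = norm (h - k) / 2" using K by simp
      finally have "norm (g (t + R h) - g (t + R k) - (h - k)) \<le> norm (h - k) / 2"
        using DR by (metis comp_apply id_apply)
      then show ?thesis
        using norm_triangle_ineq3[of "h - k" "g (t + R h) - g (t + R k)"]
        by (simp add: norm_minus_commute)
    qed
    define G where "G h = g (t + R h)" for h
    have "inj_on G S" using expand by (force simp: inj_on_def G_def)
    \<comment> \<open>\<open>S\<close> is recovered from its image, a part of \<open>M\<close>, by
      an inverse with Lipschitz constant 2.\<close>
    have "negligible (inv_into S G ` (G ` S))"
    proof (rule negligible_locally_Lipschitz_image)
      show "negligible (G ` S)"
      proof (rule negligible_subset)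
        show "negligible M"
          using M by (simp add: negligible_iff_null_sets null_sets_completionI)
      qed (auto simp: G_def S_def B_def)
      fix x assume "x \<in> G ` S"
      then show "\<exists>T B. open T \<and> x \<in> T \<and> (\<forall>y\<in>G ` S \<inter> T. norm (inv_into S G y - inv_into S G x) \<le> B * norm (y - x))"
        using expand \<open>inj_on G S\<close>
        by (intro exI[of _ UNIV] exI[of _ 2]) (auto simp: G_def[symmetric])
    qed simp
    then have "negligible S" using \<open>inj_on G S\<close> by simp
    moreover have "S \<in> sets borel"
    proof -
      have [measurable]: "(\<lambda>h. t + R h) \<in> borel_measurable borel" by measurable
      have "S = (\<lambda>h. t + R h) -` B \<inter> space borel" by (auto simp: S_def)
      also have "\<dots> \<in> sets borel" by (rule measurable_sets[OF _ \<open>B \<in> sets borel\<close>]) measurable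
      finally show ?thesis .
    qed
    ultimately have "S \<in> null_sets lborel"
      by (simp add: negligible_iff_null_sets null_sets_completion_iff)
    from AE_not_in[OF this] show ?thesis by eventually_elim (auto simp: S_def)
  qed
  ultimately have "B \<in> null_sets lborel"
    by (intro null_if_slices_null[of B R UNIV]) auto
  then show ?thesis using that[OF \<delta>0(1)] by (simp add: B_def)
qed

section \<open>Null sets that trap the perturbed dynamics\<close>

context lipschitz_field
begin

text \<open>The coordinates of \<open>t\<close> carry no order; \<open>e\<close> lists them in the
  order in which the steps use them.\<close>

primrec chain :: "('a \<Rightarrow> 'a) \<Rightarrow> (nat \<Rightarrow> 'k::finite) \<Rightarrow> nat \<Rightarrow> 'a \<Rightarrow> real ^ 'k \<Rightarrow> 'a" where
  "chain T e 0 x t = x"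
| "chain T e (Suc j) x t = flow (t $ e j) (T (chain T e j x t))"

text \<open>The derivative of \<open>chain\<close> in the times at 0: \<open>T\<close> transports
  the earlier variations, and the newest time contributes the field at the unperturbed orbit
  point.\<close>

primrec chain_deriv :: "('a \<Rightarrow> 'a) \<Rightarrow> (nat \<Rightarrow> 'k::finite) \<Rightarrow> nat \<Rightarrow> 'a \<Rightarrow> real ^ 'k \<Rightarrow> 'a" where
  "chain_deriv T e 0 x h = 0"
| "chain_deriv T e (Suc j) x h = T (chain_deriv T e j x h) + h $ e j *\<^sub>R v ((T ^^ Suc j) x)"

lemma chain_zero [simp]: "chain T e j x 0 = (T ^^ j) x"
  by (induction j) (auto simp: flow_solution)

lemma chain_cong: "(\<And>i. i < j \<Longrightarrow> t $ e i = s $ e i) \<Longrightarrow> chain T e j x t = chain T e j x s"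
  by (induction j) auto

lemma continuous_on_chain:
  assumes "linear T"
  shows "continuous_on UNIV (chain T e j x)"
proof (induction j)
  case (Suc j)
  have "continuous_on UNIV (\<lambda>t. T (chain T e j x t))"
    by (rule linear_continuous_on_compose[OF Suc assms])
  then have "continuous_on UNIV ((\<lambda>(t, x). flow t x) \<circ> (\<lambda>t. (t $ e j, T (chain T e j x t))))"
    by (intro continuous_on_compose continuous_on_flow continuous_intros)
  then show ?case by (simp add: o_def)
qed simp

text \<open>At the base point all times are 0, so each step is differentiated exactly where
  \<open>flow_has_strict_derivative\<close> applies.\<close>

lemma chain_has_strict_derivative:
  assumes "linear T"
  shows "has_strict_derivative (chain T e j x) (chain_deriv T e j x) 0"
proof (induction j)
  case 0
  have "chain T e 0 x = (\<lambda>t. x)" "chain_deriv T e 0 x = (\<lambda>h. 0)" by auto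
  then show ?case by (simp add: has_strict_derivative_const)
next
  case (Suc j)
  let ?p = "(0::real, (T ^^ Suc j) x)"
  have T: "bounded_linear T" using assms linear_linear by blast
  have 1: "has_strict_derivative (\<lambda>t. T (chain T e j x t)) (\<lambda>h. T (chain_deriv T e j x h)) 0"
    by (intro has_strict_derivative_compose[OF Suc] has_strict_derivative_linear T)
  have 2: "has_strict_derivative (\<lambda>t. t $ e j) (\<lambda>h. h $ e j) (0 :: real ^ 'b)"
    by (intro has_strict_derivative_linear bounded_linear_vec_nth)
  have "has_strict_derivative (\<lambda>(t, x). flow t x) (\<lambda>(\<tau>, h). h + \<tau> *\<^sub>R v ((T ^^ Suc j) x))
      ((0 :: real ^ 'b) $ e j, T (chain T e j x 0))"
    using flow_has_strict_derivative[of "(T ^^ Suc j) x"] by simp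
  from has_strict_derivative_compose[OF has_strict_derivative_Pair[OF 2 1] this]
  show ?case by simp
qed

text \<open>The columns of the Jacobian: a variation of time \<open>j\<close> starts as the field at
  iterate \<open>j + 1\<close> and is carried on by the remaining \<open>m - 1 - j\<close>
  applications of \<open>T\<close>.\<close>

lemma chain_deriv_axis:
  assumes "linear T" "inj_on e {..<k}" "j < k" "m \<le> k"
  shows "chain_deriv T e m x (axis (e j) 1) =
    (if j < m then (T ^^ (m - 1 - j)) (v ((T ^^ Suc j) x)) else 0)"
  using assms(4)
proof (induction m)
  case (Suc m)
  have "axis (e j) (1::real) $ e m = (if j = m then 1 else 0)"
    using assms Suc.prems by (auto simp: axis_def inj_on_def)
  moreover have "m - j = Suc (m - 1 - j)" if "j < m" using that by auto
  ultimately show ?case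
    using Suc linear_0[OF assms(1)] by (auto simp: not_less less_Suc_eq)
qed simp

text \<open>A proper subspace has a nonzero normal vector, and this would annihilate every column of
  the Jacobian.\<close>

lemma surj_chain_deriv:
  assumes T: "linear T" and e: "inj_on e {..<k}"
    and span: "\<And>\<xi>. \<xi> \<noteq> 0 \<Longrightarrow> \<exists>j<k. \<xi> \<bullet> (T ^^ (k - 1 - j)) (v ((T ^^ Suc j) x)) \<noteq> 0"
  shows "surj (chain_deriv T e k x)"
proof (rule ccontr)
  let ?D = "chain_deriv T e k x"
  have lin: "linear ?D"
    using chain_has_strict_derivative[OF T, of e k x]
    by (auto simp: has_strict_derivative_def bounded_linear.linear)
  have sub: "subspace (range ?D)" by (intro linear_subspace_image lin subspace_UNIV)
  assume "\<not> surj ?D"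
  then have "span (range ?D) \<noteq> UNIV" using sub by (simp add: span_eq_iff[THEN iffD2])
  then have "dim (range ?D) < DIM('a)"
    using dim_eq_full[of "range ?D"] dim_subset_UNIV[of "range ?D"] by linarith
  then obtain \<xi> where \<xi>: "\<xi> \<noteq> 0" "\<And>y. y \<in> span (range ?D) \<Longrightarrow> orthogonal \<xi> y"
    using orthogonal_to_subspace_exists by metis
  obtain j where j: "j < k" "\<xi> \<bullet> (T ^^ (k - 1 - j)) (v ((T ^^ Suc j) x)) \<noteq> 0"
    using span[OF \<xi>(1)] by blast
  have "\<xi> \<bullet> ?D (axis (e j) 1) = 0"
    using \<xi>(2)[OF span_base] by (auto simp: orthogonal_def)
  then show False using j chain_deriv_axis[OF T e j(1) order_refl, of x] by simp
qed

text \<open>The first \<open>j\<close> steps depend only on the first \<open>j\<close> times. Once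
  these are fixed outside an exceptional null set, the trapping property bounds the bad values of
  the next time, and Fubini in that coordinate gives the induction step.\<close>

lemma AE_chain_trapped:
  assumes T: "linear T" and e: "inj_on e {..<k}"
    and M: "M \<in> sets borel" and "0 < \<delta>"
    and trap: "\<And>x. x \<in> M \<Longrightarrow> AE t in lborel. \<bar>t\<bar> < \<delta> \<longrightarrow> flow t (T x) \<in> M"
    and "x \<in> M" "j \<le> k"
  shows "{t. (\<forall>i<j. \<bar>t $ e i\<bar> < \<delta>) \<and> chain T e j x t \<notin> M} \<in> null_sets lborel"
  using \<open>j \<le> k\<close>
proof (induction j)
  case 0
  then show ?case using \<open>x \<in> M\<close> by simp
next
  case (Suc j)
  let ?B = "\<lambda>j. {t. (\<forall>i<j. \<bar>t $ e i\<bar> < \<delta>) \<and> chain T e j x t \<notin> M}"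
  \<comment> \<open>Slices parallel to the axis of the newest time, along which the first
    \<open>j\<close> steps do not change.\<close>
  define R :: "real \<Rightarrow> real ^ 'b" where "R s = axis (e j) s" for s
  have R: "R s = s *\<^sub>R axis (e j) 1" for s
    by (auto simp: R_def axis_def vec_eq_iff)
  have [measurable]: "chain T e i x \<in> borel_measurable borel" for i
    by (intro borel_measurable_continuous_onI continuous_on_chain T)
  have flow_meas: "(\<lambda>s. flow s y) \<in> borel_measurable borel" for y
    using flow_lipschitz_time[of _ y]
    by (intro borel_measurable_continuous_onI lipschitz_on_continuous_on[of 1])
       (auto simp: lipschitz_on_def dist_norm)
  have "?B (Suc j) \<in> null_sets lborel"
  proof (rule null_if_slices_null[of _ R UNIV])
    show "?B (Suc j) \<in> sets borel" using M by measurable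
    show "R \<in> borel_measurable borel"
      unfolding R by (intro borel_measurable_continuous_onI continuous_intros)
    have "AE t in lborel. t \<notin> ?B j" using Suc by (intro AE_not_in) auto
    then show "AE t in lborel. AE s in lborel. s \<in> UNIV \<longrightarrow> t + R s \<notin> ?B (Suc j)"
    proof eventually_elim
      case (elim t)
      have shift: "(t + R s) $ e i = t $ e i" if "i < j" for s i
        using that Suc.prems inj_onD[OF e, of i j] by (auto simp: R_def axis_def)
      have same: "chain T e j x (t + R s) = chain T e j x t" for s
        by (rule chain_cong) (rule shift)
      have last: "(t + R s) $ e j = t $ e j + s" for s by (simp add: R_def)
      show ?case
      proof (cases "\<forall>i<j. \<bar>t $ e i\<bar> < \<delta>")
        case True
        with elim have "chain T e j x t \<in> M" by auto
        then have "AE s in lborel. \<bar>s\<bar> < \<delta> \<longrightarrow> flow s (T (chain T e j x t)) \<in> M" by (rule trap)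
        moreover have "Measurable.pred borel (\<lambda>s. \<bar>s\<bar> < \<delta> \<longrightarrow> flow s (T (chain T e j x t)) \<in> M)"
          using M flow_meas by measurable
        \<comment> \<open>A slice is parametrised by the offset from \<open>t $ e j\<close>, while
          \<open>trap\<close> speaks of the flow time itself; the two differ by a
          translation.\<close>
        ultimately have "AE s in lborel. \<bar>t $ e j + 1 * s\<bar> < \<delta> \<longrightarrow>
            flow (t $ e j + 1 * s) (T (chain T e j x t)) \<in> M"
          by (intro AE_borel_affine) auto
        then show ?thesis
          by eventually_elim (use last in \<open>auto simp: same simp del: vector_add_component\<close>)
      next
        case False
        then obtain i where "i < j" "\<not> \<bar>t $ e i\<bar> < \<delta>" by auto
        then have "t + R s \<notin> ?B (Suc j)" for s
          using shift[of i s] by (auto intro!: exI[of _ i])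
        then show ?thesis by simp
      qed
    qed
  qed auto
  then show ?case by simp
qed

text \<open>Starting from a point of \<open>M\<close>, the end point lies in \<open>M\<close> only
  for a null set of small times because the k-step map is a submersion, and lies outside
  \<open>M\<close> only for a null set by trapping. Together these two null sets would cover a
  ball.\<close>

theorem trapped_not_spanning:
  fixes e :: "nat \<Rightarrow> 'k::finite"
  assumes T: "linear T" and e: "inj_on e {..<k}"
    and M: "M \<in> null_sets lborel" and "0 < \<delta>"
    and trap: "\<And>x. x \<in> M \<Longrightarrow> AE t in lborel. \<bar>t\<bar> < \<delta> \<longrightarrow> flow t (T x) \<in> M"
    and span: "\<And>\<xi>. \<xi> \<noteq> 0 \<Longrightarrow> \<exists>j<k. \<xi> \<bullet> (T ^^ (k - 1 - j)) (v ((T ^^ Suc j) x)) \<noteq> 0"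
  shows "x \<notin> M"
proof
  assume "x \<in> M"
  have "chain T e k x \<in> borel_measurable borel"
    by (intro borel_measurable_continuous_onI continuous_on_chain T)
  then obtain r where r: "0 < r" "{t \<in> cball 0 r. chain T e k x t \<in> M} \<in> null_sets lborel"
    using null_preimage_strict_submersion[OF chain_has_strict_derivative[OF T]
        surj_chain_deriv[OF T e span] M] by metis
  have "{t. (\<forall>i<k. \<bar>t $ e i\<bar> < \<delta>) \<and> chain T e k x t \<notin> M} \<in> null_sets lborel"
    using M by (intro AE_chain_trapped[OF T e _ \<open>0 < \<delta>\<close> trap \<open>x \<in> M\<close> order_refl]) auto
  from null_sets.Un[OF r(2) this] have "ball 0 (min r \<delta>) \<in> null_sets (lborel :: (real ^ 'k) measure)"
  proof (rule null_sets_subset)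
    show "ball 0 (min r \<delta>) \<subseteq> {t \<in> cball 0 r. chain T e k x t \<in> M} \<union>
        {t. (\<forall>i<k. \<bar>t $ e i\<bar> < \<delta>) \<and> chain T e k x t \<notin> M}"
      by (auto intro: le_less_trans[OF component_le_norm_cart])
  qed auto
  then have "negligible (ball (0 :: real ^ 'k) (min r \<delta>))"
    by (simp add: negligible_iff_null_sets null_sets_completionI)
  then show False using open_not_negligible[of "ball (0 :: real ^ 'k) (min r \<delta>)"] r(1) \<open>0 < \<delta>\<close> by auto
qed

end

section \<open>The torus\<close>

lemma null_sets_lborel_iff_negligible:
  "N \<in> sets borel \<Longrightarrow> N \<in> null_sets lborel \<longleftrightarrow> negligible N"
  by (simp add: negligible_iff_null_sets null_sets_completion_iff)

definition integer_points :: "(real ^ 'n) set" where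
  "integer_points = {z. \<forall>i. z $ i \<in> \<int>}"

lemma countable_integer_points: "countable (integer_points :: (real ^ 'n::finite) set)"
proof -
  have "(integer_points :: (real ^ 'n) set) \<subseteq> range (\<lambda>k :: 'n \<Rightarrow> int. \<chi> i. of_int (k i))"
  proof
    fix z :: "real ^ 'n" assume "z \<in> integer_points"
    then have "\<forall>i. \<exists>k. z $ i = of_int k" by (auto simp: integer_points_def elim!: Ints_cases)
    then obtain k where "\<forall>i. z $ i = of_int (k i)" by metis
    then show "z \<in> range (\<lambda>k :: 'n \<Rightarrow> int. \<chi> i. of_int (k i))" by (auto simp: vec_eq_iff)
  qed
  then show ?thesis by (rule countable_subset) (rule countable_image, rule countableI_type)
qed

lemma abs_torus_eq_integer: "abs_torus x = abs_torus y \<longleftrightarrow> x - y \<in> integer_points"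
  by (simp add: abs_torus_eq_iff lattice_rel_def integer_points_def)

lemma abs_torus_add_integer [simp]: "z \<in> integer_points \<Longrightarrow> abs_torus (x + z) = abs_torus x"
  by (simp add: abs_torus_eq_integer)

lemma open_image_abs_torus:
  assumes "open U"
  shows "open (abs_torus ` U)"
  unfolding open_dist
proof safe
  fix x assume "x \<in> U"
  then obtain e where e: "0 < e" "\<And>y. dist y x < e \<Longrightarrow> y \<in> U"
    using assms by (auto simp: open_dist)
  have "q \<in> abs_torus ` U" if "dist q (abs_torus x) < e" for q
    using that dist_torus_less[of x q e] e(2) by (metis dist_commute imageI)
  with e(1) show "\<exists>e>0. \<forall>q. dist q (abs_torus x) < e \<longrightarrow> q \<in> abs_torus ` U" by blast
qed

text \<open>The projection is open and surjective, so the torus carries the quotient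
  topology.\<close>

lemma continuous_on_torusI:
  fixes g :: "'n::finite torus \<Rightarrow> 'b::topological_space"
  assumes "continuous_on UNIV (\<lambda>x. g (abs_torus x))"
  shows "continuous_on UNIV g"
proof -
  have "open (g -` S)" if "open S" for S
  proof -
    have "g -` S = abs_torus ` ((\<lambda>x. g (abs_torus x)) -` S)"
    proof (intro equalityI subsetI)
      fix p assume "p \<in> g -` S"
      then show "p \<in> abs_torus ` ((\<lambda>x. g (abs_torus x)) -` S)"
        by (intro image_eqI[of p abs_torus "rep_torus p"]) auto
    qed auto
    moreover have "open ((\<lambda>x. g (abs_torus x)) -` S)"
      using that assms by (rule open_vimage)
    ultimately show ?thesis by (simp only: open_image_abs_torus)
  qed
  then show ?thesis by (subst continuous_on_open_vimage) auto
qed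

text \<open>With a countable base the Borel sets of the product of torus and time axis are the
  product sigma-algebra; Fubini's theorem for the flow relies on this.\<close>

instance torus :: (finite) second_countable_topology
proof
  obtain B :: "(real ^ 'a) set set" where B: "countable B" "topological_basis B"
    using ex_countable_basis by blast
  have "topological_basis ((`) abs_torus ` B)"
  proof (rule topological_basisI)
    show "open C" if "C \<in> (`) abs_torus ` B" for C
      using that B(2) by (auto intro: open_image_abs_torus topological_basis_open)
    fix U and p :: "'a torus" assume "open U" "p \<in> U"
    then have "open (abs_torus -` U)"
      by (intro open_vimage continuous_on_abs_torus)
    moreover have "rep_torus p \<in> abs_torus -` U" using \<open>p \<in> U\<close> by simp
    ultimately obtain C where "C \<in> B" "rep_torus p \<in> C" "C \<subseteq> abs_torus -` U"
      using topological_basisE[OF B(2)] by metis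
    then show "\<exists>C\<in>(`) abs_torus ` B. p \<in> C \<and> C \<subseteq> U"
      by (auto intro!: bexI[of _ C] image_eqI[of p abs_torus "rep_torus p"])
  qed
  then show "\<exists>B :: 'a torus set set. countable B \<and> open = generate_topology B"
    using B(1) topological_basis_imp_subbasis by blast
qed

lemma measurable_abs_torus [measurable]: "abs_torus \<in> borel_measurable borel"
  by (intro borel_measurable_continuous_onI continuous_on_abs_torus)

lemma vimage_abs_torus_borel: "N \<in> sets borel \<Longrightarrow> abs_torus -` N \<in> sets borel"
  using measurable_sets[OF measurable_abs_torus, of N] by simp

text \<open>The full preimage is covered by countably many integer translates of its part in the
  unit cube, which is what the measure sees. Null sets can then be handled in Euclidean
  space.\<close>

lemma null_sets_torus_measure:
  fixes N :: "'n::finite torus set"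
  shows "N \<in> null_sets torus_measure \<longleftrightarrow> N \<in> sets borel \<and> abs_torus -` N \<in> null_sets lborel"
proof (cases "N \<in> sets borel")
  case True
  let ?Q = "{x :: real ^ 'n. \<forall>i. 0 \<le> x $ i \<and> x $ i < 1}"
  have Q: "?Q \<in> sets borel" by measurable
  have N: "abs_torus -` N \<in> sets borel" by (rule vimage_abs_torus_borel[OF True])
  have "abs_torus \<in> measurable (restrict_space lborel ?Q) borel"
    by (intro measurable_restrict_space1) simp
  then have "emeasure torus_measure N = emeasure (restrict_space lborel ?Q) (abs_torus -` N \<inter> space (restrict_space lborel ?Q))"
    unfolding torus_measure_def using True by (rule emeasure_distr)
  also have "\<dots> = emeasure lborel (abs_torus -` N \<inter> ?Q)"
    using Q by (subst emeasure_restrict_space) (auto simp: space_restrict_space)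
  finally have *: "emeasure torus_measure N = emeasure lborel (abs_torus -` N \<inter> ?Q)" .
  have "abs_torus -` N \<in> null_sets lborel" if "emeasure lborel (abs_torus -` N \<inter> ?Q) = 0"
  proof -
    have "abs_torus -` N \<inter> ?Q \<in> null_sets lborel" using that N Q by (intro null_setsI) auto
    then have "negligible (abs_torus -` N \<inter> ?Q)"
      by (simp add: negligible_iff_null_sets null_sets_completionI)
    then have "negligible (\<Union>z\<in>integer_points. (+) z ` (abs_torus -` N \<inter> ?Q))"
      by (intro negligible_countable_Union countable_image countable_integer_points)
         (auto intro: negligible_translation)
    moreover have "abs_torus -` N \<subseteq> (\<Union>z\<in>integer_points. (+) z ` (abs_torus -` N \<inter> ?Q))"
    proof
      fix x assume x: "x \<in> abs_torus -` N"
      define z :: "real ^ 'n" where "z = (\<chi> i. of_int \<lfloor>x $ i\<rfloor>)"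
      have z: "z \<in> integer_points" by (simp add: z_def integer_points_def)
      then have "abs_torus (x - z) = abs_torus x" using abs_torus_add_integer[of z "x - z"] by simp
      moreover have "x - z \<in> ?Q" by (auto simp: z_def) linarith
      ultimately show "x \<in> (\<Union>z\<in>integer_points. (+) z ` (abs_torus -` N \<inter> ?Q))"
        using x z by (intro UN_I[OF z] image_eqI[of _ _ "x - z"]) auto
    qed
    ultimately have "negligible (abs_torus -` N)" by (rule negligible_subset)
    then show ?thesis using N by (simp add: null_sets_lborel_iff_negligible)
  qed
  moreover have "emeasure lborel (abs_torus -` N \<inter> ?Q) = 0" if "abs_torus -` N \<in> null_sets lborel"
  proof -
    have "abs_torus -` N \<inter> ?Q \<in> null_sets lborel" using Q by (intro null_set_Int2 that) simp
    then show ?thesis by (simp add: null_sets_def)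
  qed
  ultimately have "emeasure torus_measure N = 0 \<longleftrightarrow> abs_torus -` N \<in> null_sets lborel"
    unfolding * by blast
  moreover have "N \<in> sets torus_measure" using True by (simp add: torus_measure_def)
  ultimately show ?thesis using True by (simp add: null_sets_def[of torus_measure])
qed (simp add: null_sets_def torus_measure_def)

section \<open>The flow on the torus, arcs and their uniform distributions\<close>

locale torus_field =
  fixes V :: "'n::finite torus \<Rightarrow> real ^ 'n" and L :: real
  assumes lipschitz_lift: "lipschitz_field (\<lambda>x. V (abs_torus x)) L"
begin

sublocale lift: lipschitz_field "\<lambda>x. V (abs_torus x)" L
  by (rule lipschitz_lift)

lemma flow_translate:
  assumes "z \<in> integer_points"
  shows "lift.flow t (x + z) = lift.flow t x + z"
proof -
  have "lift.solution (\<lambda>t. lift.flow t x + z)"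
    unfolding lift.solution_def using assms
    by (auto intro!: derivative_eq_intros lift.flow_deriv)
  from lift.flow_eqI[OF this, of t] show ?thesis by (simp add: lift.flow_solution)
qed

text \<open>The definite description in \<open>integral_curve\<close> is justified here: a lift of
  any integral curve starts at an integer translate of \<open>x\<close>, so it is a translate of the
  lifted flow line and has the same projection.\<close>

lemma integral_curve_abs_torus: "integral_curve V (abs_torus x) = (\<lambda>t. abs_torus (lift.flow t x))"
  unfolding integral_curve_def
proof (rule the_equality)
  show "is_integral_curve V (abs_torus x) (\<lambda>t. abs_torus (lift.flow t x))"
    unfolding is_integral_curve_def
    by (auto simp: lift.flow_solution intro!: exI[of _ "\<lambda>t. lift.flow t x"] lift.flow_deriv)
  fix \<gamma> assume "is_integral_curve V (abs_torus x) \<gamma>"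
  then obtain c where c: "\<gamma> 0 = abs_torus x" "\<And>t. \<gamma> t = abs_torus (c t)" "lift.solution c"
    unfolding is_integral_curve_def lift.solution_def by metis
  then have z: "c 0 - x \<in> integer_points" by (simp flip: abs_torus_eq_integer)
  have "c t = lift.flow t x + (c 0 - x)" for t
    using lift.flow_eqI[OF c(3), of t] flow_translate[OF z, of t x] by simp
  then show "\<gamma> = (\<lambda>t. abs_torus (lift.flow t x))" using z c(2) by (metis abs_torus_add_integer)
qed

lemma integral_curve_0 [simp]: "integral_curve V p 0 = p"
  by (cases p rule: torus_cases) (simp add: integral_curve_abs_torus lift.flow_solution)

lemma integral_curve_add: "integral_curve V p (t + s) = integral_curve V (integral_curve V p s) t"
  by (cases p rule: torus_cases) (simp add: integral_curve_abs_torus lift.flow_add)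

lemma dist_integral_curve: "dist (integral_curve V p t) (integral_curve V p s) \<le> \<bar>t - s\<bar>"
proof (cases p rule: torus_cases)
  case (abs x)
  then show ?thesis
    using order_trans[OF dist_torus_le lift.flow_lipschitz_time[of t x s, folded dist_norm]]
    by (simp add: integral_curve_abs_torus)
qed

lemma continuous_on_integral_curve: "continuous_on S (integral_curve V p)"
  by (rule lipschitz_on_continuous_on[of 1]) (auto simp: lipschitz_on_def dist_integral_curve dist_real_def)

text \<open>Joint continuity descends from the lift because the projection maps open boxes to open
  sets.\<close>

lemma continuous_on_torus_flow: "continuous_on UNIV (\<lambda>(p, t). integral_curve V p t)"
proof -
  have "open ((\<lambda>(p, t). integral_curve V p t) -` S)" if "open S" for S
  proof -
    let ?W = "(\<lambda>(t, x). abs_torus (lift.flow t x)) -` S"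
    have "continuous_on UNIV (abs_torus \<circ> (\<lambda>(t, x). lift.flow t x))"
      by (intro continuous_on_compose lift.continuous_on_flow continuous_on_abs_torus)
    then have "continuous_on UNIV (\<lambda>(t, x). abs_torus (lift.flow t x))"
      by (simp add: case_prod_beta' o_def)
    with that have W: "open ?W" by (rule open_vimage)
    have "\<exists>A B. open A \<and> open B \<and> (p, t) \<in> A \<times> B \<and> A \<times> B \<subseteq> (\<lambda>(p, t). integral_curve V p t) -` S"
      if pt: "integral_curve V p t \<in> S" for p t
    proof (cases p rule: torus_cases)
      case (abs x)
      then have "(t, x) \<in> ?W" using pt by (simp add: integral_curve_abs_torus)
      from open_prod_elim[OF W this] obtain B A
        where "open B" "open A" "(t, x) \<in> B \<times> A" "B \<times> A \<subseteq> ?W"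
        by blast
      then show ?thesis
        using abs open_image_abs_torus[of A]
        by (intro exI[of _ "abs_torus ` A"] exI[of _ B]) (auto simp: integral_curve_abs_torus)
    qed
    then show ?thesis unfolding open_prod_def by auto
  qed
  then show ?thesis by (subst continuous_on_open_vimage) auto
qed

text \<open>The time component may be unbounded and its image not closed; cutting it at
  \<open>[-n, n]\<close> exhibits the arc as a countable union of compact sets.\<close>

lemma sets_arc [measurable]: "arc V \<epsilon> p \<in> sets borel"
proof -
  let ?C = "connected_component_set {t. dist (integral_curve V p t) p \<le> \<epsilon>} 0"
  have "closed {t. dist (integral_curve V p t) p \<le> \<epsilon>}"
    by (intro closed_Collect_le continuous_intros continuous_on_integral_curve)
  then have "closed ?C" by (rule closed_connected_component)
  then have "compact (?C \<inter> {- real n..real n})" for n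
    by (rule closed_Int_compact) (rule compact_Icc)
  then have "closed (integral_curve V p ` (?C \<inter> {- real n..real n}))" for n
    by (intro compact_imp_closed compact_continuous_image continuous_on_integral_curve)
  then have "(\<Union>n. integral_curve V p ` (?C \<inter> {- real n..real n})) \<in> sets borel" by auto
  moreover have "arc V \<epsilon> p = (\<Union>n. integral_curve V p ` (?C \<inter> {- real n..real n}))"
    unfolding arc_def
  proof (intro equalityI subsetI)
    fix q assume "q \<in> integral_curve V p ` ?C"
    then obtain t where t: "t \<in> ?C" "q = integral_curve V p t" by blast
    obtain n where "\<bar>t\<bar> \<le> real n" using real_arch_simple by blast
    then show "q \<in> (\<Union>n. integral_curve V p ` (?C \<inter> {- real n..real n}))"
      using t by (intro UN_I[of n] image_eqI[of _ _ t]) auto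
  qed blast
  ultimately show ?thesis by simp
qed

text \<open>The speed is at most 1, so the point stays within distance \<open>\<epsilon>\<close>
  during this connected time interval. It is the uniform lower bound on arcs that the trapping
  argument needs.\<close>

lemma short_time_in_arc:
  assumes "\<bar>t\<bar> \<le> \<epsilon>"
  shows "integral_curve V p t \<in> arc V \<epsilon> p"
proof -
  have "{- \<epsilon>..\<epsilon>} \<subseteq> connected_component_set {t. dist (integral_curve V p t) p \<le> \<epsilon>} 0"
  proof (rule connected_component_maximal)
    show "{- \<epsilon>..\<epsilon>} \<subseteq> {t. dist (integral_curve V p t) p \<le> \<epsilon>}"
      using order_trans[OF dist_integral_curve[of p _ 0]] by auto
  qed (use assms in auto)
  moreover have "t \<in> {- \<epsilon>..\<epsilon>}" using assms by auto
  ultimately show ?thesis unfolding arc_def by blast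
qed

lemma sets_orbit_length [simp, measurable_cong]: "sets (orbit_length V p) = sets borel"
  by (simp add: orbit_length_def)

lemma sets_orbit_times [measurable]: "orbit_times V p \<in> sets borel"
  by (simp add: orbit_times_def)

lemma emeasure_orbit_length:
  assumes "N \<in> sets borel"
  shows "emeasure (orbit_length V p) N =
    emeasure lborel {t \<in> orbit_times V p. integral_curve V p t \<in> N}"
proof -
  have [measurable]: "integral_curve V p \<in> borel_measurable borel"
    by (intro borel_measurable_continuous_onI continuous_on_integral_curve)
  have "integral_curve V p \<in> measurable (restrict_space lborel (orbit_times V p)) borel"
    by (intro measurable_restrict_space1) simp
  then have "emeasure (orbit_length V p) N = emeasure (restrict_space lborel (orbit_times V p))
      (integral_curve V p -` N \<inter> space (restrict_space lborel (orbit_times V p)))"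
    unfolding orbit_length_def using assms by (rule emeasure_distr)
  also have "\<dots> = emeasure lborel (integral_curve V p -` N \<inter> orbit_times V p)"
    by (subst emeasure_restrict_space) (auto simp: space_restrict_space)
  also have "integral_curve V p -` N \<inter> orbit_times V p = {t \<in> orbit_times V p. integral_curve V p t \<in> N}"
    by auto
  finally show ?thesis .
qed

lemma emeasure_uniform_on_arc:
  assumes "N \<in> sets borel"
  shows "emeasure (uniform_on_arc V \<epsilon> p) N =
    emeasure (orbit_length V p) (arc V \<epsilon> p \<inter> N) / emeasure (orbit_length V p) (arc V \<epsilon> p)"
  unfolding uniform_on_arc_def using assms by (intro emeasure_uniform_measure) auto

lemma uniform_on_arc_null:
  assumes N: "N \<in> sets borel" and "AE t in lborel. integral_curve V p t \<notin> N"
  shows "emeasure (uniform_on_arc V \<epsilon> p) N = 0"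
proof -
  have [measurable]: "integral_curve V p \<in> borel_measurable borel"
    by (intro borel_measurable_continuous_onI continuous_on_integral_curve)
  have "AE t in lborel. t \<notin> {t \<in> orbit_times V p. integral_curve V p t \<in> arc V \<epsilon> p \<inter> N}"
    using assms(2) by eventually_elim auto
  moreover have "{t \<in> orbit_times V p. integral_curve V p t \<in> arc V \<epsilon> p \<inter> N} \<in> sets lborel"
    using N by measurable
  ultimately have "emeasure (orbit_length V p) (arc V \<epsilon> p \<inter> N) = 0"
    using N by (simp add: emeasure_orbit_length AE_iff_measurable[OF _ refl] conj_ac)
  then show ?thesis using N by (simp add: emeasure_uniform_on_arc)
qed

lemma uniform_on_arc_le_1:
  assumes "N \<in> sets borel"
  shows "emeasure (uniform_on_arc V \<epsilon> p) N \<le> 1"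
proof -
  let ?a = "emeasure (orbit_length V p) (arc V \<epsilon> p)"
  have "emeasure (orbit_length V p) (arc V \<epsilon> p \<inter> N) / ?a \<le> ?a / ?a"
    by (intro divide_right_mono_ennreal emeasure_mono) auto
  also have "\<dots> \<le> 1"
  proof (cases "?a = 0 \<or> ?a = \<top>")
    \<comment> \<open>In both degenerate cases the quotient is 0 by the convention that 0 times
      infinity is 0.\<close>
    case True
    then show ?thesis by (auto simp: divide_ennreal_def)
  qed (simp add: less_top)
  finally show ?thesis using assms by (simp add: emeasure_uniform_on_arc)
qed

text \<open>On a closed orbit the hypothesis speaks about one period only, so the conclusion is moved there by periodicity.\<close>

lemma uniform_on_arc_full:
  assumes N: "N \<in> sets borel" and full: "1 \<le> emeasure (uniform_on_arc V \<epsilon> p) N"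
  shows "AE t in lborel. \<bar>t\<bar> < \<epsilon> \<longrightarrow> integral_curve V p t \<in> N"
proof -
  let ?l = "orbit_length V p" and ?a = "arc V \<epsilon> p"
  have meas [measurable]: "integral_curve V p \<in> borel_measurable borel"
    by (intro borel_measurable_continuous_onI continuous_on_integral_curve)
  note [measurable] = N
  have *: "1 \<le> emeasure ?l (?a \<inter> N) / emeasure ?l ?a"
    using full N by (simp add: emeasure_uniform_on_arc)
  have "emeasure ?l (?a \<inter> N) \<le> emeasure ?l ?a" by (intro emeasure_mono) auto
  \<comment> \<open>An arc of length 0 or of infinite length would give the quotient 0.\<close>
  with * have nz: "emeasure ?l ?a \<noteq> 0" and fin: "emeasure ?l ?a \<noteq> \<infinity>"
    by (auto simp: divide_ennreal_def)
  have "emeasure ?l ?a \<le> emeasure ?l (?a \<inter> N)"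
    using nz fin mult_right_mono[OF *, of "emeasure ?l ?a"]
    by (simp add: ennreal_divide_times less_top)
  moreover have "emeasure ?l (?a - N) = emeasure ?l ?a - emeasure ?l (?a \<inter> N)"
  proof -
    have "emeasure ?l (?a - ?a \<inter> N) = emeasure ?l ?a - emeasure ?l (?a \<inter> N)"
      using fin by (intro emeasure_Diff) (use \<open>emeasure ?l (?a \<inter> N) \<le> emeasure ?l ?a\<close> in \<open>auto simp: top_unique\<close>)
    moreover have "?a - ?a \<inter> N = ?a - N" by auto
    ultimately show ?thesis by simp
  qed
  ultimately have "emeasure ?l (?a - N) = 0"
    using fin by (simp add: diff_eq_0_iff_ennreal less_top)
  then have bad: "{t \<in> orbit_times V p. integral_curve V p t \<in> ?a - N} \<in> null_sets lborel"
    by (intro null_setsI) (auto simp: emeasure_orbit_length)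
  show ?thesis
  proof (cases "\<exists>T>0. integral_curve V p T = p")
    case False
    then have all: "orbit_times V p = UNIV" by (simp only: orbit_times_def if_False)
    from AE_not_in[OF bad] show ?thesis
      by eventually_elim (auto simp: all intro: short_time_in_arc)
  next
    case True
    define P where "P = {T. 0 < T \<and> integral_curve V p T = p}"
    define T where "T = Inf P"
    have times: "orbit_times V p = {0..<T}" using True by (simp only: orbit_times_def T_def P_def if_True)
    have P: "P \<noteq> {}" "bdd_below P" using True by (auto simp: P_def intro!: bdd_belowI[of _ 0])
    \<comment> \<open>If the infimum of the return times were 0, the set of orbit times would be
      empty and the arc would have length 0, against \<open>nz\<close>.\<close>
    have "0 < T"
    proof (rule ccontr)
      assume "\<not> 0 < T"
      then have "orbit_times V p = {}" using times by simp
      then show False using nz by (simp add: emeasure_orbit_length)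
    qed
    have period: "integral_curve V p T = p"
    proof -
      have "closed {t. integral_curve V p t = p}"
        by (intro closed_Collect_eq continuous_on_integral_curve continuous_on_const)
      moreover have "T \<in> closure P" unfolding T_def by (rule closure_contains_Inf[OF P])
      moreover have "P \<subseteq> {t. integral_curve V p t = p}" by (auto simp: P_def)
      ultimately show ?thesis using closure_minimal by blast
    qed
    have per: "integral_curve V p (t + real k * T) = integral_curve V p t" for t k
    proof (induction k)
      case (Suc k)
      have "integral_curve V p (t + real (Suc k) * T) = integral_curve V p ((t + real k * T) + T)"
        by (simp add: algebra_simps)
      also have "\<dots> = integral_curve V p (t + real k * T)"
        by (subst integral_curve_add) (simp add: period)
      finally show ?case using Suc by simp
    qed simp
    have per': "integral_curve V p (t - of_int k * T) = integral_curve V p t" for t and k :: int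
    proof (cases "0 \<le> k")
      case True
      then show ?thesis using per[of "t - of_int k * T" "nat k"] by simp
    next
      case False
      then show ?thesis using per[of t "nat (- k)"] by (simp add: of_nat_nat)
    qed
    have "AE t in lborel. t - of_int k * T \<notin> {t \<in> orbit_times V p. integral_curve V p t \<in> ?a - N}" for k :: int
    proof -
      have "AE t in lborel. (- of_int k * T) + 1 * t \<notin> {t \<in> orbit_times V p. integral_curve V p t \<in> ?a - N}"
        by (rule AE_borel_affine[OF _ _ AE_not_in[OF bad]]) (auto, measurable)
      then show ?thesis by simp
    qed
    \<comment> \<open>Only countably many translates of the exceptional set occur, so almost every
      time can be reduced to one period while avoiding it.\<close>
    then have "AE t in lborel. \<forall>k :: int. t - of_int k * T \<notin> {t \<in> orbit_times V p. integral_curve V p t \<in> ?a - N}"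
      by (simp add: AE_all_countable)
    then show ?thesis
    proof eventually_elim
      case (elim t)
      define k where "k = \<lfloor>t / T\<rfloor>"
      have "of_int k \<le> t / T" "t / T < of_int k + 1" unfolding k_def by linarith+
      then have "t - of_int k * T \<in> {0..<T}" using \<open>0 < T\<close> by (simp add: field_simps)
      then show ?case
        using elim[rule_format, of k] short_time_in_arc[of t \<epsilon> p] by (auto simp: times per')
    qed
  qed
qed

end

section \<open>Invariant measures\<close>

text \<open>
  The integral of a nonmeasurable function is a lower integral. This makes the measurability of
  the transition kernel superfluous.
\<close>

lemma nn_integral_attained:
  "\<exists>g\<in>borel_measurable M. (\<forall>x. g x \<le> f x) \<and> integral\<^sup>N M g = integral\<^sup>N M f"
proof -
  let ?A = "{g. simple_function M g \<and> g \<le> f}"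
  have "?A \<noteq> {}" by (auto intro!: exI[of _ "\<lambda>_. 0"] simp: le_fun_def)
  then obtain G where G: "range G \<subseteq> integral\<^sup>S M ` ?A" "(SUP g\<in>?A. integral\<^sup>S M g) = (SUP i::nat. G i)"
    using ennreal_SUP_countable_SUP[of ?A "integral\<^sup>S M"] by metis
  have "\<exists>g\<in>?A. integral\<^sup>S M g = G i" for i
    using subsetD[OF G(1) rangeI[of G i]] by (auto simp only: image_iff)
  then obtain h where h: "\<And>i. simple_function M (h i)" "\<And>i. h i \<le> f" "\<And>i. integral\<^sup>S M (h i) = G i"
    by (simp only: mem_Collect_eq Bex_def) metis
  define g where "g x = (SUP i. h i x)" for x
  have "g \<in> borel_measurable M"
    unfolding g_def using h(1)
    by (intro borel_measurable_SUP countableI_type borel_measurable_simple_function)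
  moreover have "g x \<le> f x" for x
    unfolding g_def using h(2) by (intro SUP_least) (auto simp: le_fun_def)
  moreover have "integral\<^sup>N M f \<le> integral\<^sup>N M g"
  proof -
    have "G i \<le> integral\<^sup>N M g" for i
    proof -
      have "G i = integral\<^sup>N M (h i)" using h by (simp add: nn_integral_eq_simple_integral)
      also have "\<dots> \<le> integral\<^sup>N M g" by (intro nn_integral_mono) (auto simp: g_def intro: SUP_upper)
      finally show ?thesis .
    qed
    then show ?thesis using G(2) by (simp add: nn_integral_def[of M f] SUP_least)
  qed
  ultimately show ?thesis
    using nn_integral_mono[of M g f] by (auto intro!: bexI[of _ g] antisym)
qed

text \<open>One shrinking step makes the points of \<open>K'\<close> enter \<open>K\<close>, not yet
  \<open>K'\<close>. Iterating it and intersecting the decreasing sets loses no mass, since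
  \<open>\<mu>\<close> and all \<open>P x\<close> are continuous from above, and leaves a set that
  its own points enter with full probability.\<close>

lemma invariant_measure_trapped:
  fixes P :: "'a::topological_space \<Rightarrow> 'a measure"
  assumes inv: "invariant_measure P \<mu>" and m: "sets m = sets borel"
    and P: "\<And>x. sets (P x) = sets borel" "\<And>x A. A \<in> sets borel \<Longrightarrow> emeasure (P x) A \<le> 1"
    and null: "\<And>N. N \<in> null_sets m \<Longrightarrow> \<exists>N'\<in>null_sets m. \<forall>x. x \<notin> N' \<longrightarrow> emeasure (P x) N = 0"
    and not_ac: "\<not> absolutely_continuous m \<mu>"
  obtains S where "S \<in> null_sets m" "emeasure \<mu> S \<noteq> 0" "\<And>x. x \<in> S \<Longrightarrow> 1 \<le> emeasure (P x) S"
proof -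
  interpret \<mu>: prob_space \<mu> using inv by (simp add: invariant_measure_def)
  have sets [measurable_cong, simp]: "sets \<mu> = sets borel" using inv by (simp add: invariant_measure_def)
  have [simp]: "space \<mu> = UNIV" using sets_eq_imp_space_eq[OF sets] by simp
  have null_borel: "N \<in> sets borel" if "N \<in> null_sets m" for N using that m by auto
  define s where "s = (SUP N\<in>null_sets m. emeasure \<mu> N)"
  have s_upper: "emeasure \<mu> N \<le> s" if "N \<in> null_sets m" for N
    unfolding s_def using that by (rule SUP_upper)
  obtain N where N: "N \<in> null_sets m" "emeasure \<mu> N = s"
  proof -
    have "null_sets m \<noteq> {}" using null_sets.empty_sets by blast
    then obtain G where G: "range G \<subseteq> emeasure \<mu> ` null_sets m" "s = (SUP i::nat. G i)"
      unfolding s_def using ennreal_SUP_countable_SUP[of "null_sets m" "emeasure \<mu>"] by metis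
    have "\<exists>N\<in>null_sets m. emeasure \<mu> N = G i" for i
      using subsetD[OF G(1) rangeI[of G i]] by (auto simp only: image_iff)
    then obtain K where K: "\<And>i. K i \<in> null_sets m" "\<And>i. emeasure \<mu> (K i) = G i" by metis
    have U: "(\<Union>i. K i) \<in> null_sets m" using K by auto
    have "s \<le> emeasure \<mu> (\<Union>i. K i)"
      unfolding G(2) K(2)[symmetric] using null_borel[OF U]
      by (intro SUP_least emeasure_mono) auto
    then show ?thesis using that U s_upper antisym by blast
  qed
  have "s \<noteq> 0"
  proof
    assume "s = 0"
    then have "emeasure \<mu> N = 0" if "N \<in> null_sets m" for N using s_upper[OF that] by simp
    then have "absolutely_continuous m \<mu>"
      using null_borel by (auto simp: absolutely_continuous_def null_sets_def[of \<mu>])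
    then show False using not_ac by simp
  qed
  text \<open>By maximality, the points outside \<open>K\<close> from which \<open>K\<close> can be entered are not charged by \<open>\<mu>\<close>.\<close>
  have shrink: "\<exists>K'. K' \<in> null_sets m \<and> emeasure \<mu> K' = s \<and> K' \<subseteq> K \<and> (\<forall>x\<in>K'. 1 \<le> emeasure (P x) K)"
    if K: "K \<in> null_sets m" "emeasure \<mu> K = s" for K
  proof -
    note [measurable] = null_borel[OF K(1)]
    obtain N' where N': "N' \<in> null_sets m" "\<And>x. x \<notin> N' \<Longrightarrow> emeasure (P x) K = 0"
      using null[OF K(1)] by blast
    note [measurable] = null_borel[OF N'(1)]
    obtain g where g [measurable]: "g \<in> borel_measurable \<mu>" and g_le: "\<And>x. g x \<le> emeasure (P x) K"
      and g_int: "integral\<^sup>N \<mu> g = (\<integral>\<^sup>+x. emeasure (P x) K \<partial>\<mu>)"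
      using nn_integral_attained[of \<mu> "\<lambda>x. emeasure (P x) K"] by auto
    have g_eq: "integral\<^sup>N \<mu> g = s"
      using inv g_int K(2) null_borel[OF K(1)] by (simp add: invariant_measure_def)
    have "emeasure \<mu> (N' - K) = 0"
    proof -
      have "emeasure \<mu> K + emeasure \<mu> (N' - K) = emeasure \<mu> (K \<union> N')"
        by (subst plus_emeasure) (auto intro: arg_cong[where f = "emeasure \<mu>"])
      also have "\<dots> \<le> emeasure \<mu> K + 0" using s_upper[OF null_sets.Un[OF K(1) N'(1)]] K(2) by simp
      finally show ?thesis using \<mu>.emeasure_finite[of K] by (simp only: ennreal_add_left_cancel_le) simp
    qed
    then have "AE x in \<mu>. x \<notin> N' - K" by (intro AE_not_in null_setsI) auto
    then have off: "AE x in \<mu>. g x = g x * indicator K x"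
    proof eventually_elim
      case (elim x)
      then show ?case using N'(2)[of x] g_le[of x] by (auto simp: indicator_def)
    qed
    \<comment> \<open>\<open>g\<close> is at most 1 and its integral over \<open>K\<close> equals
      the mass of \<open>K\<close>; hence the nonnegative defect \<open>1 - g\<close> vanishes
      almost everywhere on \<open>K\<close>.\<close>
    have "(\<integral>\<^sup>+x. indicator K x - g x * indicator K x \<partial>\<mu>) = (\<integral>\<^sup>+x. indicator K x \<partial>\<mu>) - (\<integral>\<^sup>+x. g x * indicator K x \<partial>\<mu>)"
    proof (rule nn_integral_diff)
      show "AE x in \<mu>. g x * indicator K x \<le> indicator K x"
        using order_trans[OF g_le P(2)[OF null_borel[OF K(1)]]] by (auto simp: indicator_def)
      show "(\<integral>\<^sup>+x. g x * indicator K x \<partial>\<mu>) \<noteq> \<infinity>"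
        using nn_integral_cong_AE[OF off] g_eq K(2) \<mu>.emeasure_finite[of K] by simp
    qed auto
    also have "\<dots> = 0" using nn_integral_cong_AE[OF off] g_eq K(2) \<mu>.emeasure_finite[of K]
      by (simp add: diff_eq_0_iff_ennreal less_top)
    finally have "AE x in \<mu>. indicator K x - g x * indicator K x = 0"
      by (subst (asm) nn_integral_0_iff_AE) auto
    then have ret: "AE x in \<mu>. x \<in> K \<longrightarrow> x \<in> {x \<in> K. 1 \<le> g x}"
      by eventually_elim (auto simp: indicator_def diff_eq_0_iff_ennreal split: if_splits)
    \<comment> \<open>Cut out by the measurable minorant \<open>g\<close>, since \<open>P x\<close>
      need not be measurable in \<open>x\<close>.\<close>
    let ?K' = "{x \<in> K. 1 \<le> g x}"
    have [measurable]: "g \<in> borel_measurable borel"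
      using g by (simp cong: measurable_cong_sets)
    have K': "?K' \<in> sets borel" by measurable
    have "emeasure \<mu> ?K' = emeasure \<mu> K" using ret K' by (intro emeasure_eq_AE) auto
    moreover have "?K' \<in> null_sets m" using K(1) K' m by (intro null_sets_subset[OF K(1)]) auto
    ultimately show ?thesis using K(2) order_trans[OF _ g_le] by (intro exI[of _ ?K']) auto
  qed
  then obtain nxt where nxt: "\<And>K. K \<in> null_sets m \<Longrightarrow> emeasure \<mu> K = s \<Longrightarrow>
      nxt K \<in> null_sets m \<and> emeasure \<mu> (nxt K) = s \<and> nxt K \<subseteq> K \<and> (\<forall>x\<in>nxt K. 1 \<le> emeasure (P x) K)"
    by metis
  define K where "K i = (nxt ^^ i) N" for i
  have K: "K i \<in> null_sets m \<and> emeasure \<mu> (K i) = s" for i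
    unfolding K_def by (induction i) (use N nxt in auto)
  have KSuc: "K (Suc i) = nxt (K i)" for i by (simp add: K_def)
  have decK: "decseq K" using nxt K by (intro decseq_SucI) (auto simp: KSuc)
  have Kb: "K i \<in> sets borel" for i using K null_borel by blast
  let ?S = "\<Inter>i. K i"
  have "?S \<in> sets m" unfolding m using Kb by (intro sets.countable_INT) auto
  then have "?S \<in> null_sets m" by (rule null_sets_subset[OF conjunct1[OF K[of 0]]]) blast
  moreover have "emeasure \<mu> ?S = s"
  proof -
    have "emeasure \<mu> ?S = (INF i. emeasure \<mu> (K i))"
      using decK Kb by (intro INF_emeasure_decseq[symmetric]) auto
    then show ?thesis using K by simp
  qed
  moreover have "1 \<le> emeasure (P x) ?S" if "x \<in> ?S" for x
  proof -
    have "1 \<le> emeasure (P x) (K i)" for i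
    proof -
      have "x \<in> K (Suc i)" using that by blast
      then show ?thesis using nxt[of "K i"] K[of i] by (simp add: KSuc)
    qed
    moreover have "emeasure (P x) (K i) \<noteq> \<infinity>" for i
      using P(2)[OF Kb[of i], of x] by (auto simp: top_unique)
    then have "(INF i. emeasure (P x) (K i)) = emeasure (P x) ?S"
      using decK Kb P(1) by (intro INF_emeasure_decseq) auto
    ultimately show ?thesis by (metis INF_greatest)
  qed
  ultimately show ?thesis using that[of ?S] \<open>s \<noteq> 0\<close> by metis
qed

text \<open>For a fixed time \<open>t\<close>, the map \<open>lift.flow t (T x)\<close> of
  \<open>x\<close> is injective with Lipschitz inverse, so it pulls null sets back to null sets.
  Exchanging the order of integration, for almost every \<open>x\<close> almost all times avoid
  \<open>N\<close>.\<close>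

lemma (in torus_field) rank1_perturbation_null:
  assumes f: "\<And>x. f (abs_torus x) = abs_torus (T x)" and T: "linear T" "inj T"
    and N: "N \<in> null_sets torus_measure"
  shows "\<exists>N'\<in>null_sets torus_measure. \<forall>x. x \<notin> N' \<longrightarrow> emeasure (rank1_perturbation f V \<epsilon> x) N = 0"
proof -
  have Nb [measurable]: "N \<in> sets borel" and lift_null: "abs_torus -` N \<in> null_sets lborel"
    using N by (auto simp: null_sets_torus_measure)
  have contT: "continuous_on UNIV T" using T(1) by (simp add: linear_continuous_on linear_linear)
  have "continuous_on UNIV (\<lambda>x. f (abs_torus x))"
    unfolding f by (intro continuous_on_compose2[OF continuous_on_abs_torus contT]) auto
  then have contf: "continuous_on UNIV f" by (rule continuous_on_torusI)
  have "continuous_on UNIV ((\<lambda>(p, t). integral_curve V p t) \<circ> (\<lambda>(p, t). (f p, t)))"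
    unfolding case_prod_beta' using continuous_on_torus_flow
    by (intro continuous_on_compose continuous_intros continuous_on_compose2[OF contf])
       (auto simp: case_prod_beta' intro: continuous_on_subset)
  then have "(\<lambda>(p, t). integral_curve V (f p) t) \<in> borel_measurable (borel \<Otimes>\<^sub>M borel)"
    by (subst borel_prod) (auto intro!: borel_measurable_continuous_onI simp: case_prod_beta' o_def)
  then have [measurable]: "(\<lambda>(p, t). integral_curve V (f p) t) \<in> measurable (borel \<Otimes>\<^sub>M lborel) borel"
    by (simp cong: measurable_cong_sets)
  \<comment> \<open>The total time that the orbit of \<open>f p\<close> spends in \<open>N\<close>.
    As an integral it is measurable in \<open>p\<close>, which gives a Borel exceptional
    set.\<close>
  define w where "w p = (\<integral>\<^sup>+t. indicator N (integral_curve V (f p) t) \<partial>lborel)" for p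
  have w [measurable]: "w \<in> borel_measurable borel"
    unfolding w_def by measurable
  have w_lift: "w (abs_torus x) = (\<integral>\<^sup>+t. indicator (abs_torus -` N) (lift.flow t (T x)) \<partial>lborel)" for x
    unfolding w_def f integral_curve_abs_torus by (simp add: indicator_def)
  have meas: "(\<lambda>(x, t). indicator (abs_torus -` N) (lift.flow t (T x)) :: ennreal) \<in> borel_measurable (lborel \<Otimes>\<^sub>M lborel)"
  proof -
    have [measurable]: "abs_torus -` N \<in> sets borel" by (rule vimage_abs_torus_borel[OF Nb])
    have "continuous_on UNIV ((\<lambda>(t, x). lift.flow t x) \<circ> (\<lambda>(x, t). (t, T x)))"
      unfolding case_prod_beta' using lift.continuous_on_flow
      by (intro continuous_on_compose continuous_intros continuous_on_compose2[OF contT])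
         (auto simp: case_prod_beta')
    then have "(\<lambda>(x, t). lift.flow t (T x)) \<in> borel_measurable (borel \<Otimes>\<^sub>M borel)"
      by (subst borel_prod) (auto intro!: borel_measurable_continuous_onI simp: case_prod_beta' o_def)
    then have [measurable]: "(\<lambda>(x, t). lift.flow t (T x)) \<in> measurable (lborel \<Otimes>\<^sub>M lborel) borel"
      by (simp cong: measurable_cong_sets)
    show ?thesis by measurable
  qed
  have "(\<integral>\<^sup>+x. indicator (abs_torus -` N) (lift.flow t (T x)) \<partial>lborel) = (0 :: ennreal)" for t
  proof -
    let ?E = "(\<lambda>x. lift.flow t (T x)) -` (abs_torus -` N)"
    obtain R where R: "linear R" "R \<circ> T = id" using linear_injective_left_inverse[OF T] by blast
    obtain B where B: "0 < B" "\<And>y. norm (R y) \<le> norm y * B"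
      using bounded_linear.pos_bounded[OF linear_conv_bounded_linear[THEN iffD1, OF R(1)]] by blast
    have "negligible ((\<lambda>y. R (lift.flow (- t) y)) ` (abs_torus -` N))"
    proof (rule negligible_locally_Lipschitz_image)
      show "negligible (abs_torus -` N)"
        using lift_null by (simp add: negligible_iff_null_sets null_sets_completionI)
      fix y
      have "norm (R (lift.flow (- t) z) - R (lift.flow (- t) y)) \<le> (exp (L * \<bar>t\<bar>) * B) * norm (z - y)" for z
      proof -
        have "norm (R (lift.flow (- t) z - lift.flow (- t) y)) \<le> norm (lift.flow (- t) z - lift.flow (- t) y) * B"
          by (rule B)
        also have "\<dots> \<le> (exp (L * \<bar>- t\<bar>) * norm (z - y)) * B"
          using B by (intro mult_right_mono lift.flow_lipschitz_initial) simp
        finally show ?thesis by (simp add: linear_diff[OF R(1)] ac_simps)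
      qed
      then show "\<exists>U B. open U \<and> y \<in> U \<and> (\<forall>z\<in>abs_torus -` N \<inter> U.
          norm (R (lift.flow (- t) z) - R (lift.flow (- t) y)) \<le> B * norm (z - y))"
        by (intro exI[of _ UNIV] exI[of _ "exp (L * \<bar>t\<bar>) * B"]) auto
    qed simp
    moreover have "?E \<subseteq> (\<lambda>y. R (lift.flow (- t) y)) ` (abs_torus -` N)"
    proof
      fix x assume "x \<in> ?E"
      then show "x \<in> (\<lambda>y. R (lift.flow (- t) y)) ` (abs_torus -` N)"
        using R(2) by (intro image_eqI[of _ _ "lift.flow t (T x)"]) (simp_all add: pointfree_idE)
    qed
    ultimately have "negligible ?E" by (rule negligible_subset)
    moreover have "?E \<in> sets borel"
    proof -
      have "continuous_on UNIV ((\<lambda>y. lift.flow t y) \<circ> T)"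
        using lift.flow_lipschitz_initial[of t]
        by (intro continuous_on_compose contT lipschitz_on_continuous_on[of "exp (L * \<bar>t\<bar>)"])
           (auto simp: lipschitz_on_def dist_norm)
      then have "(\<lambda>x. lift.flow t (T x)) \<in> borel_measurable borel"
        by (intro borel_measurable_continuous_onI) (simp add: o_def)
      from measurable_sets[OF this vimage_abs_torus_borel[OF Nb]] show ?thesis by simp
    qed
    ultimately have "?E \<in> null_sets lborel" by (simp add: null_sets_lborel_iff_negligible)
    moreover have "(\<integral>\<^sup>+x. indicator (abs_torus -` N) (lift.flow t (T x)) \<partial>lborel) = (\<integral>\<^sup>+x. indicator ?E x \<partial>lborel)"
      by (simp add: indicator_def)
    ultimately show ?thesis by (auto simp: null_sets_def)
  qed
  then have "(\<integral>\<^sup>+x. w (abs_torus x) \<partial>lborel) = 0"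
    unfolding w_lift by (subst lborel_pair.Fubini'[OF meas, symmetric]) simp
  then have AE0: "AE x in lborel. w (abs_torus x) = 0"
    by (subst (asm) nn_integral_0_iff_AE) auto
  let ?N' = "{p. w p \<noteq> 0}"
  have N'b: "?N' \<in> sets borel" by measurable
  moreover have "abs_torus -` ?N' \<in> null_sets lborel"
    using AE0 vimage_abs_torus_borel[OF N'b] by (auto simp: AE_iff_null_sets vimage_def)
  ultimately have "?N' \<in> null_sets torus_measure" by (simp add: null_sets_torus_measure)
  moreover have "emeasure (rank1_perturbation f V \<epsilon> p) N = 0" if "p \<notin> ?N'" for p
  proof -
    have "(\<integral>\<^sup>+t. indicator N (integral_curve V (f p) t) \<partial>lborel) = 0" using that by (simp add: w_def)
    moreover have "integral_curve V (f p) \<in> borel_measurable borel"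
      by (intro borel_measurable_continuous_onI continuous_on_integral_curve)
    ultimately have "AE t in lborel. indicator N (integral_curve V (f p) t) = (0 :: ennreal)"
      by (subst (asm) nn_integral_0_iff_AE) auto
    then have "AE t in lborel. integral_curve V (f p) t \<notin> N"
      by eventually_elim (auto simp: indicator_def split: if_splits)
    then show ?thesis
      unfolding rank1_perturbation_def by (rule uniform_on_arc_null[OF Nb])
  qed
  ultimately show ?thesis by blast
qed

text \<open>Over a short time the displacement from \<open>y\<close> is at least half of that along
  \<open>v y\<close>, so visits to \<open>y\<close> are separated by a fixed time. This is why
  transition measures have no atoms.\<close>

lemma (in lipschitz_field) countable_visits:
  assumes "v y \<noteq> 0"
  shows "countable {t. flow t x = y}"
proof -
  have "0 < norm (v y) / 2" using assms by simp
  then obtain \<delta> where \<delta>: "0 < \<delta>"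
    "\<And>t s x' y'. \<bar>t\<bar> \<le> \<delta> \<Longrightarrow> \<bar>s\<bar> \<le> \<delta> \<Longrightarrow> norm (y' - y) \<le> \<delta> \<Longrightarrow>
      norm (flow t x' - flow s y' - ((x' - y') + (t - s) *\<^sub>R v y)) \<le> norm (v y) / 2 * (norm (x' - y') + \<bar>t - s\<bar>)"
    using flow_strict by blast
  have no_return: "t = 0" if "flow t y = y" "\<bar>t\<bar> \<le> \<delta>" for t
  proof -
    have "\<bar>t\<bar> * norm (v y) \<le> 0"
      using \<delta>(2)[of t 0 y y] \<delta>(1) that by (simp add: flow_solution)
    then show ?thesis using assms by (auto simp: mult_le_0_iff)
  qed
  \<comment> \<open>Each interval of length \<open>\<delta>\<close> contains at most one
    visit.\<close>
  have "inj_on (\<lambda>t. \<lfloor>t / \<delta>\<rfloor>) {t. flow t x = y}"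
  proof (rule inj_onI)
    fix t s assume t: "t \<in> {t. flow t x = y}" and s: "s \<in> {t. flow t x = y}"
      and "\<lfloor>t / \<delta>\<rfloor> = \<lfloor>s / \<delta>\<rfloor>"
    then have "\<bar>t / \<delta> - s / \<delta>\<bar> < 1" by linarith
    then have "\<bar>t - s\<bar> \<le> \<delta>" using \<delta>(1) by (simp add: abs_if field_simps split: if_splits)
    moreover have "flow (t - s) y = y" using flow_add[of "t - s" s x] t s by simp
    ultimately show "t = s" using no_return[of "t - s"] by simp
  qed
  then show ?thesis by (rule countableI')
qed

theorem (in torus_field) invariant_measure_absolutely_continuous:
  fixes e :: "nat \<Rightarrow> 'k::finite"
  assumes f: "\<And>x. f (abs_torus x) = abs_torus (T x)" and T: "linear T" "inj T"
    and "0 < \<epsilon>" and e: "inj_on e {..<k}" and V: "\<And>p. V p \<noteq> 0"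
    and F: "countable F"
    and span: "\<And>x \<xi>. x \<notin> F \<Longrightarrow> \<xi> \<noteq> 0 \<Longrightarrow>
      \<exists>j<k. \<xi> \<bullet> (T ^^ (k - 1 - j)) (V (abs_torus ((T ^^ Suc j) x))) \<noteq> 0"
    and inv: "invariant_measure (rank1_perturbation f V \<epsilon>) \<mu>"
  shows "absolutely_continuous torus_measure \<mu>"
proof (rule ccontr)
  let ?P = "rank1_perturbation f V \<epsilon>"
  assume "\<not> absolutely_continuous torus_measure \<mu>"
  then obtain S where S: "S \<in> null_sets torus_measure" "emeasure \<mu> S \<noteq> 0" "\<And>p. p \<in> S \<Longrightarrow> 1 \<le> emeasure (?P p) S"
  proof (rule invariant_measure_trapped[OF inv, rotated 4])
    show "sets torus_measure = sets borel" by (simp add: torus_measure_def)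
    show "sets (?P p) = sets borel" for p
      by (simp add: rank1_perturbation_def uniform_on_arc_def)
    show "emeasure (?P p) A \<le> 1" if "A \<in> sets borel" for p A
      unfolding rank1_perturbation_def by (rule uniform_on_arc_le_1[OF that])
    show "\<exists>N'\<in>null_sets torus_measure. \<forall>p. p \<notin> N' \<longrightarrow> emeasure (?P p) N = 0"
      if "N \<in> null_sets torus_measure" for N
      by (rule rank1_perturbation_null[where f = f, OF f T that])
  qed blast
  have Sb: "S \<in> sets borel" and S_null: "abs_torus -` S \<in> null_sets lborel"
    using S(1) by (auto simp: null_sets_torus_measure)
  have trap: "AE t in lborel. \<bar>t\<bar> < \<epsilon> \<longrightarrow> lift.flow t (T x) \<in> abs_torus -` S" if "x \<in> abs_torus -` S" for x
    using uniform_on_arc_full[OF Sb S(3)[of "abs_torus x", unfolded rank1_perturbation_def]] that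
    by (simp add: f integral_curve_abs_torus)
  have "abs_torus -` S \<subseteq> F"
  proof
    fix x assume x: "x \<in> abs_torus -` S"
    show "x \<in> F"
    proof (rule ccontr)
      assume "x \<notin> F"
      from lift.trapped_not_spanning[OF T(1) e S_null \<open>0 < \<epsilon>\<close> trap span[OF this]] x
      show False by blast
    qed
  qed
  then have "countable (abs_torus ` (abs_torus -` S))"
    using F by (intro countable_image) (rule countable_subset)
  moreover have "abs_torus ` (abs_torus -` S) = S"
    by (auto simp: image_iff) (metis abs_rep_torus)
  ultimately have countS: "countable S" by simp
  \<comment> \<open>A countable set is met at countably many times only, so no transition charges
    it; invariance then gives it mass 0.\<close>
  have "emeasure (?P p) S = 0" for p
    unfolding rank1_perturbation_def
  proof (rule uniform_on_arc_null[OF Sb])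
    obtain y where y: "f p = abs_torus y" by (rule torus_cases)
    have "countable (\<Union>z\<in>abs_torus -` S. {t. lift.flow t y = z})"
      using \<open>abs_torus -` S \<subseteq> F\<close> F V by (intro countable_UN lift.countable_visits) (auto intro: countable_subset)
    moreover have "(\<Union>z\<in>abs_torus -` S. {t. lift.flow t y = z}) = {t. integral_curve V (f p) t \<in> S}"
      by (auto simp: y integral_curve_abs_torus)
    ultimately have "{t. integral_curve V (f p) t \<in> S} \<in> null_sets lborel"
      using countable_imp_null_set_lborel by metis
    from AE_not_in[OF this] show "AE t in lborel. integral_curve V (f p) t \<notin> S" by simp
  qed
  then have "emeasure \<mu> S = 0" using inv Sb by (auto simp: invariant_measure_def)
  then show False using S(2) by simp
qed

section \<open>Functions of class C2\<close>

text \<open>The derivative is taken at \<open>x\<close> and not within \<open>U\<close>, so the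
  property passes to arbitrary subsets. As its values are bounded linear maps, the second order
  class repeats the first order one for the derivative.\<close>

definition C1_on :: "'a::real_normed_vector set \<Rightarrow> ('a \<Rightarrow> 'b::real_normed_vector) \<Rightarrow> bool" where
  "C1_on U f \<longleftrightarrow> (\<exists>f'. (\<forall>x\<in>U. (f has_derivative blinfun_apply (f' x)) (at x)) \<and> continuous_on U f')"

definition C2_on :: "'a::real_normed_vector set \<Rightarrow> ('a \<Rightarrow> 'b::real_normed_vector) \<Rightarrow> bool" where
  "C2_on U f \<longleftrightarrow> (\<exists>f'. (\<forall>x\<in>U. (f has_derivative blinfun_apply (f' x)) (at x)) \<and> C1_on U f')"

lemma C1_onI:
  "(\<And>x. x \<in> U \<Longrightarrow> (f has_derivative blinfun_apply (f' x)) (at x)) \<Longrightarrow> continuous_on U f' \<Longrightarrow> C1_on U f"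
  by (auto simp: C1_on_def)

lemma C2_onI:
  "(\<And>x. x \<in> U \<Longrightarrow> (f has_derivative blinfun_apply (f' x)) (at x)) \<Longrightarrow> C1_on U f' \<Longrightarrow> C2_on U f"
  by (auto simp: C2_on_def)

lemma C1_on_imp_continuous_on: "C1_on U f \<Longrightarrow> continuous_on U f"
  unfolding C1_on_def
  by (meson continuous_at_imp_continuous_on has_derivative_continuous)

lemma C2_on_imp_C1_on: "C2_on U f \<Longrightarrow> C1_on U f"
  unfolding C2_on_def using C1_on_imp_continuous_on C1_onI by metis

lemma C1_on_subset: "C1_on U f \<Longrightarrow> S \<subseteq> U \<Longrightarrow> C1_on S f"
  unfolding C1_on_def by (meson continuous_on_subset subsetD)

lemma C2_on_subset: "C2_on U f \<Longrightarrow> S \<subseteq> U \<Longrightarrow> C2_on S f"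
  unfolding C2_on_def by (meson C1_on_subset subsetD)

lemma C1_on_linear:
  assumes "bounded_linear f"
  shows "C1_on U f"
  by (rule C1_onI[where f' = "\<lambda>x. Blinfun f"])
     (auto simp: bounded_linear_Blinfun_apply[OF assms] bounded_linear_imp_has_derivative[OF assms])

lemma C1_on_const: "C1_on U (\<lambda>x. c)"
  by (rule C1_onI[where f' = "\<lambda>x. 0"]) (auto simp: zero_blinfun.rep_eq)

lemma C2_on_const: "C2_on U (\<lambda>x. c)"
  by (rule C2_onI[where f' = "\<lambda>x. 0"]) (auto simp: zero_blinfun.rep_eq intro: C1_on_const)

lemma C2_on_linear:
  assumes "bounded_linear f"
  shows "C2_on U f"
  by (rule C2_onI[where f' = "\<lambda>x. Blinfun f"])
     (auto simp: bounded_linear_Blinfun_apply[OF assms] bounded_linear_imp_has_derivative[OF assms] C1_on_const)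

lemma C1_on_compose:
  assumes f: "C1_on U f" and g: "C1_on W g" and sub: "f ` U \<subseteq> W"
  shows "C1_on U (\<lambda>x. g (f x))"
proof -
  obtain f' where f': "\<And>x. x \<in> U \<Longrightarrow> (f has_derivative blinfun_apply (f' x)) (at x)" "continuous_on U f'"
    using f by (auto simp: C1_on_def)
  obtain g' where g': "\<And>x. x \<in> W \<Longrightarrow> (g has_derivative blinfun_apply (g' x)) (at x)" "continuous_on W g'"
    using g by (auto simp: C1_on_def)
  show ?thesis
  proof (rule C1_onI)
    fix x assume "x \<in> U"
    then show "((\<lambda>x. g (f x)) has_derivative blinfun_apply (g' (f x) o\<^sub>L f' x)) (at x)"
      using has_derivative_compose[OF f'(1) g'(1)] sub by (auto simp: blinfun_apply_blinfun_compose[abs_def] o_def)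
  next
    have "continuous_on U (\<lambda>x. g' (f x))"
      by (rule continuous_on_compose2[OF g'(2) C1_on_imp_continuous_on[OF f] sub])
    then show "continuous_on U (\<lambda>x. g' (f x) o\<^sub>L f' x)"
      using f'(2) by (intro continuous_intros)
  qed
qed

text \<open>One product rule serves multiplication, scaling, the inner product and the composition
  of linear maps.\<close>

lemma C1_on_bilinear:
  assumes "bounded_bilinear mul" and f: "C1_on U f" and g: "C1_on U g"
  shows "C1_on U (\<lambda>x. mul (f x) (g x))"
proof -
  interpret bounded_bilinear mul by fact
  obtain f' where f': "\<And>x. x \<in> U \<Longrightarrow> (f has_derivative blinfun_apply (f' x)) (at x)" "continuous_on U f'"
    using f by (auto simp: C1_on_def)
  obtain g' where g': "\<And>x. x \<in> U \<Longrightarrow> (g has_derivative blinfun_apply (g' x)) (at x)" "continuous_on U g'"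
    using g by (auto simp: C1_on_def)
  let ?D = "\<lambda>x. (prod_right (f x) o\<^sub>L g' x) + (prod_left (g x) o\<^sub>L f' x)"
  show ?thesis
  proof (rule C1_onI)
    fix x assume x: "x \<in> U"
    have "blinfun_apply (?D x) = (\<lambda>h. mul (f x) (g' x h) + mul (f' x h) (g x))"
      by (auto simp: blinfun.add_left prod_right.rep_eq prod_left.rep_eq)
    then show "((\<lambda>x. mul (f x) (g x)) has_derivative blinfun_apply (?D x)) (at x)"
      using FDERIV[OF f'(1)[OF x] g'(1)[OF x]] by simp
  next
    show "continuous_on U ?D"
      using f'(2) g'(2) C1_on_imp_continuous_on[OF f] C1_on_imp_continuous_on[OF g]
      by (intro continuous_intros bounded_linear.continuous_on[OF bounded_linear_prod_right]
          bounded_linear.continuous_on[OF bounded_linear_prod_left])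
  qed
qed

lemma C1_on_add:
  assumes f: "C1_on U f" and g: "C1_on U g"
  shows "C1_on U (\<lambda>x. f x + g x)"
proof -
  obtain f' where f': "\<And>x. x \<in> U \<Longrightarrow> (f has_derivative blinfun_apply (f' x)) (at x)" "continuous_on U f'"
    using f by (auto simp: C1_on_def)
  obtain g' where g': "\<And>x. x \<in> U \<Longrightarrow> (g has_derivative blinfun_apply (g' x)) (at x)" "continuous_on U g'"
    using g by (auto simp: C1_on_def)
  show ?thesis
    by (rule C1_onI[where f' = "\<lambda>x. f' x + g' x"])
       (use f' g' in \<open>auto simp: plus_blinfun.rep_eq intro: has_derivative_add continuous_on_add\<close>)
qed

lemma C1_on_linear_compose: "bounded_linear g \<Longrightarrow> C1_on U f \<Longrightarrow> C1_on U (\<lambda>x. g (f x))"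
  by (rule C1_on_compose[where W = UNIV]) (auto intro: C1_on_linear)

lemma C2_on_compose:
  assumes f: "C2_on U f" and g: "C2_on W g" and sub: "f ` U \<subseteq> W"
  shows "C2_on U (\<lambda>x. g (f x))"
proof -
  obtain f' where f': "\<And>x. x \<in> U \<Longrightarrow> (f has_derivative blinfun_apply (f' x)) (at x)" "C1_on U f'"
    using f by (auto simp: C2_on_def)
  obtain g' where g': "\<And>x. x \<in> W \<Longrightarrow> (g has_derivative blinfun_apply (g' x)) (at x)" "C1_on W g'"
    using g by (auto simp: C2_on_def)
  show ?thesis
  proof (rule C2_onI)
    fix x assume "x \<in> U"
    then show "((\<lambda>x. g (f x)) has_derivative blinfun_apply (g' (f x) o\<^sub>L f' x)) (at x)"
      using has_derivative_compose[OF f'(1) g'(1)] sub by (auto simp: blinfun_apply_blinfun_compose[abs_def] o_def)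
  next
    show "C1_on U (\<lambda>x. g' (f x) o\<^sub>L f' x)"
      by (intro C1_on_bilinear[OF bounded_bilinear_blinfun_compose] f'(2)
          C1_on_compose[OF C2_on_imp_C1_on[OF f] g'(2) sub])
  qed
qed

lemma C2_on_bilinear:
  assumes "bounded_bilinear mul" and f: "C2_on U f" and g: "C2_on U g"
  shows "C2_on U (\<lambda>x. mul (f x) (g x))"
proof -
  interpret bounded_bilinear mul by fact
  obtain f' where f': "\<And>x. x \<in> U \<Longrightarrow> (f has_derivative blinfun_apply (f' x)) (at x)" "C1_on U f'"
    using f by (auto simp: C2_on_def)
  obtain g' where g': "\<And>x. x \<in> U \<Longrightarrow> (g has_derivative blinfun_apply (g' x)) (at x)" "C1_on U g'"
    using g by (auto simp: C2_on_def)
  let ?D = "\<lambda>x. (prod_right (f x) o\<^sub>L g' x) + (prod_left (g x) o\<^sub>L f' x)"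
  show ?thesis
  proof (rule C2_onI)
    fix x assume x: "x \<in> U"
    have "blinfun_apply (?D x) = (\<lambda>h. mul (f x) (g' x h) + mul (f' x h) (g x))"
      by (auto simp: blinfun.add_left prod_right.rep_eq prod_left.rep_eq)
    then show "((\<lambda>x. mul (f x) (g x)) has_derivative blinfun_apply (?D x)) (at x)"
      using FDERIV[OF f'(1)[OF x] g'(1)[OF x]] by simp
  next
    show "C1_on U ?D"
      by (intro C1_on_add C1_on_bilinear[OF bounded_bilinear_blinfun_compose] f'(2) g'(2)
          C1_on_linear_compose[OF bounded_linear_prod_right] C1_on_linear_compose[OF bounded_linear_prod_left]
          C2_on_imp_C1_on f g)
  qed
qed

lemma C2_on_linear_compose: "bounded_linear g \<Longrightarrow> C2_on U f \<Longrightarrow> C2_on U (\<lambda>x. g (f x))"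
  by (rule C2_on_compose[where W = UNIV]) (auto intro: C2_on_linear)

lemma C2_on_add:
  assumes f: "C2_on U f" and g: "C2_on U g"
  shows "C2_on U (\<lambda>x. f x + g x)"
proof -
  obtain f' where f': "\<And>x. x \<in> U \<Longrightarrow> (f has_derivative blinfun_apply (f' x)) (at x)" "C1_on U f'"
    using f by (auto simp: C2_on_def)
  obtain g' where g': "\<And>x. x \<in> U \<Longrightarrow> (g has_derivative blinfun_apply (g' x)) (at x)" "C1_on U g'"
    using g by (auto simp: C2_on_def)
  show ?thesis
    by (rule C2_onI[where f' = "\<lambda>x. f' x + g' x"])
       (use f' g' in \<open>auto simp: plus_blinfun.rep_eq intro: has_derivative_add C1_on_add\<close>)
qed

lemma C2_on_diff:
  assumes "C2_on U f" "C2_on U g"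
  shows "C2_on U (\<lambda>x. f x - g x)"
  using C2_on_add[OF assms(1) C2_on_linear_compose[OF bounded_linear_minus[OF bounded_linear_ident] assms(2)]]
  by simp

lemma C2_on_sum: "(\<And>i. i \<in> I \<Longrightarrow> C2_on U (f i)) \<Longrightarrow> C2_on U (\<lambda>x. \<Sum>i\<in>I. f i x)"
  by (induction I rule: infinite_finite_induct) (auto intro: C2_on_const C2_on_add)

section \<open>Concrete C2 functions for bumps and normalisation\<close>

lemma C1_on_real:
  assumes "\<And>t. t \<in> S \<Longrightarrow> (g has_real_derivative g' t) (at t)" "continuous_on S g'"
  shows "C1_on S g"
proof (rule C1_onI[where f' = "\<lambda>t. g' t *\<^sub>R id_blinfun"])
  show "(g has_derivative blinfun_apply (g' t *\<^sub>R id_blinfun)) (at t)" if "t \<in> S" for t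
    using assms(1)[OF that] by (simp add: has_field_derivative_def scaleR_blinfun.rep_eq mult_commute_abs)
  show "continuous_on S (\<lambda>t. g' t *\<^sub>R (id_blinfun :: real \<Rightarrow>\<^sub>L real))"
    using assms(2) by (intro continuous_intros)
qed

lemma C2_on_real:
  assumes "\<And>t. t \<in> S \<Longrightarrow> (g has_real_derivative g' t) (at t)"
    and "\<And>t. t \<in> S \<Longrightarrow> (g' has_real_derivative g'' t) (at t)" "continuous_on S g''"
  shows "C2_on S g"
proof (rule C2_onI[where f' = "\<lambda>t. g' t *\<^sub>R id_blinfun"])
  show "(g has_derivative blinfun_apply (g' t *\<^sub>R id_blinfun)) (at t)" if "t \<in> S" for t
    using assms(1)[OF that] by (simp add: has_field_derivative_def scaleR_blinfun.rep_eq mult_commute_abs)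
  show "C1_on S (\<lambda>t. g' t *\<^sub>R (id_blinfun :: real \<Rightarrow>\<^sub>L real))"
    by (rule C1_on_linear_compose[OF bounded_linear_scaleR_left C1_on_real[OF assms(2,3)]])
qed

lemma C2_on_inverse: "C2_on {0<..} (inverse :: real \<Rightarrow> real)"
proof (rule C2_on_real)
  show "continuous_on {0<..} (\<lambda>t::real. 2 * inverse (t ^ 3))" by (intro continuous_intros) auto
qed (auto intro!: derivative_eq_intros simp: power3_eq_cube power2_eq_square)

lemma C2_on_cos: "C2_on UNIV (cos :: real \<Rightarrow> real)"
  by (rule C2_on_real[where g'' = "\<lambda>t. - cos t"]) (auto intro!: derivative_eq_intros continuous_intros)

text \<open>The profile of the bumps; the cube is the lowest natural power of the positive part that
  is of class C2.\<close>

lemma C2_on_pos_cube: "C2_on UNIV (\<lambda>t::real. (max 0 t) ^ 3)"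
proof (rule C2_on_real)
  have d: "((\<lambda>t::real. (max 0 t) ^ Suc n) has_real_derivative real (Suc n) * (max 0 t) ^ n) (at t)"
    if "0 < n" for n t
  proof -
    consider "t < 0" | "t = 0" | "0 < t" by linarith
    then show ?thesis
    proof cases
      case 1
      have "((\<lambda>t::real. 0) has_real_derivative 0) (at t)" by simp
      then show ?thesis
        using 1 that by (subst has_field_derivative_cong_eventually[where g = "\<lambda>_. 0"])
          (auto intro!: eventually_at_in_open[of "{..<0}", THEN eventually_mono] simp: max_def zero_power)
    next
      case 2
      have "((\<lambda>h::real. max 0 h ^ n * (max 0 h / h)) \<longlongrightarrow> 0) (at 0)"
      proof (rule Lim_null_comparison[OF always_eventually])
        show "\<forall>h. norm (max 0 h ^ n * (max 0 h / h)) \<le> max 0 (h :: real) ^ n"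
          by (auto simp: max_def)
        have "((\<lambda>h::real. max 0 h ^ n) \<longlongrightarrow> (max 0 0) ^ n) (at 0)" by (intro tendsto_intros)
        then show "((\<lambda>h::real. max 0 h ^ n) \<longlongrightarrow> 0) (at 0)" using that by (simp add: zero_power)
      qed
      then show ?thesis
        using 2 that by (simp add: DERIV_def zero_power mult.commute)
    next
      case 3
      have "((\<lambda>t::real. t ^ Suc n) has_real_derivative real (Suc n) * t ^ n) (at t)"
        using DERIV_pow[of "Suc n" t UNIV] by simp
      then show ?thesis
        using 3 by (subst has_field_derivative_cong_eventually[where g = "\<lambda>t. t ^ Suc n"])
          (auto intro!: eventually_at_in_open[of "{0<..}", THEN eventually_mono] simp: max_def)
    qed
  qed
  show "((\<lambda>t::real. (max 0 t) ^ 3) has_real_derivative 3 * (max 0 t)\<^sup>2) (at t)" for t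
    using d[of 2 t] by (simp add: numeral_eq_Suc)
  show "((\<lambda>t::real. 3 * (max 0 t)\<^sup>2) has_real_derivative 3 * (2 * max 0 t)) (at t)" for t
    using DERIV_cmult[OF d[of 1 t], of 3] by (simp add: numeral_eq_Suc)
  show "continuous_on UNIV (\<lambda>t::real. 3 * (2 * max 0 t))" by (intro continuous_intros)
qed

text \<open>A bootstrap: the derivative of the norm is the inner product with \<open>sgn\<close>,
  and \<open>sgn\<close> is the identity divided by the norm. Continuity of \<open>sgn\<close> makes
  the norm C1, hence \<open>sgn\<close> C1, hence the norm C2, hence \<open>sgn\<close> C2.\<close>

lemma C2_on_sgn: "C2_on (- {0}) (sgn :: 'a::real_inner \<Rightarrow> 'a)"
proof -
  let ?U = "- {0} :: 'a set"
  have norm_deriv: "(norm has_derivative blinfun_apply (blinfun_inner_left (sgn x))) (at x)" if "x \<in> ?U" for x :: 'a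
    using has_derivative_norm[of x] that by (simp add: blinfun_inner_left.rep_eq[abs_def] inner_commute)
  have "continuous_on ?U (sgn :: 'a \<Rightarrow> 'a)" by (intro continuous_on_sgn continuous_intros) auto
  then have "C1_on ?U (norm :: 'a \<Rightarrow> real)"
    by (intro C1_onI[where f' = "\<lambda>x. blinfun_inner_left (sgn x)"] norm_deriv
        bounded_linear.continuous_on[OF bounded_linear_blinfun_inner_left])
  have sgn_eq: "(sgn :: 'a \<Rightarrow> 'a) = (\<lambda>x. inverse (norm x) *\<^sub>R x)" by (auto simp: sgn_div_norm)
  have "C1_on ?U (\<lambda>x. inverse (norm x) *\<^sub>R x)"
    by (intro C1_on_bilinear[OF bounded_bilinear_scaleR] C1_on_linear bounded_linear_ident
        C1_on_compose[OF \<open>C1_on ?U norm\<close> C2_on_imp_C1_on[OF C2_on_inverse]]) auto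
  then have "C1_on ?U (sgn :: 'a \<Rightarrow> 'a)" by (simp add: sgn_eq)
  then have "C2_on ?U (norm :: 'a \<Rightarrow> real)"
    by (intro C2_onI[where f' = "\<lambda>x. blinfun_inner_left (sgn x)"] norm_deriv
        C1_on_linear_compose[OF bounded_linear_blinfun_inner_left])
  then have "C2_on ?U (\<lambda>x. inverse (norm x) *\<^sub>R x)"
    by (intro C2_on_bilinear[OF bounded_bilinear_scaleR] C2_on_linear bounded_linear_ident
        C2_on_compose[OF \<open>C2_on ?U norm\<close> C2_on_inverse]) auto
  then show ?thesis by (simp add: sgn_eq)
qed

section \<open>Families of C2 fields on the torus\<close>

lemma torus_deriv_unique:
  assumes "\<And>x. ((\<lambda>y. g (abs_torus y)) has_derivative blinfun_apply (G x)) (at x)"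
  shows "torus_differentiable g" "torus_deriv g (abs_torus x) = G x"
proof -
  show diff: "torus_differentiable g"
    unfolding torus_differentiable_def differentiable_def using assms by blast
  show "torus_deriv g (abs_torus x) = G x"
    by (rule blinfun_eqI)
       (metis assms frechet_derivative_at torus_deriv_has_derivative[OF diff])
qed

lemma C2_unit_fields_lift:
  assumes "V \<in> C2_unit_fields"
  shows "C2_on UNIV (\<lambda>x. V (abs_torus x))"
proof -
  have V: "torus_differentiable V" "torus_differentiable (torus_deriv V)"
    "continuous_on UNIV (torus_deriv (torus_deriv V))"
    using assms by (auto simp: C2_unit_fields_def C2_torus_def)
  have "continuous_on UNIV (\<lambda>x. torus_deriv (torus_deriv V) (abs_torus x))"
    by (intro continuous_on_compose2[OF V(3) continuous_on_abs_torus]) simp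
  then have "C1_on UNIV (\<lambda>x. torus_deriv V (abs_torus x))"
    by (intro C1_onI[OF torus_deriv_has_derivative[OF V(2)]])
  then show ?thesis by (intro C2_onI[OF torus_deriv_has_derivative[OF V(1)]])
qed

lemma has_derivative_partial:
  assumes "(F has_derivative D) (at (s, x))"
  shows "((\<lambda>y. F (s, y)) has_derivative (\<lambda>h. D (0, h))) (at x)"
proof -
  have "((\<lambda>y. (s, y)) has_derivative (\<lambda>h. (0, h))) (at x)"
    by (auto intro!: derivative_eq_intros)
  from has_derivative_compose[OF this assms] show ?thesis by simp
qed

lemma compact_slices_uniformly_close:
  fixes H :: "'a::euclidean_space \<times> 'b::metric_space \<Rightarrow> 'c::metric_space"
  assumes "continuous_on (T \<times> K) H" "open T" "0 \<in> T" "compact K" "0 < \<eta>"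
  obtains \<delta> where "0 < \<delta>" "\<And>s x. norm s < \<delta> \<Longrightarrow> x \<in> K \<Longrightarrow> s \<in> T \<and> dist (H (0, x)) (H (s, x)) < \<eta>"
proof -
  obtain r where r: "0 < r" "cball 0 r \<subseteq> T"
    using \<open>open T\<close> \<open>0 \<in> T\<close> by (meson open_contains_cball)
  have "uniformly_continuous_on (cball 0 r \<times> K) H"
    using assms r by (intro compact_uniformly_continuous compact_Times)
      (auto intro: continuous_on_subset)
  then obtain d where d: "0 < d" "\<And>p q. p \<in> cball 0 r \<times> K \<Longrightarrow> q \<in> cball 0 r \<times> K \<Longrightarrow> dist q p < d \<Longrightarrow> dist (H q) (H p) < \<eta>"
    using \<open>0 < \<eta>\<close> unfolding uniformly_continuous_on_def by metis
  show ?thesis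
  proof (rule that[of "min r d"])
    fix s :: 'a and x assume s: "norm s < min r d" and x: "x \<in> K"
    then have "dist (H (0, x)) (H (s, x)) < \<eta>"
      using r(1) by (intro d(2)) (auto simp: dist_prod_def)
    moreover have "s \<in> T" using s r(2) by auto
    ultimately show "s \<in> T \<and> dist (H (0, x)) (H (s, x)) < \<eta>" by simp
  qed (use r d in auto)
qed

text \<open>Continuity of the derivatives in the parameter is uniform in \<open>x\<close> by compactness of the torus.\<close>

lemma C2_family_dist:
  fixes W :: "'a::euclidean_space \<Rightarrow> 'n::finite torus \<Rightarrow> real ^ 'n"
  assumes smooth: "C2_on (T \<times> UNIV) (\<lambda>(s, x). W s (abs_torus x))" and T: "open T" "0 \<in> T"
    and unit: "\<And>s p. s \<in> T \<Longrightarrow> norm (W s p) = 1" and "0 < \<eta>"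
  obtains \<delta> where "0 < \<delta>"
    "\<And>s. norm s < \<delta> \<Longrightarrow> W s \<in> C2_unit_fields \<and> C2_dist (W 0) (W s) < \<eta>"
proof -
  let ?F = "\<lambda>(s, x). W s (abs_torus x)"
  \<comment> \<open>The inclusion of the space directions; composing a full derivative with it gives
    the partial derivative in \<open>x\<close>.\<close>
  define J :: "(real ^ 'n) \<Rightarrow>\<^sub>L ('a \<times> (real ^ 'n))" where "J = Blinfun (\<lambda>h. (0, h))"
  have "bounded_linear (\<lambda>h :: real ^ 'n. (0 :: 'a, h))"
    by (intro bounded_linear_Pair bounded_linear_zero bounded_linear_ident)
  then have J: "blinfun_apply J h = (0, h)" for h by (simp add: J_def bounded_linear_Blinfun_apply)
  obtain F' where F': "\<And>z. z \<in> T \<times> UNIV \<Longrightarrow> (?F has_derivative blinfun_apply (F' z)) (at z)" "C1_on (T \<times> UNIV) F'"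
    using smooth by (auto simp: C2_on_def)
  define G1 where "G1 z = F' z o\<^sub>L J" for z
  have "C1_on (T \<times> UNIV) G1"
    unfolding G1_def
    by (rule C1_on_linear_compose[OF bounded_bilinear.bounded_linear_left[OF bounded_bilinear_blinfun_compose] F'(2)])
  then obtain G1' where G1': "\<And>z. z \<in> T \<times> UNIV \<Longrightarrow> (G1 has_derivative blinfun_apply (G1' z)) (at z)"
    "continuous_on (T \<times> UNIV) G1'"
    by (auto simp: C1_on_def)
  define G2 where "G2 z = G1' z o\<^sub>L J" for z
  have der1: "((\<lambda>y. W s (abs_torus y)) has_derivative blinfun_apply (G1 (s, x))) (at x)" if "s \<in> T" for s x
    using has_derivative_partial[OF F'(1), of s x] that by (simp add: G1_def J blinfun_compose.rep_eq o_def)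
  have td1: "torus_differentiable (W s)" "torus_deriv (W s) (abs_torus x) = G1 (s, x)" if "s \<in> T" for s x
    using torus_deriv_unique[of "W s" "\<lambda>x. G1 (s, x)"] der1 that by blast+
  have der2: "((\<lambda>y. torus_deriv (W s) (abs_torus y)) has_derivative blinfun_apply (G2 (s, x))) (at x)" if "s \<in> T" for s x
    using has_derivative_partial[OF G1'(1), of s x] that by (simp add: td1 G2_def J blinfun_compose.rep_eq o_def)
  have td2: "torus_differentiable (torus_deriv (W s))" "torus_deriv (torus_deriv (W s)) (abs_torus x) = G2 (s, x)"
    if "s \<in> T" for s x
    using torus_deriv_unique[of "torus_deriv (W s)" "\<lambda>x. G2 (s, x)"] der2 that by blast+
  have cont0: "continuous_on (T \<times> UNIV) ?F"
    by (rule C1_on_imp_continuous_on[OF C2_on_imp_C1_on[OF smooth]])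
  have cont1: "continuous_on (T \<times> UNIV) G1"
    by (rule C1_on_imp_continuous_on) fact
  have cont2: "continuous_on (T \<times> UNIV) G2"
    unfolding G2_def using G1'(2) by (intro continuous_intros)
  have field: "W s \<in> C2_unit_fields" if "s \<in> T" for s
  proof -
    have "continuous_on UNIV (\<lambda>x. G2 (s, x))"
      using that by (intro continuous_on_compose2[OF cont2] continuous_intros) auto
    then have "continuous_on UNIV (torus_deriv (torus_deriv (W s)))"
      using that by (intro continuous_on_torusI) (simp add: td2)
    then show ?thesis using td1(1) td2(1) unit that by (simp add: C2_unit_fields_def C2_torus_def)
  qed
  let ?K = "cbox 0 (\<chi> i. 1) :: (real ^ 'n) set"
  have sub: "T \<times> ?K \<subseteq> T \<times> UNIV" by auto
  \<comment> \<open>Three suprema enter the distance, each at most a quarter of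
    \<open>\<eta>\<close>; the remaining quarter keeps the final inequality strict.\<close>
  have "0 < \<eta> / 4" using \<open>0 < \<eta>\<close> by simp
  note close = compact_slices_uniformly_close[OF continuous_on_subset[OF _ sub] T compact_cbox this]
  obtain \<delta>0 where \<delta>0: "0 < \<delta>0" "\<And>s x. norm s < \<delta>0 \<Longrightarrow> x \<in> ?K \<Longrightarrow> s \<in> T \<and> dist (?F (0, x)) (?F (s, x)) < \<eta> / 4"
    using close[OF cont0] by blast
  obtain \<delta>1 where \<delta>1: "0 < \<delta>1" "\<And>s x. norm s < \<delta>1 \<Longrightarrow> x \<in> ?K \<Longrightarrow> s \<in> T \<and> dist (G1 (0, x)) (G1 (s, x)) < \<eta> / 4"
    using close[OF cont1] by blast
  obtain \<delta>2 where \<delta>2: "0 < \<delta>2" "\<And>s x. norm s < \<delta>2 \<Longrightarrow> x \<in> ?K \<Longrightarrow> s \<in> T \<and> dist (G2 (0, x)) (G2 (s, x)) < \<eta> / 4"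
    using close[OF cont2] by blast
  show ?thesis
  proof (rule that[of "min \<delta>0 (min \<delta>1 \<delta>2)"])
    fix s :: 'a assume s: "norm s < min \<delta>0 (min \<delta>1 \<delta>2)"
    have sT: "s \<in> T" using \<delta>0(2)[of s 0] s by (auto simp: mem_box_cart)
    have sup: "(SUP p. norm (g 0 p - g s p)) \<le> \<eta> / 4"
      if "\<And>x. x \<in> ?K \<Longrightarrow> dist (g 0 (abs_torus x)) (g s (abs_torus x)) < \<eta> / 4"
      for g :: "'a \<Rightarrow> 'n torus \<Rightarrow> 'c::real_normed_vector"
    proof (rule cSUP_least)
      fix p
      obtain x where "x \<in> ?K" "abs_torus x = p" using abs_torus_unit_cube[of p] by blast
      then show "norm (g 0 p - g s p) \<le> \<eta> / 4" using that[of x] by (simp add: dist_norm)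
    qed simp
    have "(SUP p. norm (W 0 p - W s p)) \<le> \<eta> / 4"
      using \<delta>0(2)[of s] s by (intro sup) auto
    moreover have "(SUP p. norm (torus_deriv (W 0) p - torus_deriv (W s) p)) \<le> \<eta> / 4"
      using \<delta>1(2)[of s] s T(2) sT by (intro sup[of "\<lambda>s. torus_deriv (W s)"]) (auto simp: td1)
    moreover have "(SUP p. norm (torus_deriv (torus_deriv (W 0)) p - torus_deriv (torus_deriv (W s)) p)) \<le> \<eta> / 4"
      using \<delta>2(2)[of s] s T(2) sT by (intro sup[of "\<lambda>s. torus_deriv (torus_deriv (W s))"]) (auto simp: td2)
    ultimately have "C2_dist (W 0) (W s) \<le> \<eta> / 4 + \<eta> / 4 + \<eta> / 4"
      using field[OF T(2)] field[OF sT] by (simp add: C2_dist_def)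
    then show "W s \<in> C2_unit_fields \<and> C2_dist (W 0) (W s) < \<eta>"
      using field[OF sT] \<open>0 < \<eta>\<close> by auto
  qed (use \<delta>0 \<delta>1 \<delta>2 in auto)
qed

text \<open>Adding bumps destroys the unit length and \<open>sgn\<close> restores it. It only
  rescales each vector positively, so the vanishing of linear functionals can still be tested on the
  unnormalised sum.\<close>

lemma C2_perturbation:
  fixes V :: "'n::finite torus \<Rightarrow> real ^ 'n" and \<beta> :: "'m::finite \<Rightarrow> 'n torus \<Rightarrow> real"
    and u :: "'m \<Rightarrow> real ^ 'n"
  defines "W s p \<equiv> sgn (V p + (\<Sum>l\<in>UNIV. (s $ l * \<beta> l p) *\<^sub>R u l))"
  assumes V: "V \<in> C2_unit_fields" and \<beta>: "\<And>l. C2_on UNIV (\<lambda>x. \<beta> l (abs_torus x))" and "0 < \<eta>"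
  obtains \<delta> where "0 < \<delta>" "\<And>s. norm s < \<delta> \<Longrightarrow> W s \<in> C2_unit_fields \<and> C2_dist V (W s) < \<eta> \<and>
    (\<forall>p. V p + (\<Sum>l\<in>UNIV. (s $ l * \<beta> l p) *\<^sub>R u l) \<noteq> 0)"
proof -
  define Z where "Z s p = V p + (\<Sum>l\<in>UNIV. (s $ l * \<beta> l p) *\<^sub>R u l)" for s p
  have unitV: "norm (V p) = 1" for p using V by (simp add: C2_unit_fields_def)
  have C2Z: "C2_on UNIV (\<lambda>(s, x). Z s (abs_torus x))"
  proof -
    have "C2_on UNIV (\<lambda>z :: (real ^ 'm) \<times> (real ^ 'n). g (snd z))" if "C2_on UNIV g"
      for g :: "real ^ 'n \<Rightarrow> 'c::real_normed_vector"
      by (rule C2_on_compose[OF C2_on_linear[OF bounded_linear_snd] that]) simp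
    note snd = this
    have fst: "C2_on UNIV (\<lambda>z :: (real ^ 'm) \<times> (real ^ 'n). fst z $ l)" for l
      by (intro C2_on_linear bounded_linear_compose[OF bounded_linear_vec_nth bounded_linear_fst])
    have "C2_on UNIV (\<lambda>z. V (abs_torus (snd z)) +
        (\<Sum>l\<in>UNIV. (fst z $ l * \<beta> l (abs_torus (snd z))) *\<^sub>R u l))"
      by (intro C2_on_add C2_on_sum C2_on_linear_compose[OF bounded_linear_scaleR_left]
          C2_on_bilinear[OF bounded_bilinear_mult] fst snd[OF \<beta>] snd[OF C2_unit_fields_lift[OF V]])
    then show ?thesis by (simp add: Z_def case_prod_beta')
  qed
  let ?K = "cbox 0 (\<chi> i. 1) :: (real ^ 'n) set"
  have "continuous_on (UNIV \<times> ?K) (\<lambda>(s, x). Z s (abs_torus x))"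
    by (rule continuous_on_subset[OF C1_on_imp_continuous_on[OF C2_on_imp_C1_on[OF C2Z]]]) simp
  from compact_slices_uniformly_close[OF this open_UNIV UNIV_I compact_cbox zero_less_one]
  obtain r where r: "0 < r" "\<And>s x. norm s < r \<Longrightarrow> x \<in> ?K \<Longrightarrow> dist (Z 0 (abs_torus x)) (Z s (abs_torus x)) < 1"
    by auto
  \<comment> \<open>\<open>Z 0 p\<close> is the unit vector \<open>V p\<close>, so a point at
    distance less than 1 from it is nonzero.\<close>
  have nz: "Z s p \<noteq> 0" if "s \<in> ball 0 r" for s p
  proof -
    obtain x where "x \<in> ?K" "abs_torus x = p" using abs_torus_unit_cube[of p] by blast
    then have "dist (Z 0 p) (Z s p) < 1" using r(2)[of s x] that by simp
    then show ?thesis using unitV[of p] by (auto simp: Z_def dist_norm add_eq_0_iff)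
  qed
  have "C2_on (ball 0 r \<times> UNIV) (\<lambda>z. sgn (case z of (s, x) \<Rightarrow> Z s (abs_torus x)))"
    using nz by (intro C2_on_compose[OF C2_on_subset[OF C2Z] C2_on_sgn]) auto
  then have smooth: "C2_on (ball 0 r \<times> UNIV) (\<lambda>(s, x). W s (abs_torus x))"
    by (simp add: W_def Z_def case_prod_beta')
  have unit: "norm (W s p) = 1" if "s \<in> ball 0 r" for s p
    using nz[OF that] by (simp add: W_def Z_def norm_sgn)
  have W0: "W 0 = V" using unitV by (auto simp: W_def sgn_div_norm)
  obtain \<delta> where \<delta>: "0 < \<delta>" "\<And>s. norm s < \<delta> \<Longrightarrow> W s \<in> C2_unit_fields \<and> C2_dist (W 0) (W s) < \<eta>"
    using C2_family_dist[OF smooth open_ball _ unit \<open>0 < \<eta>\<close>] r(1) by auto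
  show ?thesis
    by (rule that[of "min r \<delta>"]) (use \<delta> r(1) nz in \<open>auto simp: W0 Z_def\<close>)
qed

section \<open>Generic fields\<close>

text \<open>A smooth periodic substitute for the squared distance to the integer points.\<close>

definition lattice_gap :: "real ^ 'n::finite \<Rightarrow> real" where
  "lattice_gap x = (\<Sum>i\<in>UNIV. 1 - cos (2 * pi * x $ i))"

lemma lattice_gap_nonneg: "0 \<le> lattice_gap x"
  by (auto simp: lattice_gap_def intro: sum_nonneg)

lemma lattice_gap_eq_0_iff: "lattice_gap x = 0 \<longleftrightarrow> x \<in> integer_points"
proof -
  have cos1: "cos (2 * pi * t) = 1 \<longleftrightarrow> t \<in> \<int>" for t
  proof -
    have "2 * pi * t = of_int n * 2 * pi \<longleftrightarrow> t = of_int n" for n by auto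
    then show ?thesis by (auto simp: cos_one_2pi_int Ints_def)
  qed
  have "lattice_gap x = 0 \<longleftrightarrow> (\<forall>i. cos (2 * pi * x $ i) = 1)"
    unfolding lattice_gap_def by (subst sum_nonneg_eq_0_iff) auto
  then show ?thesis by (simp add: cos1 integer_points_def)
qed

lemma lattice_gap_periodic:
  assumes "z \<in> integer_points"
  shows "lattice_gap (x + z) = lattice_gap x"
proof -
  have "cos (2 * pi * (x $ i + z $ i)) = cos (2 * pi * x $ i)" for i
  proof -
    obtain n where "z $ i = of_int n" using assms by (auto simp: integer_points_def elim: Ints_cases)
    then show ?thesis
      using cos_int_2pin[of n] sin_int_2pin[of n] by (simp add: distrib_left cos_add)
  qed
  then show ?thesis by (simp add: lattice_gap_def)
qed

lemma C2_on_lattice_gap: "C2_on UNIV (\<lambda>x. lattice_gap (x - c))"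
proof -
  have aff: "C2_on UNIV (\<lambda>x :: real ^ 'a. x $ i - c $ i)" for i
    by (intro C2_on_diff C2_on_const C2_on_linear bounded_linear_vec_nth)
  have "C2_on UNIV (\<lambda>x :: real ^ 'a. cos (2 * pi * (x $ i - c $ i)))" for i
    by (rule C2_on_compose[OF C2_on_linear_compose[OF bounded_linear_mult_right aff] C2_on_cos]) simp
  then show ?thesis
    unfolding lattice_gap_def vector_minus_component by (intro C2_on_sum C2_on_diff C2_on_const)
qed

lemma continuous_on_lattice_gap: "continuous_on S lattice_gap"
  unfolding lattice_gap_def by (intro continuous_intros)

text \<open>Periodicity of the gap makes the chosen representative irrelevant. The bump is positive
  exactly where the gap from \<open>c\<close> is below \<open>r\<close>.\<close>

definition torus_bump :: "real ^ 'n::finite \<Rightarrow> real \<Rightarrow> 'n torus \<Rightarrow> real" where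
  "torus_bump c r p = (max 0 (r - lattice_gap (rep_torus p - c))) ^ 3"

lemma torus_bump_abs: "torus_bump c r (abs_torus x) = (max 0 (r - lattice_gap (x - c))) ^ 3"
proof -
  have "rep_torus (abs_torus x) - x \<in> integer_points" by (simp flip: abs_torus_eq_integer)
  from lattice_gap_periodic[OF this, of "x - c"] show ?thesis by (simp add: torus_bump_def)
qed

lemma C2_on_torus_bump: "C2_on UNIV (\<lambda>x. torus_bump c r (abs_torus x))"
  unfolding torus_bump_abs
  by (rule C2_on_compose[OF C2_on_diff[OF C2_on_const C2_on_lattice_gap] C2_on_pos_cube]) simp

lemma norm_diff_le_C2_dist:
  assumes "V \<in> C2_unit_fields" "W \<in> C2_unit_fields"
  shows "norm (V p - W p) \<le> C2_dist V W"
proof -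
  have "norm (V p - W p) \<le> (SUP p. norm (V p - W p))"
    using assms by (intro cSUP_upper bdd_above_norm_diff C2_unit_fields_bounded) auto
  also have "\<dots> \<le> C2_dist V W"
    using assms by (auto simp: C2_dist_def add.assoc intro!: add_increasing2 add_nonneg_nonneg SUP_norm_diff_nonneg C2_unit_fields_bounded)
  finally show ?thesis .
qed

text \<open>
  The orbit directions \<open>C l (V (g l y))\<close> are to span for all \<open>y\<close> in a ball. Dual vectors \<open>\<xi>\<close> are
  normalised by \<open>\<xi> $ a = 1\<close>, and bounding them makes the condition open.
\<close>

definition spanning_fields ::
    "('m \<Rightarrow> real ^ 'n \<Rightarrow> real ^ 'n) \<Rightarrow> ('m \<Rightarrow> real ^ 'n \<Rightarrow> real ^ 'n) \<Rightarrow> (real ^ 'n) set \<Rightarrow> 'n \<Rightarrow> real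
      \<Rightarrow> ('n::finite torus \<Rightarrow> real ^ 'n) set" where
  "spanning_fields C g K a R = {V \<in> C2_unit_fields. \<forall>y\<in>K. \<forall>\<xi>. \<xi> $ a = 1 \<and> norm \<xi> \<le> R \<longrightarrow>
     (\<exists>l. \<xi> \<bullet> C l (V (abs_torus (g l y))) \<noteq> 0)}"

text \<open>The sum \<open>h\<close> of the absolute pairings is continuous and positive on a
  compact set, so it has a positive lower bound \<open>m\<close>. Uniformly close fields change it
  by less than \<open>m\<close>.\<close>

lemma openin_spanning_fields:
  fixes C g :: "'m::finite \<Rightarrow> real ^ 'n::finite \<Rightarrow> real ^ 'n"
  assumes C: "\<And>l. linear (C l)" and g: "\<And>l. linear (g l)" and K: "compact K" and "0 \<le> R"
  shows "openin C2_unit_fields_topology (spanning_fields C g K a R)"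
  unfolding C2_unit_fields_topology_def C2_metric.openin_mtopology
proof (intro conjI allI impI)
  show "spanning_fields C g K a R \<subseteq> C2_unit_fields" by (auto simp: spanning_fields_def)
  fix V assume V: "V \<in> spanning_fields C g K a R"
  then have VC2: "V \<in> C2_unit_fields" by (simp add: spanning_fields_def)
  let ?X = "{\<xi> :: real ^ 'n. \<xi> $ a = 1} \<inter> cball 0 R"
  define h where "h z = (\<Sum>l\<in>UNIV. \<bar>snd z \<bullet> C l (V (abs_torus (g l (fst z))))\<bar>)" for z
  have contV: "continuous_on UNIV (\<lambda>x. V (abs_torus x))"
    by (rule C1_on_imp_continuous_on[OF C2_on_imp_C1_on[OF C2_unit_fields_lift[OF VC2]]])
  have "continuous_on (K \<times> ?X) h"
    unfolding h_def
    by (intro continuous_intros linear_continuous_on_compose[OF _ C]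
        continuous_on_compose2[OF contV] linear_continuous_on_compose[OF _ g]) auto
  have cpt: "compact (K \<times> ?X)"
    by (intro compact_Times K closed_Int_compact compact_cball closed_Collect_eq continuous_intros)
  have pos: "0 < h z" if z: "z \<in> K \<times> ?X" for z
  proof -
    obtain l where "snd z \<bullet> C l (V (abs_torus (g l (fst z)))) \<noteq> 0"
      using V z by (fastforce simp: spanning_fields_def)
    then show ?thesis unfolding h_def by (intro sum_pos2[of UNIV l]) auto
  qed
  obtain m where m: "0 < m" "\<And>z. z \<in> K \<times> ?X \<Longrightarrow> m \<le> h z"
  proof (cases "K \<times> ?X = {}")
    case False
    then show ?thesis
      using continuous_attains_inf[OF cpt False \<open>continuous_on (K \<times> ?X) h\<close>] pos that by blast
  qed (use that[of 1] in auto)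
  have "\<exists>B. \<forall>x. norm (C l x) \<le> B * norm x" for l
    using linear_bounded[OF C[of l]] by blast
  then obtain B where B: "\<And>l x. norm (C l x) \<le> B l * norm x" by metis
  have B0: "0 \<le> B l" for l using order_trans[OF norm_ge_zero B[of l "axis a 1"]] by simp
  \<comment> \<open>Chosen so that the total change \<open>R * (\<Sum>l\<in>UNIV. B l) * r\<close>
    stays below \<open>m\<close>; the summand 1 keeps the denominator positive.\<close>
  define r where "r = m / (R * (\<Sum>l\<in>UNIV. B l) + 1)"
  have den: "0 < R * (\<Sum>l\<in>UNIV. B l) + 1" using \<open>0 \<le> R\<close> B0 by (simp add: add_nonneg_pos sum_nonneg)
  have r: "0 < r" "R * (\<Sum>l\<in>UNIV. B l) * r < m"
  proof -
    show "0 < r" using m(1) den by (simp add: r_def)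
    have "(R * (\<Sum>l\<in>UNIV. B l) + 1) * r = m" using den by (simp add: r_def)
    then show "R * (\<Sum>l\<in>UNIV. B l) * r < m" using \<open>0 < r\<close> by (simp add: distrib_right)
  qed
  have "C2_metric.mball V r \<subseteq> spanning_fields C g K a R"
  proof
    fix W assume "W \<in> C2_metric.mball V r"
    then have W: "W \<in> C2_unit_fields" "C2_dist V W < r" by auto
    have "\<exists>l. \<xi> \<bullet> C l (W (abs_torus (g l y))) \<noteq> 0" if "y \<in> K" "\<xi> $ a = 1" "norm \<xi> \<le> R" for y \<xi>
    proof (rule ccontr)
      assume "\<not> ?thesis"
      then have zero: "\<xi> \<bullet> C l (W (abs_torus (g l y))) = 0" for l by auto
      have "m \<le> h (y, \<xi>)" using that by (intro m(2)) auto
      also have "\<dots> \<le> (\<Sum>l\<in>UNIV. R * (B l * r))"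
        unfolding h_def
      proof (rule sum_mono)
        fix l
        let ?p = "abs_torus (g l y)"
        have "\<bar>\<xi> \<bullet> C l (V ?p)\<bar> = \<bar>\<xi> \<bullet> C l (V ?p - W ?p)\<bar>"
          by (simp add: linear_diff[OF C] inner_diff_right zero)
        also have "\<dots> \<le> norm \<xi> * norm (C l (V ?p - W ?p))" by (rule Cauchy_Schwarz_ineq2)
        also have "\<dots> \<le> R * (B l * r)"
        proof (intro mult_mono)
          have "norm (C l (V ?p - W ?p)) \<le> B l * norm (V ?p - W ?p)" by (rule B)
          also have "\<dots> \<le> B l * r"
            using norm_diff_le_C2_dist[OF VC2 W(1), of ?p] W(2) B0 by (intro mult_left_mono) auto
          finally show "norm (C l (V ?p - W ?p)) \<le> B l * r" .
        qed (use that \<open>0 \<le> R\<close> in auto)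
        finally show "\<bar>snd (y, \<xi>) \<bullet> C l (V (abs_torus (g l (fst (y, \<xi>)))))\<bar> \<le> R * (B l * r)" by simp
      qed
      also have "\<dots> = R * (\<Sum>l\<in>UNIV. B l) * r" by (simp add: sum_distrib_left sum_distrib_right mult.assoc)
      finally show False using r(2) by simp
    qed
    then show "W \<in> spanning_fields C g K a R" using W(1) by (auto simp: spanning_fields_def)
  qed
  then show "\<exists>r>0. C2_metric.mball V r \<subseteq> spanning_fields C g K a R" using r(1) by blast
qed

text \<open>
  The perturbation moves \<open>C l (V (g l y))\<close> by a positive multiple of \<open>s $ l\<close> in the direction of the
  basis vector \<open>a\<close>, independently for every \<open>l\<close>. A parameter \<open>s\<close> is bad only if it is a
  differentiable function of \<open>y\<close> and \<open>\<xi>\<close>; there are more parameters than these \<open>2n\<close> variables.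
\<close>

lemma dense_spanning_fields:
  fixes C g :: "'m::finite \<Rightarrow> real ^ 'n::finite \<Rightarrow> real ^ 'n"
  assumes C: "\<And>l. linear (C l)" and g: "\<And>l. linear (g l)" and surj: "\<And>l. surj (C l)"
    and card: "2 * CARD('n) < CARD('m)"
    and inside: "\<And>l y. y \<in> K \<Longrightarrow> lattice_gap (g l y - g l c) < r"
    and outside: "\<And>l l' y. y \<in> K \<Longrightarrow> l \<noteq> l' \<Longrightarrow> r \<le> lattice_gap (g l y - g l' c)"
  shows "C2_unit_fields_topology closure_of (spanning_fields C g K a R) = topspace C2_unit_fields_topology"
proof -
  have "\<exists>W\<in>spanning_fields C g K a R. W \<in> C2_metric.mball V \<eta>" if V: "V \<in> C2_unit_fields" and "0 < \<eta>" for V \<eta>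
  proof -
    \<comment> \<open>With \<open>\<xi> $ a = 1\<close>, the direction \<open>u l\<close> has
      pairing exactly 1 after transport by \<open>C l\<close>, whatever the other coordinates of
      \<open>\<xi>\<close> are.\<close>
    have "\<exists>u. C l u = axis a 1" for l using surj[of l] by (metis surjD)
    then obtain u where u: "\<And>l. C l (u l) = axis a 1" by metis
    define \<beta> where "\<beta> l = torus_bump (g l c) r" for l
    have \<beta>_C2: "C2_on UNIV (\<lambda>x. \<beta> l (abs_torus x))" for l
      unfolding \<beta>_def by (rule C2_on_torus_bump)
    have \<beta>_pos: "0 < \<beta> l (abs_torus (g l y))" if "y \<in> K" for l y
      using inside[OF that, of l] by (simp add: \<beta>_def torus_bump_abs)
    have \<beta>_zero: "\<beta> l' (abs_torus (g l y)) = 0" if "y \<in> K" "l' \<noteq> l" for l l' y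
      using outside[OF that(1), of l l'] that(2) by (simp add: \<beta>_def torus_bump_abs)
    define Z where "Z s p = V p + (\<Sum>l\<in>UNIV. (s $ l * \<beta> l p) *\<^sub>R u l)" for s p
    obtain \<delta> where \<delta>: "0 < \<delta>" "\<And>s. norm s < \<delta> \<Longrightarrow>
        (\<lambda>p. sgn (Z s p)) \<in> C2_unit_fields \<and> C2_dist V (\<lambda>p. sgn (Z s p)) < \<eta> \<and> (\<forall>p. Z s p \<noteq> 0)"
      by (rule C2_perturbation[where \<beta> = \<beta> and u = u, OF V \<beta>_C2 \<open>0 < \<eta>\<close>, folded Z_def])
         (rule that; blast)
    \<comment> \<open>Solves the equation \<open>\<xi> \<bullet> C l (Z s p) = 0\<close> at
      \<open>p = abs_torus (g l y)\<close> for \<open>s $ l\<close>; thus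
      \<open>bad (y, \<xi>)\<close> is the only parameter at which \<open>\<xi>\<close> annihilates
      all directions at \<open>y\<close>.\<close>
    define bad :: "(real ^ 'n) \<times> (real ^ 'n) \<Rightarrow> real ^ 'm" where
      "bad z = (\<chi> l. - (snd z \<bullet> C l (V (abs_torus (g l (fst z))))) * inverse (\<beta> l (abs_torus (g l (fst z)))))" for z
    have "negligible (bad ` (K \<times> UNIV))"
    proof (rule negligible_differentiable_image_lowdim)
      show "DIM((real ^ 'n) \<times> (real ^ 'n)) < DIM(real ^ 'm)" using card by simp
      have bl: "bounded_linear (C l)" "bounded_linear (g l)" for l
        using C g linear_conv_bounded_linear by blast+
      have lift: "C1_on (K \<times> UNIV) (\<lambda>z :: (real ^ 'n) \<times> (real ^ 'n). F (g l (fst z)))" if "C2_on UNIV F"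
        for F :: "real ^ 'n \<Rightarrow> 'c::real_normed_vector" and l
        by (rule C1_on_compose[OF C1_on_linear[OF bounded_linear_compose[OF bl(2) bounded_linear_fst]] C2_on_imp_C1_on[OF that]]) simp
      have "C1_on (K \<times> UNIV) (\<lambda>z. bad z $ l)" for l
      proof -
        have "C1_on (K \<times> UNIV) (\<lambda>z. (- (snd z \<bullet> C l (V (abs_torus (g l (fst z)))))) *
            inverse (\<beta> l (abs_torus (g l (fst z)))))"
        proof (intro C1_on_bilinear[OF bounded_bilinear_mult])
          show "C1_on (K \<times> UNIV) (\<lambda>z. - (snd z \<bullet> C l (V (abs_torus (g l (fst z))))))"
            by (intro C1_on_linear_compose[OF bounded_linear_minus[OF bounded_linear_ident]]
                C1_on_bilinear[OF bounded_bilinear_inner] C1_on_linear bounded_linear_snd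
                C1_on_linear_compose[OF bl(1)] lift[OF C2_unit_fields_lift[OF V]])
          show "C1_on (K \<times> UNIV) (\<lambda>z :: (real ^ 'n) \<times> (real ^ 'n). inverse (\<beta> l (abs_torus (g l (fst z)))))"
            by (rule C1_on_compose[OF lift[OF \<beta>_C2] C2_on_imp_C1_on[OF C2_on_inverse]])
               (use \<beta>_pos in auto)
        qed
        then show ?thesis by (simp add: bad_def)
      qed
      then have "(\<lambda>z. bad z $ l) differentiable (at z within K \<times> UNIV)" if "z \<in> K \<times> UNIV" for l z
        using that unfolding C1_on_def differentiable_def by (meson has_derivative_at_withinI)
      then show "bad differentiable_on K \<times> UNIV"
        unfolding differentiable_on_def
        by (subst differentiable_componentwise_within) (auto simp: Basis_vec_def inner_axis)
    qed
    then have "\<not> ball 0 \<delta> \<subseteq> bad ` (K \<times> UNIV)"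
      using negligible_subset open_not_negligible[OF open_ball, of "0 :: real ^ 'm" \<delta>] \<delta>(1) by auto
    then obtain s where s: "norm s < \<delta>" "s \<notin> bad ` (K \<times> UNIV)"
      by (metis mem_ball_0 subsetI)
    let ?W = "\<lambda>p. sgn (Z s p)"
    have "\<exists>l. \<xi> \<bullet> C l (?W (abs_torus (g l y))) \<noteq> 0" if y: "y \<in> K" and \<xi>: "\<xi> $ a = 1" for y \<xi>
    proof (rule ccontr)
      assume "\<not> ?thesis"
      then have zero: "\<xi> \<bullet> C l (?W (abs_torus (g l y))) = 0" for l by auto
      have "s $ l = bad (y, \<xi>) $ l" for l
      proof -
        let ?p = "abs_torus (g l y)"
        have "Z s ?p \<noteq> 0" using \<delta>(2)[OF s(1)] by blast
        then have "\<xi> \<bullet> C l (Z s ?p) = 0"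
          using zero[of l] by (simp add: sgn_div_norm linear_scale[OF C])
        \<comment> \<open>At this orbit point only the bump of its own step is nonzero, which
          decouples the parameters.\<close>
        moreover have "(\<Sum>l'\<in>UNIV. (s $ l' * \<beta> l' ?p) *\<^sub>R u l') = (s $ l * \<beta> l ?p) *\<^sub>R u l"
          using \<beta>_zero[OF y] by (subst sum.remove[of _ l]) (auto intro!: sum.neutral)
        ultimately have "\<xi> \<bullet> C l (V ?p) + s $ l * \<beta> l ?p = 0"
          using \<xi> by (simp add: Z_def linear_add[OF C] linear_scale[OF C] u inner_add_right inner_axis)
        then show ?thesis using \<beta>_pos[OF y, of l] by (simp add: bad_def field_simps)
      qed
      then have "s = bad (y, \<xi>)" by (simp add: vec_eq_iff)
      then show False using s(2) y by auto
    qed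
    then have "?W \<in> spanning_fields C g K a R"
      using \<delta>(2)[OF s(1)] by (auto simp: spanning_fields_def)
    then show ?thesis using \<delta>(2)[OF s(1)] V by auto
  qed
  then show ?thesis
    unfolding C2_unit_fields_topology_def C2_metric.metric_closure_of by auto
qed

lemma C2_unit_fields_torus_field:
  assumes "V \<in> C2_unit_fields"
  obtains L where "torus_field V L"
proof -
  have V: "torus_differentiable V" using assms by (auto simp: C2_unit_fields_def C2_torus_def)
  obtain B where B: "\<And>p. norm (torus_deriv V p) \<le> B"
    using C2_unit_fields_bounded(2)[OF assms] by (auto simp: bounded_iff)
  have "norm (V (abs_torus x) - V (abs_torus y)) \<le> B * norm (x - y)" for x y
    by (rule differentiable_bound[where S = UNIV and f' = "\<lambda>x. blinfun_apply (torus_deriv V (abs_torus x))"])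
       (use torus_deriv_has_derivative[OF V] B in \<open>auto simp: norm_blinfun.rep_eq\<close>)
  \<comment> \<open>\<open>lipschitz_field\<close> demands a positive constant, and \<open>B\<close>
    may be 0 for a constant field.\<close>
  also have "B * norm (x - y) \<le> max B 1 * norm (x - y)" for x y :: "real ^ 'a"
    by (intro mult_right_mono) auto
  finally show ?thesis
    using assms by (intro that[of "max B 1"] torus_field.intro lipschitz_field.intro) (auto simp: C2_unit_fields_def)
qed

section \<open>Hyperbolic automorphisms\<close>

text \<open>For \<open>j \<noteq> 0\<close> this is a full geometric sum over a root of unity
  different from 1.\<close>

lemma sum_cis_roots:
  assumes "0 < d" "j < d"
  shows "(\<Sum>m<d. cis (2 * pi * real m / real d) ^ j) = (if j = 0 then of_nat d else 0)"
proof (cases "j = 0")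
  case False
  let ?z = "cis (2 * pi * real j / real d)"
  have "cis (2 * pi * real m / real d) ^ j = ?z ^ m" for m
    by (simp add: Complex.DeMoivre algebra_simps)
  then have "(\<Sum>m<d. cis (2 * pi * real m / real d) ^ j) = (\<Sum>m<d. ?z ^ m)" by simp
  also have "\<dots> = 0"
  proof -
    have "?z \<noteq> 1"
    proof
      assume "?z = 1"
      then have "cos (2 * pi * real j / real d) = 1" by (simp add: complex_eq_iff)
      then obtain n :: int where "2 * pi * real j / real d = of_int n * 2 * pi"
        by (auto simp: cos_one_2pi_int)
      then have "real j = of_int n * real d" using assms by (simp add: field_simps)
      then have "int j = n * int d" by (metis of_int_eq_iff of_int_mult of_int_of_nat_eq)
      then have "d dvd j" by (metis dvd_triv_right int_dvd_int_iff)
      then show False using assms False by (auto dest: dvd_imp_le)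
    qed
    moreover have "?z ^ d = 1" using assms by (simp add: Complex.DeMoivre cis_multiple_2pi)
    ultimately show ?thesis by (simp add: geometric_sum)
  qed
  finally show ?thesis using False by simp
qed simp

text \<open>For each root of unity \<open>\<omega>\<close> of order dividing \<open>d\<close>,
  periodicity makes \<open>e \<omega>\<close> an eigenvector with eigenvalue the inverse of
  \<open>\<omega>\<close>, unless it is 0. These vectors sum to \<open>d\<close> times
  \<open>w\<close>, so one of them is nonzero.\<close>

lemma periodic_vector_eigenvalue:
  fixes M :: "complex ^ 'n::finite ^ 'n"
  assumes per: "((*v) M ^^ d) w = w" and "w \<noteq> 0" "0 < d"
  obtains z u where "cmod z = 1" "u \<noteq> 0" "M *v u = z *s u"
proof -
  define e where "e \<omega> = (\<Sum>j<d. \<omega> ^ j *s ((*v) M ^^ j) w)" for \<omega> :: complex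
  let ?\<omega> = "\<lambda>m. cis (2 * pi * real m / real d)"
  have "(\<Sum>m<d. e (?\<omega> m)) = (\<Sum>j<d. (\<Sum>m<d. ?\<omega> m ^ j) *s ((*v) M ^^ j) w)"
    unfolding e_def by (subst sum.swap) (simp add: vec.scale_sum_left)
  also have "\<dots> = (\<Sum>j<d. if j = 0 then of_nat d *s w else 0)"
    using \<open>0 < d\<close> by (intro sum.cong) (auto simp: sum_cis_roots)
  also have "\<dots> = of_nat d *s w" using \<open>0 < d\<close> by (simp add: sum.delta')
  finally have "(\<Sum>m<d. e (?\<omega> m)) \<noteq> 0" using assms by simp
  then obtain m where m: "m < d" "e (?\<omega> m) \<noteq> 0" by (meson lessThan_iff sum.neutral)
  let ?w = "?\<omega> m"
  have root: "?w ^ d = 1" using \<open>0 < d\<close> by (simp add: Complex.DeMoivre cis_multiple_2pi)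
  have shift: "?w *s (M *v e ?w) = e ?w"
  proof -
    let ?a = "\<lambda>j. ?w ^ j *s ((*v) M ^^ j) w"
    have "?w *s (M *v e ?w) = (\<Sum>j<d. ?a (Suc j))"
      unfolding e_def linear_sum[OF matrix_vector_mul_linear]
      by (simp add: vector_scalar_commute vec.scale_sum_right vector_smult_assoc)
    also have "(\<Sum>j<d. ?a (Suc j)) = (\<Sum>j<d. ?a j)"
    proof -
      have "(\<Sum>j<d. ?a j) + ?a d = ?a 0 + (\<Sum>j<d. ?a (Suc j))"
        by (rule trans[OF sum.lessThan_Suc[symmetric] sum.lessThan_Suc_shift])
      moreover have "?a d = ?a 0" unfolding root per by simp
      ultimately show ?thesis by (simp only: add.commute[of _ "?a 0"] add_left_cancel)
    qed
    finally show ?thesis by (simp only: e_def)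
  qed
  show ?thesis
  proof (rule that[of "inverse ?w" "e ?w"])
    show "cmod (inverse ?w) = 1" by (simp add: norm_inverse)
    have "inverse ?w *s (?w *s (M *v e ?w)) = inverse ?w *s e ?w" by (simp only: shift)
    then show "M *v e ?w = inverse ?w *s e ?w" 
      by (simp only: vector_smult_assoc left_inverse[OF cis_neq_zero] vec.scale_one)
  qed (rule m(2))
qed

lemma det_map_matrix_of_int:
  fixes A :: "int ^ 'n::finite ^ 'n"
  shows "det (map_matrix of_int A :: 'a::comm_ring_1 ^ 'n ^ 'n) = of_int (det A)"
  by (simp add: det_def)

text \<open>The vector is complexified because the eigenvalue that it produces need not be
  real.\<close>

lemma hyperbolic_no_periodic_vector:
  fixes A :: "int ^ 'n::finite ^ 'n" and w :: "real ^ 'n"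
  assumes hyp: "\<And>z :: complex. \<exists>u. u \<noteq> 0 \<and> map_matrix of_int A *v u = z *s u \<Longrightarrow> cmod z \<noteq> 1"
    and per: "((*v) (map_matrix of_int A) ^^ d) w = w" and "0 < d"
  shows "w = 0"
proof (rule ccontr)
  assume "w \<noteq> 0"
  define c :: "real ^ 'n \<Rightarrow> complex ^ 'n" where "c x = (\<chi> i. complex_of_real (x $ i))" for x
  have c_step: "c (map_matrix of_int A *v x) = map_matrix of_int A *v c x" for x
    by (simp add: c_def matrix_vector_mult_def vec_eq_iff)
  have "c (((*v) (map_matrix of_int A) ^^ m) x) = ((*v) (map_matrix of_int A) ^^ m) (c x)" for m x
    by (induction m) (auto simp: c_step)
  then have "((*v) (map_matrix of_int A) ^^ d) (c w) = c w" using per by metis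
  moreover have "c w \<noteq> 0" using \<open>w \<noteq> 0\<close> by (auto simp: c_def vec_eq_iff)
  ultimately obtain z u where "cmod z = 1" "u \<noteq> 0" "map_matrix of_int A *v u = z *s u"
    using periodic_vector_eigenvalue \<open>0 < d\<close> by metis
  then show False using hyp by blast
qed

lemma linear_funpow:
  fixes T :: "'a::real_vector \<Rightarrow> 'a"
  assumes "linear T"
  shows "linear (T ^^ i)"
proof (induction i)
  case (Suc i)
  then show ?case using linear_compose[OF Suc assms] by (simp add: o_def)
qed (simp add: linear_ident)

text \<open>Each difference of two iterates is an injective linear map, because a kernel vector
  would yield a periodic one; so it reaches the countable lattice only from countably many
  points.\<close>

lemma countable_resonant_points:
  fixes T :: "real ^ 'n::finite \<Rightarrow> real ^ 'n"
  assumes T: "linear T" "inj T" and no_per: "\<And>d w. 0 < d \<Longrightarrow> (T ^^ d) w = w \<Longrightarrow> w = 0"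
  shows "countable {x. \<exists>i j. i \<noteq> j \<and> (T ^^ i) x - (T ^^ j) x \<in> integer_points}"
proof -
  have "countable {x. (T ^^ i) x - (T ^^ j) x \<in> integer_points}" if "i < j" for i j
  proof -
    let ?D = "\<lambda>x. (T ^^ i) x - (T ^^ j) x"
    have "x = 0" if "?D x = 0" for x
    proof -
      have "(T ^^ (j - i)) ((T ^^ i) x) = (T ^^ i) x"
      proof -
        have "(T ^^ (j - i)) ((T ^^ i) x) = (T ^^ (j - i + i)) x" by (simp only: funpow_add o_apply)
        then show ?thesis using that \<open>i < j\<close> by simp
      qed
      then have "(T ^^ i) x = (T ^^ i) 0"
        using no_per[of "j - i"] \<open>i < j\<close> linear_0[OF linear_funpow[OF T(1)]] by simp
      then show "x = 0" using inj_fn[OF T(2), of i] by (simp add: inj_eq)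
    qed
    moreover have "linear ?D" by (intro linear_compose_sub linear_funpow T(1))
    ultimately have "inj ?D" using linear_injective_0 by blast
    moreover have "countable (?D ` (?D -` integer_points))"
      by (rule countable_subset[OF _ countable_integer_points]) auto
    ultimately show ?thesis
      using countable_image_inj_on[of ?D "?D -` integer_points"] by (simp add: vimage_def inj_on_subset)
  qed
  then have "countable (\<Union>j. \<Union>i\<in>{..<j}. {x. (T ^^ i) x - (T ^^ j) x \<in> integer_points})" (is "countable ?U")
    by (intro countable_UN) auto
  moreover have "{x. \<exists>i j. i \<noteq> j \<and> (T ^^ i) x - (T ^^ j) x \<in> integer_points} \<subseteq> ?U"
  proof safe
    fix x i j assume ij: "i \<noteq> (j::nat)" and D: "(T ^^ i) x - (T ^^ j) x \<in> integer_points"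
    have D': "(T ^^ j) x - (T ^^ i) x \<in> integer_points"
      using D by (metis abs_torus_eq_integer)
    show "x \<in> ?U"
    proof (cases "i < j")
      case True
      then show ?thesis using D by (intro UN_I[of j] UN_I[of i]) auto
    next
      case False
      then show ?thesis using D' ij by (intro UN_I[of i] UN_I[of j]) auto
    qed
  qed
  ultimately show ?thesis by (rule countable_subset[rotated])
qed

text \<open>Provides a common bump size \<open>r\<close> for an entire ball of starting points:
  every iterate stays inside the bump of its own step and outside all the others.\<close>

lemma orbit_separation:
  fixes T :: "real ^ 'n::finite \<Rightarrow> real ^ 'n"
  assumes T: "linear T" and x: "\<And>i j. i \<noteq> j \<Longrightarrow> (T ^^ i) x - (T ^^ j) x \<notin> integer_points"
  obtains \<rho> r where "0 < \<rho>"
    "\<And>y i. y \<in> cball x \<rho> \<Longrightarrow> i \<le> k \<Longrightarrow> lattice_gap ((T ^^ i) y - (T ^^ i) x) < r"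
    "\<And>y i j. y \<in> cball x \<rho> \<Longrightarrow> i \<le> k \<Longrightarrow> j \<le> k \<Longrightarrow> i \<noteq> j \<Longrightarrow> r \<le> lattice_gap ((T ^^ i) y - (T ^^ j) x)"
proof -
  let ?g = "\<lambda>i j y. lattice_gap ((T ^^ i) y - (T ^^ j) x)"
  \<comment> \<open>The element 1 keeps the set nonempty when no pair of distinct indices
    exists.\<close>
  define S where "S = insert 1 ((\<lambda>(i, j). ?g i j x) ` ({(i, j). i \<noteq> j} \<inter> {..k} \<times> {..k}))"
  define r where "r = Min S / 2"
  have "finite S" by (simp add: S_def)
  have "?g i j x > 0" if "i \<noteq> j" for i j
    using x[OF that] lattice_gap_nonneg lattice_gap_eq_0_iff by (metis order_le_less)
  then have "\<forall>s\<in>S. 0 < s" by (auto simp: S_def)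
  then have "0 < Min S" using \<open>finite S\<close> by (subst Min_gr_iff) (auto simp: S_def)
  then have r: "0 < r" "r < Min S" by (auto simp: r_def)
  have far: "r < ?g i j x" if "i \<le> k" "j \<le> k" "i \<noteq> j" for i j
    using r(2) \<open>finite S\<close> that by (intro less_le_trans[OF r(2) Min_le]) (auto simp: S_def)
  have lim: "(?g i j \<longlongrightarrow> ?g i j x) (nhds x)" for i j
  proof -
    have "continuous_on UNIV (?g i j)"
      by (intro continuous_on_compose2[OF continuous_on_lattice_gap[of UNIV]] continuous_intros
          linear_continuous_on_compose[OF continuous_on_id linear_funpow[OF T], unfolded id_def]) auto
    then have "isCont (?g i j) x" by (simp add: continuous_on_eq_continuous_at)
    then show ?thesis unfolding isCont_def by (rule tendsto_at_iff_tendsto_nhds[THEN iffD1])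
  qed
  have "\<forall>\<^sub>F y in nhds x. \<forall>i\<in>{..k}. ?g i i y < r"
  proof (intro eventually_ball_finite ballI)
    fix i
    have "?g i i x = 0" by (simp add: lattice_gap_def)
    then show "\<forall>\<^sub>F y in nhds x. ?g i i y < r" using order_tendstoD(2)[OF lim[of i i]] r(1) by simp
  qed simp
  moreover have "\<forall>\<^sub>F y in nhds x. \<forall>i\<in>{..k}. \<forall>j\<in>{..k}. i \<noteq> j \<longrightarrow> r < ?g i j y"
  proof (intro eventually_ball_finite ballI)
    fix i j assume "i \<in> {..k}" "j \<in> {..k}"
    then show "\<forall>\<^sub>F y in nhds x. i \<noteq> j \<longrightarrow> r < ?g i j y"
      using order_tendstoD(1)[OF lim[of i j] far[of i j]] by (cases "i = j") auto
  qed auto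
  ultimately have "\<forall>\<^sub>F y in nhds x. (\<forall>i\<in>{..k}. ?g i i y < r) \<and> (\<forall>i\<in>{..k}. \<forall>j\<in>{..k}. i \<noteq> j \<longrightarrow> r < ?g i j y)"
    by (rule eventually_conj)
  then obtain d where d: "0 < d" "\<And>y. dist y x < d \<Longrightarrow>
      (\<forall>i\<in>{..k}. ?g i i y < r) \<and> (\<forall>i\<in>{..k}. \<forall>j\<in>{..k}. i \<noteq> j \<longrightarrow> r < ?g i j y)"
    unfolding eventually_nhds_metric by auto
  have near: "dist y x < d" if "y \<in> cball x (d / 2)" for y
    using that d(1) by (auto simp: dist_commute)
  show ?thesis
    by (rule that[of "d / 2" r]) (use d near in \<open>auto intro: less_imp_le\<close>)
qed

theorem theorem5:
  fixes f :: "'n::finite torus \<Rightarrow> 'n torus" and \<epsilon> :: real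
  assumes "hyperbolic_toral_automorphism f" and "0 < \<epsilon>"
  shows "\<exists>\<V>. residual_in C2_unit_fields_topology \<V> \<and>
           (\<forall>V\<in>\<V>. \<forall>\<mu>. invariant_measure (rank1_perturbation f V \<epsilon>) \<mu> \<longrightarrow>
                      absolutely_continuous torus_measure \<mu>)"
proof -
  obtain A :: "int ^ 'n ^ 'n" where det: "det A = 1 \<or> det A = - 1"
    and f: "\<And>x. f (abs_torus x) = abs_torus (map_matrix of_int A *v x)"
    and hyp: "\<And>z :: complex. \<exists>v. v \<noteq> 0 \<and> map_matrix of_int A *v v = z *s v \<Longrightarrow> cmod z \<noteq> 1"
    using assms(1) unfolding hyperbolic_toral_automorphism_def by blast
  define T :: "real ^ 'n \<Rightarrow> real ^ 'n" where "T = (*v) (map_matrix of_int A)"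
  have T: "linear T" by (simp add: T_def)
  have "det (map_matrix of_int A :: real ^ 'n ^ 'n) \<noteq> 0" using det by (auto simp: det_map_matrix_of_int)
  then have injT: "inj T" unfolding T_def 
    using det_nz_iff_inj[of "(*v) (map_matrix of_int A :: real ^ 'n ^ 'n)"] by simp
  have surjT: "surj (T ^^ i)" for i
    by (intro surj_fn linear_inj_imp_surj T injT)
  define F where "F = {x. \<exists>i j. i \<noteq> j \<and> (T ^^ i) x - (T ^^ j) x \<in> integer_points}"
  have countF: "countable F"
    unfolding F_def using hyperbolic_no_periodic_vector[OF hyp] T injT
    by (intro countable_resonant_points) (auto simp: T_def)

  text \<open>\<open>2n + 1\<close> steps for each basis direction, one more than the variables \<open>(y, \<xi>)\<close> to be avoided.\<close>
  define k where "k = CARD('n \<times> ('n + 'n) option)"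
  obtain e :: "nat \<Rightarrow> 'n \<times> ('n + 'n) option" where e: "bij_betw e {..<k} UNIV"
    using ex_bij_betw_nat_finite[of "UNIV :: ('n \<times> ('n + 'n) option) set"] by (auto simp: k_def atLeast0LessThan)
  \<comment> \<open>The step number of the pair \<open>(a, l)\<close>; for a fixed coordinate
    \<open>a\<close>, the index \<open>l\<close> runs through 2n + 1 distinct steps.\<close>
  define j where "j = the_inv_into {..<k} e"
  have j: "j p < k" for p
    using e the_inv_into_into[of e "{..<k}" p "{..<k}"] by (auto simp: j_def bij_betw_def)
  have inj_j: "j p = j q \<longleftrightarrow> p = q" for p q
    using inj_on_the_inv_into[of e "{..<k}"] e by (auto simp: j_def bij_betw_def inj_on_eq_iff)
  let ?C = "\<lambda>a l. T ^^ (k - 1 - j (a, l))" and ?g = "\<lambda>a l. T ^^ Suc (j (a, l))"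

  have "\<exists>\<rho> r. 0 < \<rho> \<and> (\<forall>y\<in>cball x \<rho>. \<forall>i\<le>k. lattice_gap ((T ^^ i) y - (T ^^ i) x) < r) \<and>
      (\<forall>y\<in>cball x \<rho>. \<forall>i\<le>k. \<forall>j\<le>k. i \<noteq> j \<longrightarrow> r \<le> lattice_gap ((T ^^ i) y - (T ^^ j) x))" if "x \<notin> F" for x
    using orbit_separation[OF T, of x k] that unfolding F_def by (metis (mono_tags, lifting) mem_Collect_eq)
  then obtain \<rho> r where \<rho>: "\<And>x. x \<notin> F \<Longrightarrow> 0 < \<rho> x"
    and inside: "\<And>x y i. x \<notin> F \<Longrightarrow> y \<in> cball x (\<rho> x) \<Longrightarrow> i \<le> k \<Longrightarrow> lattice_gap ((T ^^ i) y - (T ^^ i) x) < r x"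
    and outside: "\<And>x y i j. x \<notin> F \<Longrightarrow> y \<in> cball x (\<rho> x) \<Longrightarrow> i \<le> k \<Longrightarrow> j \<le> k \<Longrightarrow> i \<noteq> j \<Longrightarrow>
      r x \<le> lattice_gap ((T ^^ i) y - (T ^^ j) x)"
    by metis
  \<comment> \<open>The balls around all nonresonant points are replaced by countably many with the
    same union, to leave countably many open dense conditions.\<close>
  obtain \<F> where \<F>: "\<F> \<subseteq> (\<lambda>x. ball x (\<rho> x)) ` (- F)" "countable \<F>" "\<Union>\<F> = \<Union>((\<lambda>x. ball x (\<rho> x)) ` (- F))"
    using Lindelof[of "(\<lambda>x. ball x (\<rho> x)) ` (- F)"] by auto
  then obtain X where X: "countable X" "X \<subseteq> - F" "\<F> = (\<lambda>x. ball x (\<rho> x)) ` X"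
    using countable_subset_image[of \<F> "\<lambda>x. ball x (\<rho> x)" "- F"] by auto

  define G where "G = (\<lambda>(x, a, m :: nat). spanning_fields (?C a) (?g a) (cball x (\<rho> x)) a (real m))"
  define \<V> where "\<V> = C2_unit_fields \<inter> \<Inter>(G ` (X \<times> UNIV \<times> UNIV))"
  have top: "topspace C2_unit_fields_topology = C2_unit_fields"
    by (simp add: C2_unit_fields_topology_def)
  have "openin C2_unit_fields_topology (G p) \<and> C2_unit_fields_topology closure_of (G p) = topspace C2_unit_fields_topology"
    if "p \<in> X \<times> UNIV \<times> UNIV" for p
  proof -
    obtain x a m where p: "p = (x, a, m)" "x \<in> X" using \<open>p \<in> X \<times> UNIV \<times> UNIV\<close> by auto
    with X(2) have x: "x \<notin> F" by auto
    \<comment> \<open>Steps are numbered from 0 but the field is evaluated at iterates 1 to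
      \<open>k\<close>, hence separation up to \<open>k\<close> inclusive.\<close>
    have "Suc (j q) \<le> k" for q using j[of q] by simp
    then show ?thesis
      unfolding p(1) G_def prod.case using inside[OF x] outside[OF x]
      by (intro conjI openin_spanning_fields dense_spanning_fields[where c = x and r = "r x"] linear_funpow T surjT
          compact_cball) (auto simp: inj_j simp del: funpow.simps)
  qed
  then have "residual_in C2_unit_fields_topology \<V>"
    unfolding residual_in_def \<V>_def top using X(1)
    by (intro conjI exI[of _ "G ` (X \<times> UNIV \<times> UNIV)"]) auto
  moreover have "absolutely_continuous torus_measure \<mu>"
    if V: "V \<in> \<V>" and inv: "invariant_measure (rank1_perturbation f V \<epsilon>) \<mu>" for V \<mu>
  proof -
    have VC2: "V \<in> C2_unit_fields" using V by (simp add: \<V>_def)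
    then obtain L where "torus_field V L" using C2_unit_fields_torus_field by blast
    then interpret torus_field V L .
    show ?thesis
    proof (rule invariant_measure_absolutely_continuous[where F = F, OF _ T injT \<open>0 < \<epsilon>\<close> bij_betw_imp_inj_on[OF e] _ countF _ inv])
      show "f (abs_torus x) = abs_torus (T x)" for x by (simp add: f T_def)
      show "V p \<noteq> 0" for p
      proof -
        have "norm (V p) = 1" using VC2 by (simp add: C2_unit_fields_def)
        then show ?thesis by auto
      qed
      fix x \<xi> :: "real ^ 'n" assume "x \<notin> F" "\<xi> \<noteq> 0"
      then have "x \<in> \<Union>((\<lambda>x. ball x (\<rho> x)) ` (- F))" using \<rho> by (auto intro!: bexI[of _ x])
      then have "x \<in> \<Union>((\<lambda>x. ball x (\<rho> x)) ` X)" by (simp only: \<F>(3)[symmetric] X(3))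
      then obtain x' where x': "x' \<in> X" "x \<in> cball x' (\<rho> x')" by (auto simp: less_imp_le)
      obtain a where a: "\<xi> $ a \<noteq> 0" using \<open>\<xi> \<noteq> 0\<close> by (auto simp: vec_eq_iff)
      \<comment> \<open>The conditions concern functionals with a coordinate equal to 1 and bounded
        norm; rescaling a given \<open>\<xi>\<close> by a nonzero coordinate brings it into one of
        them without affecting which pairings vanish.\<close>
      define \<zeta> where "\<zeta> = (1 / \<xi> $ a) *\<^sub>R \<xi>"
      obtain m where m: "norm \<zeta> \<le> real m" using real_arch_simple by blast
      have "V \<in> G (x', a, m)" using V x'(1) by (auto simp: \<V>_def)
      moreover have "\<zeta> $ a = 1" using a by (simp add: \<zeta>_def)
      ultimately obtain l where "\<zeta> \<bullet> ?C a l (V (abs_torus (?g a l x))) \<noteq> 0"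
        using x'(2) m unfolding G_def spanning_fields_def prod.case by blast
      then have "\<xi> \<bullet> ?C a l (V (abs_torus (?g a l x))) \<noteq> 0" by (auto simp: \<zeta>_def)
      then show "\<exists>j<k. \<xi> \<bullet> (T ^^ (k - 1 - j)) (V (abs_torus ((T ^^ Suc j) x))) \<noteq> 0"
        using j by blast
    qed
  qed
  ultimately show ?thesis by blast
qed

end
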